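(* Let $M$ be a smooth manifold and let $D\subseteq\mathfrak X_{\mathrm{loc}}(M)$ be everywhere defined. Suppose that each $m\in M$ has a neighborhood $U$ on which there exists a finite-dimensional Lie algebra $\mathcal L_U$ of vector fields which generates $D|_U$ in the sense that each element of $D|_U$ is a $C^\infty$-linear combination of elements of $\mathcal L_U$. Then the induced distribution $\Delta_D$ on $M$ is integrable.
   Context: Manifolds are smooth, Hausdorff and paracompact. $\mathfrak{X}_{\mathrm{loc}}(M)=\bigcup\{\mathfrak X(U): U\subseteq M\text{ open}\}$ is the set of local vector fields on $M$. A subset $D\subseteq\mathfrak{X}_{\mathrm{loc}}(M)$ is everywhere defined if the domains of its elements cover $M$. $D|_U$ denotes the set of restrictions to $U$ of the elements of $D$. A distribution on $M$ assigns to every $m\in M$ a linear subspace of $T_mM$ (of possibly varying dimension); the distribution induced by $D$ is $\Delta_D(m)=\mathrm{span}\{X(m):X\in D,\ m\in\mathrm{dom}X\}$. A distribution is smooth if it is of the form $\Delta_{D}$ for some everywhere defined $D\subseteq\mathfrak X_{\mathrm{loc}}(M)$. For a distribution $\Delta$, $D_\Delta$ is the set of $X\in\mathfrak X_{\mathrm{loc}}(M)$ with $X(m)\in\Delta(m)$ for all $m\in\mathrm{dom}X$. The orbit of $m$ is the set of all points that can be reached from $m$ by finite compositions of flow maps $\mathrm{Fl}^X_t$, $X\in D_\Delta$, $t\in\mathbb R$; it is trivial if it equals $\{m\}$. An immersive submanifold of $M$ is a subset with a manifold structure for which the inclusion into $M$ is an immersion; an integral manifold of $\Delta$ is an immersive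 submanifold $S$ with $T_sS=\Delta(s)$ for all $s\in S$. A smooth distribution $\Delta$ is integrable if for every $m\in M$ either the orbit of $m$ is trivial or there is an integral manifold of $\Delta$ containing $m$.
   Formalization: "Generates" is taken to include that the elements of L_U are tangent to Δ_D; without this the claim fails, e.g. for D = {∂x, ∂y + x∂z} on R³ with L_U spanned by the coordinate fields. *)

theory Defs
  imports "HOL-Analysis.Analysis" "HOL-Library.Function_Algebras"
begin

section \<open>Functions as a real vector space\<close>

instantiation "fun" :: (type, real_vector) real_vector
begin

definition scaleR_fun :: "real \<Rightarrow> ('a \<Rightarrow> 'b) \<Rightarrow> 'a \<Rightarrow> 'b"
  where "scaleR_fun r f = (\<lambda>x. r *\<^sub>R f x)"

instance
  by standard (simp_all add: scaleR_fun_def fun_eq_iff scaleR_add_right scaleR_add_left)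

end


section \<open>Smooth functions between Euclidean spaces\<close>

text \<open>\<open>times_differentiable_on k f S\<close> is the usual notion of a \<open>C\<^sup>k\<close> function only for open \<open>S\<close>.\<close>

primrec times_differentiable_on ::
    "nat \<Rightarrow> ('e::euclidean_space \<Rightarrow> 'f::real_normed_vector) \<Rightarrow> 'e set \<Rightarrow> bool" where
  "times_differentiable_on 0 f S \<longleftrightarrow> continuous_on S f"
| "times_differentiable_on (Suc k) f S \<longleftrightarrow>
     (\<forall>x\<in>S. f differentiable (at x)) \<and>
     (\<forall>h. times_differentiable_on k (\<lambda>x. frechet_derivative f (at x) h) S)"

text \<open>On an arbitrary set, smooth means locally extendable to a smooth function on an open subset of
  the ambient space. It is only used on relatively open subsets of a linear subspace \<open>V\<close>, where it
  coincides with smoothness as a function on an open subset of the vector space \<open>V\<close>.\<close>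

definition smooth_on :: "'e::euclidean_space set \<Rightarrow> ('e \<Rightarrow> 'f::real_normed_vector) \<Rightarrow> bool" where
  "smooth_on A f \<longleftrightarrow>
     (\<forall>x\<in>A. \<exists>W g. open W \<and> x \<in> W \<and> (\<forall>k. times_differentiable_on k g W) \<and> (\<forall>y\<in>A \<inter> W. g y = f y))"

text \<open>The derivative of \<open>f\<close> at \<open>x\<close> applied to \<open>h\<close>. For smooth \<open>f\<close> on a relatively open subset of a
  subspace \<open>V\<close> and \<open>h \<in> V\<close> this is the total derivative, and it depends only on the values of \<open>f\<close> in
  \<open>V\<close> (whereas \<open>frechet_derivative\<close> within a proper subspace is not unique).\<close>

definition deriv_along ::
    "('e::real_normed_vector \<Rightarrow> 'f::real_normed_vector) \<Rightarrow> 'e \<Rightarrow> 'e \<Rightarrow> 'f" where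
  "deriv_along f x h = vector_derivative (\<lambda>t. f (x + t *\<^sub>R h)) (at 0)"


section \<open>Smooth manifolds\<close>

definition paracompact_space :: "'a topology \<Rightarrow> bool" where
  "paracompact_space X \<longleftrightarrow>
     (\<forall>\<U>. (\<forall>U\<in>\<U>. openin X U) \<and> \<Union>\<U> = topspace X \<longrightarrow>
        (\<exists>\<V>. (\<forall>V\<in>\<V>. openin X V) \<and> \<Union>\<V> = topspace X \<and>
             (\<forall>V\<in>\<V>. \<exists>U\<in>\<U>. V \<subseteq> U) \<and> locally_finite_in X \<V>))"

text \<open>A chart consists of its domain and its coordinate map. Charts take values in a linear subspace
  \<open>model\<close> of a Euclidean space rather than in the whole space, so that manifolds of any dimension
  \<open>dim (model M) \<le> DIM('e)\<close>, in particular submanifolds, live in the same type. The values of a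
  coordinate map outside the domain of the chart are irrelevant.\<close>

type_synonym ('a, 'e) chart = "'a set \<times> ('a \<Rightarrow> 'e)"

abbreviation chart_dom :: "('a, 'e) chart \<Rightarrow> 'a set" where "chart_dom \<equiv> fst"
abbreviation chart_map :: "('a, 'e) chart \<Rightarrow> 'a \<Rightarrow> 'e" where "chart_map \<equiv> snd"

definition chart_inv :: "('a, 'e) chart \<Rightarrow> 'e \<Rightarrow> 'a" where
  "chart_inv c = inv_into (chart_dom c) (chart_map c)"

record ('a, 'e) manifold =
  model :: "'e set"
  mtop :: "'a topology"
  atlas :: "('a, 'e) chart set"

abbreviation carrier :: "('a, 'e) manifold \<Rightarrow> 'a set" where
  "carrier M \<equiv> topspace (mtop M)"

definition charts_at :: "('a, 'e) manifold \<Rightarrow> 'a \<Rightarrow> ('a, 'e) chart set" where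
  "charts_at M m = {c \<in> atlas M. m \<in> chart_dom c}"

definition topological_chart :: "('a, 'e::euclidean_space) manifold \<Rightarrow> ('a, 'e) chart \<Rightarrow> bool" where
  "topological_chart M c \<longleftrightarrow>
     openin (mtop M) (chart_dom c) \<and>
     openin (top_of_set (model M)) (chart_map c ` chart_dom c) \<and>
     homeomorphic_map (subtopology (mtop M) (chart_dom c))
       (top_of_set (chart_map c ` chart_dom c)) (chart_map c)"

definition smooth_manifold :: "('a, 'e::euclidean_space) manifold \<Rightarrow> bool" where
  "smooth_manifold M \<longleftrightarrow>
     subspace (model M) \<and>
     Hausdorff_space (mtop M) \<and> paracompact_space (mtop M) \<and>
     (\<forall>c\<in>atlas M. topological_chart M c) \<and>
     (\<Union>c\<in>atlas M. chart_dom c) = carrier M \<and>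
     (\<forall>c\<in>atlas M. \<forall>d\<in>atlas M.
        smooth_on (chart_map c ` (chart_dom c \<inter> chart_dom d)) (chart_map d \<circ> chart_inv c))"

definition smooth_map ::
    "('a, 'e::euclidean_space) manifold \<Rightarrow> ('b, 'f::euclidean_space) manifold \<Rightarrow> ('a \<Rightarrow> 'b) \<Rightarrow> bool" where
  "smooth_map M N f \<longleftrightarrow>
     continuous_map (mtop M) (mtop N) f \<and>
     (\<forall>c\<in>atlas M. \<forall>d\<in>atlas N.
        smooth_on (chart_map c ` (chart_dom c \<inter> f -` chart_dom d)) (chart_map d \<circ> f \<circ> chart_inv c))"

definition smooth_real_functions ::
    "('a, 'e::euclidean_space) manifold \<Rightarrow> 'a set \<Rightarrow> ('a \<Rightarrow> real) set" where
  "smooth_real_functions M U =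
     {f. \<forall>c\<in>atlas M. smooth_on (chart_map c ` (chart_dom c \<inter> U)) (f \<circ> chart_inv c)}"


section \<open>Tangent vectors\<close>

text \<open>A tangent vector at \<open>m\<close> is the family of its coordinate representations in the charts around
  \<open>m\<close>, related to each other by the derivatives of the transition maps, and zero in all other charts.
  The vector space operations are pointwise.\<close>

type_synonym ('a, 'e) tvec = "('a, 'e) chart \<Rightarrow> 'e"

definition tangent_space :: "('a, 'e::euclidean_space) manifold \<Rightarrow> 'a \<Rightarrow> ('a, 'e) tvec set" where
  "tangent_space M m =
     {\<xi>. (\<forall>c. c \<notin> charts_at M m \<longrightarrow> \<xi> c = 0) \<and>
         (\<forall>c\<in>charts_at M m. \<xi> c \<in> model M) \<and>
         (\<forall>c\<in>charts_at M m. \<forall>d\<in>charts_at M m.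
            \<xi> d = deriv_along (chart_map d \<circ> chart_inv c) (chart_map c m) (\<xi> c))}"

text \<open>By the chain rule the choice of the chart \<open>c\<close> does not matter for smooth \<open>f\<close>.\<close>

definition tangent_map ::
    "('a, 'e::euclidean_space) manifold \<Rightarrow> ('b, 'f::euclidean_space) manifold \<Rightarrow> ('a \<Rightarrow> 'b) \<Rightarrow> 'a \<Rightarrow>
      ('a, 'e) tvec \<Rightarrow> ('b, 'f) tvec" where
  "tangent_map M N f m \<xi> = (\<lambda>d.
     if d \<in> charts_at N (f m) then
       (let c = (SOME c. c \<in> charts_at M m)
        in deriv_along (chart_map d \<circ> f \<circ> chart_inv c) (chart_map c m) (\<xi> c))
     else 0)"

definition immersion ::
    "('a, 'e::euclidean_space) manifold \<Rightarrow> ('b, 'f::euclidean_space) manifold \<Rightarrow> ('a \<Rightarrow> 'b) \<Rightarrow> bool" where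
  "immersion M N f \<longleftrightarrow>
     smooth_map M N f \<and> (\<forall>m\<in>carrier M. inj_on (tangent_map M N f m) (tangent_space M m))"

text \<open>Since the inclusion is an immersion, \<open>dim (model S) \<le> dim (model M)\<close>, so there is no loss in
  letting \<open>S\<close> have its model space in the same Euclidean space as \<open>M\<close>.\<close>

definition immersive_submanifold ::
    "('a, 'e::euclidean_space) manifold \<Rightarrow> ('a, 'e) manifold \<Rightarrow> bool" where
  "immersive_submanifold S M \<longleftrightarrow>
     smooth_manifold S \<and> carrier S \<subseteq> carrier M \<and> immersion S M (\<lambda>s. s)"


section \<open>Local vector fields\<close>

text \<open>A vector field on \<open>U\<close> is represented by the function that is zero outside \<open>U\<close>, so that equality
  and the vector space operations on functions are those of vector fields on \<open>U\<close>. A local vector field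
  is paired with its domain.\<close>

type_synonym ('a, 'e) vfield = "'a \<Rightarrow> ('a, 'e) tvec"
type_synonym ('a, 'e) local_vfield = "'a set \<times> ('a, 'e) vfield"

definition vfield_in_chart :: "('a, 'e) chart \<Rightarrow> ('a, 'e) vfield \<Rightarrow> 'e \<Rightarrow> 'e" where
  "vfield_in_chart c X = (\<lambda>x. X (chart_inv c x) c)"

definition vector_fields_on ::
    "('a, 'e::euclidean_space) manifold \<Rightarrow> 'a set \<Rightarrow> ('a, 'e) vfield set" where
  "vector_fields_on M U =
     {X. (\<forall>m\<in>U. X m \<in> tangent_space M m) \<and> (\<forall>m. m \<notin> U \<longrightarrow> X m = 0) \<and>
         (\<forall>c\<in>atlas M. smooth_on (chart_map c ` (chart_dom c \<inter> U)) (vfield_in_chart c X))}"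

definition local_vector_fields ::
    "('a, 'e::euclidean_space) manifold \<Rightarrow> ('a, 'e) local_vfield set" where
  "local_vector_fields M = {(U, X). openin (mtop M) U \<and> X \<in> vector_fields_on M U}"

definition restrict_vfield ::
    "'a set \<Rightarrow> ('a, 'e::euclidean_space) local_vfield \<Rightarrow> ('a, 'e) local_vfield" where
  "restrict_vfield U = (\<lambda>(V, X). (V \<inter> U, \<lambda>m. if m \<in> U then X m else 0))"

definition everywhere_defined ::
    "('a, 'e::euclidean_space) manifold \<Rightarrow> ('a, 'e) local_vfield set \<Rightarrow> bool" where
  "everywhere_defined M D \<longleftrightarrow> (\<Union>(U, X)\<in>D. U) = carrier M"

definition lie_bracket ::
    "('a, 'e::euclidean_space) manifold \<Rightarrow> 'a set \<Rightarrow> ('a, 'e) vfield \<Rightarrow> ('a, 'e) vfield \<Rightarrow> ('a, 'e) vfield" where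
  "lie_bracket M U X Y = (\<lambda>m c.
     if m \<in> U \<and> c \<in> charts_at M m then
       deriv_along (vfield_in_chart c Y) (chart_map c m) (X m c) -
       deriv_along (vfield_in_chart c X) (chart_map c m) (Y m c)
     else 0)"

definition finite_dim_lie_algebra_on ::
    "('a, 'e::euclidean_space) manifold \<Rightarrow> 'a set \<Rightarrow> ('a, 'e) vfield set \<Rightarrow> bool" where
  "finite_dim_lie_algebra_on M U L \<longleftrightarrow>
     L \<subseteq> vector_fields_on M U \<and> subspace L \<and> (\<exists>B. finite B \<and> L = span B) \<and>
     (\<forall>X\<in>L. \<forall>Y\<in>L. lie_bracket M U X Y \<in> L)"

definition smooth_linear_combination ::
    "('a, 'e::euclidean_space) manifold \<Rightarrow> ('a, 'e) vfield set \<Rightarrow> ('a, 'e) local_vfield \<Rightarrow> bool" where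
  "smooth_linear_combination M L = (\<lambda>(V, Y).
     \<exists>F a. finite F \<and> F \<subseteq> L \<and> (\<forall>X\<in>F. a X \<in> smooth_real_functions M V) \<and>
           (\<forall>m\<in>V. Y m = (\<Sum>X\<in>F. a X m *\<^sub>R X m)))"


section \<open>Distributions\<close>

definition distribution ::
    "('a, 'e::euclidean_space) manifold \<Rightarrow> ('a \<Rightarrow> ('a, 'e) tvec set) \<Rightarrow> bool" where
  "distribution M \<Delta> \<longleftrightarrow> (\<forall>m\<in>carrier M. subspace (\<Delta> m) \<and> \<Delta> m \<subseteq> tangent_space M m)"

definition induced_distribution ::
    "('a, 'e::euclidean_space) local_vfield set \<Rightarrow> 'a \<Rightarrow> ('a, 'e) tvec set" where
  "induced_distribution D m = span {X m |U X. (U, X) \<in> D \<and> m \<in> U}"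

definition smooth_distribution ::
    "('a, 'e::euclidean_space) manifold \<Rightarrow> ('a \<Rightarrow> ('a, 'e) tvec set) \<Rightarrow> bool" where
  "smooth_distribution M \<Delta> \<longleftrightarrow>
     distribution M \<Delta> \<and>
     (\<exists>D \<subseteq> local_vector_fields M. everywhere_defined M D \<and>
        (\<forall>m\<in>carrier M. \<Delta> m = induced_distribution D m))"

definition tangent_fields ::
    "('a, 'e::euclidean_space) manifold \<Rightarrow> ('a \<Rightarrow> ('a, 'e) tvec set) \<Rightarrow> ('a, 'e) local_vfield set" where
  "tangent_fields M \<Delta> = {(U, X) \<in> local_vector_fields M. \<forall>m\<in>U. X m \<in> \<Delta> m}"

definition integral_curve ::
    "('a, 'e::euclidean_space) manifold \<Rightarrow> ('a, 'e) local_vfield \<Rightarrow> real set \<Rightarrow> (real \<Rightarrow> 'a) \<Rightarrow> bool" where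
  "integral_curve M = (\<lambda>(U, X) J \<gamma>.
     \<gamma> ` J \<subseteq> U \<and> continuous_map (top_of_set J) (mtop M) \<gamma> \<and>
     (\<forall>t\<in>J. \<forall>c\<in>charts_at M (\<gamma> t).
        ((\<lambda>u. chart_map c (\<gamma> u)) has_vector_derivative X (\<gamma> t) c) (at t)))"

text \<open>\<open>flow_rel M X t\<close> is the graph of the partially defined flow map \<open>Fl\<^sup>X\<^sub>t\<close>: it relates \<open>m\<close> to the
  value at time \<open>t\<close> of the integral curve of \<open>X\<close> starting at \<open>m\<close>.\<close>

definition flow_rel ::
    "('a, 'e::euclidean_space) manifold \<Rightarrow> ('a, 'e) local_vfield \<Rightarrow> real \<Rightarrow> 'a \<Rightarrow> 'a \<Rightarrow> bool" where
  "flow_rel M X t m m' \<longleftrightarrow>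
     (\<exists>J \<gamma>. open J \<and> is_interval J \<and> 0 \<in> J \<and> t \<in> J \<and> integral_curve M X J \<gamma> \<and> \<gamma> 0 = m \<and> \<gamma> t = m')"

definition orbit ::
    "('a, 'e::euclidean_space) manifold \<Rightarrow> ('a \<Rightarrow> ('a, 'e) tvec set) \<Rightarrow> 'a \<Rightarrow> 'a set" where
  "orbit M \<Delta> m = {m'. (\<lambda>p q. \<exists>X\<in>tangent_fields M \<Delta>. \<exists>t. flow_rel M X t p q)\<^sup>*\<^sup>* m m'}"

definition integral_manifold ::
    "('a, 'e::euclidean_space) manifold \<Rightarrow> ('a \<Rightarrow> ('a, 'e) tvec set) \<Rightarrow> ('a, 'e) manifold \<Rightarrow> bool" where
  "integral_manifold M \<Delta> S \<longleftrightarrow>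
     immersive_submanifold S M \<and>
     (\<forall>s\<in>carrier S. tangent_map S M (\<lambda>s. s) s ` tangent_space S s = \<Delta> s)"

definition integrable_distribution ::
    "('a, 'e::euclidean_space) manifold \<Rightarrow> ('a \<Rightarrow> ('a, 'e) tvec set) \<Rightarrow> bool" where
  "integrable_distribution M \<Delta> \<longleftrightarrow>
     smooth_distribution M \<Delta> \<and>
     (\<forall>m\<in>carrier M. orbit M \<Delta> m = {m} \<or> (\<exists>S. integral_manifold M \<Delta> S \<and> m \<in> carrier S))"

text \<open>A Lie algebra that generates \<open>D\<close> on \<open>U\<close> is understood to consist of fields tangent to the
  distribution induced by \<open>D\<close>. Without this (first) condition, the commuting coordinate fields of a
  chart would generate every \<open>D\<close>, integrable or not. It holds in particular if \<open>L\<close> is contained in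
  \<open>D|\<^sub>U\<close> or in the \<open>C\<^sup>\<infinity>\<close>-module spanned by \<open>D|\<^sub>U\<close>.\<close>

definition generates_on ::
    "('a, 'e::euclidean_space) manifold \<Rightarrow> 'a set \<Rightarrow> ('a, 'e) vfield set \<Rightarrow> ('a, 'e) local_vfield set \<Rightarrow> bool" where
  "generates_on M U L D \<longleftrightarrow>
     (\<forall>X\<in>L. (U, X) \<in> tangent_fields M (induced_distribution D)) \<and>
     (\<forall>Y\<in>restrict_vfield U ` D. smooth_linear_combination M L Y)"

end

theory Submission
  imports Defs
begin

text \<open>In a chart let \<open>X\<^sub>1, \<dots>, X\<^sub>N\<close> span the Lie algebra, let \<open>E\<close> be the span of the \<open>X\<^sub>j(x0)\<close> and \<open>\<pi>\<close> a
  projection onto \<open>E\<close>. Near \<open>x0\<close> there are smooth combinations \<open>F h\<close> of the \<open>X\<^sub>j\<close>, linear in \<open>h\<close>, with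
  \<open>\<pi> (F h) = \<pi> h\<close>. Put \<open>Z\<^sub>j = X\<^sub>j - F(X\<^sub>j)\<close>. Since brackets of combinations of the \<open>X\<^sub>j\<close> are again such
  combinations, and since those annihilated by \<open>\<pi>\<close> are combinations of the \<open>Z\<^sub>j\<close>, the brackets \<open>[F h, Z\<^sub>j]\<close>
  and \<open>[F h, F k]\<close> are combinations of the \<open>Z\<^sub>j\<close>. By Gronwall's inequality the \<open>Z\<^sub>j\<close> therefore vanish along
  the integral curves of \<open>F h\<close> from \<open>x0\<close>: the span of the \<open>X\<^sub>j\<close> has constant dimension there although
  its dimension may jump elsewhere, and \<open>F h\<close>, \<open>F k\<close> commute there. Hence the time-one map \<open>G h\<close> of these
  curves satisfies \<open>DG(h) k = F k (G h)\<close>. This equation gives smoothness of \<open>G\<close> by bootstrapping and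
  shows that \<open>G\<close> restricted to \<open>E\<close> parametrises an integral manifold through \<open>x0\<close>. Thus every point lies on an
  integral manifold, whether its orbit is trivial or not.\<close>

section \<open>Calculus of times differentiable functions\<close>

text \<open>The obstacle is that the rank of the distribution may jump, so in general no frame of
  commuting fields spans it near \<open>x0\<close>. The relations that make a leaf integrable hold
  only on the leaf, which must be constructed before they are known. The fields \<open>F h\<close>
  break this circle: they exist on a full neighbourhood, and closure under brackets makes the
  equation for the \<open>Z\<close> along their curves a finite homogeneous system. Taking time one
  for all small \<open>h\<close>, instead of small times for fixed \<open>h\<close>, turns the
  curves into one map \<open>G\<close> on a ball. Commutation predicts its derivative in closed
  form, so differentiability becomes the verification of a candidate with quadratic error. Although
  only \<open>E\<close> matters in the end, \<open>G\<close> lives on a ball of the whole Euclidean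
  space, where total derivatives are unambiguous; for the same reason fields in a chart are first
  extended off the model space. Since \<open>F h\<close> has constant projection, \<pi> recovers the
  parameter from a point of the leaf. Hence one chart suffices for the leaf, with the subspace
  topology.\<close>

lemma times_differentiable_on_cong:
  assumes "open S" "\<And>x. x \<in> S \<Longrightarrow> f x = g x" "times_differentiable_on k f S"
  shows "times_differentiable_on k g S"
  using assms(2,3)
proof (induction k arbitrary: f g)
  case 0
  then show ?case by (simp cong: continuous_on_cong)
next
  case (Suc k)
  have d: "(g has_derivative frechet_derivative f (at x)) (at x)" if "x \<in> S" for x
    using Suc.prems that assms(1)
    by (metis frechet_derivative_works has_derivative_transform_within_open times_differentiable_on.simps(2))
  then have eq: "frechet_derivative g (at x) = frechet_derivative f (at x)" if "x \<in> S" for x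
    using that by (metis frechet_derivative_at)
  have "times_differentiable_on k (\<lambda>x. frechet_derivative g (at x) h) S" for h
    by (rule Suc.IH[of "\<lambda>x. frechet_derivative f (at x) h"]) (use eq Suc.prems(2) in auto)
  then show ?case using d by (auto simp: differentiable_def)
qed

lemma times_differentiable_on_subset:
  "times_differentiable_on k f S \<Longrightarrow> T \<subseteq> S \<Longrightarrow> times_differentiable_on k f T"
  by (induction k arbitrary: f) (auto intro: continuous_on_subset)

lemma times_differentiable_on_local:
  assumes "\<And>x. x \<in> S \<Longrightarrow> \<exists>W. open W \<and> x \<in> W \<and> times_differentiable_on k f W"
  shows "times_differentiable_on k f S"
  using assms
proof (induction k arbitrary: f)
  case 0
  have "isCont f x" if "x \<in> S" for x
    using 0 that continuous_on_eq_continuous_at by fastforce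
  then show ?case by (simp add: continuous_at_imp_continuous_on)
next
  case (Suc k)
  then show ?case by (simp; meson)
qed

text \<open>The recursion is phrased with the choice operator \<open>frechet_derivative\<close>; the
  closure properties are proved through an explicitly given derivative instead, which this rule
  permits.\<close>

lemma times_differentiable_onI:
  assumes "open S" "\<And>x. x \<in> S \<Longrightarrow> (f has_derivative f' x) (at x)"
    "\<And>h. times_differentiable_on k (\<lambda>x. f' x h) S"
  shows "times_differentiable_on (Suc k) f S"
proof -
  have eq: "f' x = frechet_derivative f (at x)" if "x \<in> S" for x
    using assms(2)[OF that] frechet_derivative_at by blast
  have "times_differentiable_on k (\<lambda>x. frechet_derivative f (at x) h) S" for h
    by (rule times_differentiable_on_cong[of S "\<lambda>x. f' x h"]) (use eq assms(1,3) in auto)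
  then show ?thesis using assms(2) by (auto simp: differentiable_def)
qed

lemma times_differentiable_on_has_derivative:
  "times_differentiable_on (Suc k) f S \<Longrightarrow> x \<in> S \<Longrightarrow>
    (f has_derivative frechet_derivative f (at x)) (at x)"
  by (simp add: frechet_derivative_works[symmetric])

lemma times_differentiable_on_Suc_imp:
  "times_differentiable_on (Suc k) f S \<Longrightarrow> times_differentiable_on k f S"
proof (induction k arbitrary: f)
  case 0
  then show ?case
    by (auto intro!: continuous_at_imp_continuous_on differentiable_imp_continuous_within)
next
  case (Suc k)
  then show ?case by (metis times_differentiable_on.simps(2))
qed

lemma times_differentiable_on_const [simp]: "times_differentiable_on k (\<lambda>x. c) S"
  by (induction k arbitrary: c) auto

lemma times_differentiable_on_linear_comp:
  assumes "bounded_linear l" "open S" "times_differentiable_on k f S"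
  shows "times_differentiable_on k (\<lambda>x. l (f x)) S"
  using assms(3)
proof (induction k arbitrary: f)
  case 0
  then show ?case using assms(1) by (simp add: bounded_linear.continuous_on)
next
  case (Suc k)
  show ?case
  proof (rule times_differentiable_onI[where f' = "\<lambda>x h. l (frechet_derivative f (at x) h)"])
    show "((\<lambda>x. l (f x)) has_derivative (\<lambda>h. l (frechet_derivative f (at x) h))) (at x)"
      if "x \<in> S" for x
      using that Suc.prems
      by (rule bounded_linear.has_derivative[OF assms(1) times_differentiable_on_has_derivative, rotated])
  qed (use Suc assms(2) in auto)
qed

lemma times_differentiable_on_ident: "open S \<Longrightarrow> times_differentiable_on k (\<lambda>x. x) S"
proof (cases k)
  case (Suc n)
  moreover assume "open S"
  ultimately show ?thesis
    using times_differentiable_onI[of S "\<lambda>x. x" "\<lambda>x h. h" n] by auto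
qed auto

lemma times_differentiable_on_linear:
  "bounded_linear l \<Longrightarrow> open S \<Longrightarrow> times_differentiable_on k l S"
  using times_differentiable_on_linear_comp times_differentiable_on_ident by fastforce

lemma times_differentiable_on_add:
  assumes "open S" "times_differentiable_on k f S" "times_differentiable_on k g S"
  shows "times_differentiable_on k (\<lambda>x. f x + g x) S"
  using assms(2,3)
proof (induction k arbitrary: f g)
  case (Suc k)
  show ?case
  proof (rule times_differentiable_onI)
    show "((\<lambda>x. f x + g x) has_derivative
       (\<lambda>h. frechet_derivative f (at x) h + frechet_derivative g (at x) h)) (at x)"
      if "x \<in> S" for x
      using that Suc.prems by (intro has_derivative_add times_differentiable_on_has_derivative)
  qed (use Suc assms(1) in auto)
qed (auto intro: continuous_intros)

lemma times_differentiable_on_sum: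
  assumes "open S" "\<And>i. i \<in> I \<Longrightarrow> times_differentiable_on k (f i) S"
  shows "times_differentiable_on k (\<lambda>x. \<Sum>i\<in>I. f i x) S"
  using assms(2)
  by (induction I rule: infinite_finite_induct) (auto intro!: times_differentiable_on_add assms(1))

lemma times_differentiable_on_minus:
  assumes "open S" "times_differentiable_on k f S" "times_differentiable_on k g S"
  shows "times_differentiable_on k (\<lambda>x. f x - g x) S"
proof -
  have "times_differentiable_on k (\<lambda>x. - g x) S"
    using times_differentiable_on_linear_comp[OF bounded_linear_minus[OF bounded_linear_ident]] assms
    by blast
  from times_differentiable_on_add[OF assms(1,2) this] show ?thesis by simp
qed

lemma times_differentiable_on_bilinear:
  assumes "bounded_bilinear b" "open S"
    "times_differentiable_on k f S" "times_differentiable_on k g S"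
  shows "times_differentiable_on k (\<lambda>x. b (f x) (g x)) S"
  using assms(3,4)
proof (induction k arbitrary: f g)
  case 0
  then show ?case using assms(1) by (simp add: bounded_bilinear.continuous_on)
next
  case (Suc k)
  show ?case
  proof (rule times_differentiable_onI)
    show "((\<lambda>x. b (f x) (g x)) has_derivative
       (\<lambda>h. b (f x) (frechet_derivative g (at x) h) + b (frechet_derivative f (at x) h) (g x))) (at x)"
      if "x \<in> S" for x
      using that Suc.prems
      by (intro bounded_bilinear.FDERIV[OF assms(1)] times_differentiable_on_has_derivative)
    show "times_differentiable_on k (\<lambda>x. b (f x) (frechet_derivative g (at x) h) +
        b (frechet_derivative f (at x) h) (g x)) S" for h
      using Suc.prems times_differentiable_on_Suc_imp[OF Suc.prems(1)]
        times_differentiable_on_Suc_imp[OF Suc.prems(2)]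
      by (intro times_differentiable_on_add Suc.IH assms(2)) auto
  qed (use assms(2) in auto)
qed

lemmas times_differentiable_on_scaleR = times_differentiable_on_bilinear[OF bounded_bilinear_scaleR]
lemmas times_differentiable_on_mult = times_differentiable_on_bilinear[OF bounded_bilinear_mult]

lemma times_differentiable_on_inner_const:
  "open S \<Longrightarrow> times_differentiable_on k f S \<Longrightarrow> times_differentiable_on k (\<lambda>x. f x \<bullet> c) S"
  by (rule times_differentiable_on_linear_comp[OF bounded_linear_inner_left])

lemma linear_euclidean_sum:
  assumes "linear l"
  shows "l (v::'e::euclidean_space) = (\<Sum>b\<in>Basis. (v \<bullet> b) *\<^sub>R l b)"
proof -
  have "l v = l (\<Sum>b\<in>Basis. (v \<bullet> b) *\<^sub>R b)" by (simp add: euclidean_representation)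
  also have "\<dots> = (\<Sum>b\<in>Basis. (v \<bullet> b) *\<^sub>R l b)"
    using assms by (simp add: linear_sum linear_cmul)
  finally show ?thesis .
qed

lemma times_differentiable_on_compose:
  fixes f :: "'g::euclidean_space \<Rightarrow> 'f::real_normed_vector" and g :: "'e::euclidean_space \<Rightarrow> 'g"
  assumes "open S" "open T" "g ` S \<subseteq> T"
    "times_differentiable_on k f T" "times_differentiable_on k g S"
  shows "times_differentiable_on k (\<lambda>x. f (g x)) S"
  using assms(4,5)
proof (induction k arbitrary: f)
  case 0
  then show ?case using assms(3) by (simp add: continuous_on_compose2)
next
  case (Suc k)
  let ?f' = "\<lambda>x. frechet_derivative f (at x)" and ?g' = "\<lambda>x. frechet_derivative g (at x)"
  have f': "(f has_derivative ?f' y) (at y)" if "y \<in> T" for y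
    using times_differentiable_on_has_derivative[OF Suc.prems(1) that] .
  \<comment> \<open>The direction \<open>?g' x h\<close> varies with \<open>x\<close>, whereas the
    induction hypothesis covers derivatives of \<open>f\<close> in fixed directions only. Expansion
    in the basis moves the variation into scalar coefficients.\<close>
  have *: "?f' (g x) (?g' x h) = (\<Sum>b\<in>Basis. (?g' x h \<bullet> b) *\<^sub>R ?f' (g x) b)" if "x \<in> S" for x h
    using f'[of "g x"] that assms(3) has_derivative_linear by (intro linear_euclidean_sum) blast
  show ?case
  proof (rule times_differentiable_onI)
    show "((\<lambda>x. f (g x)) has_derivative (\<lambda>h. ?f' (g x) (?g' x h))) (at x)" if "x \<in> S" for x
      using that assms(3)
      by (intro has_derivative_compose[OF times_differentiable_on_has_derivative[OF Suc.prems(2)] f']) auto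
    have 1: "times_differentiable_on k (\<lambda>x. \<Sum>b\<in>Basis. (?g' x h \<bullet> b) *\<^sub>R ?f' (g x) b) S" for h
      using Suc.prems times_differentiable_on_Suc_imp[OF Suc.prems(2)]
      by (intro times_differentiable_on_sum times_differentiable_on_scaleR assms(1)
          times_differentiable_on_inner_const Suc.IH) auto
    show "times_differentiable_on k (\<lambda>x. ?f' (g x) (?g' x h)) S" for h
      by (rule times_differentiable_on_cong[OF assms(1) _ 1]) (use * in auto)
  qed (use assms(1) in auto)
qed

section \<open>Smooth dependence of inverse operators\<close>

text \<open>A product rule in which the second factor is merely continuous: its increment is
  multiplied by a factor that vanishes at \<open>x\<close>. It serves to differentiate an inverse
  operator of which only continuity is known so far.\<close>

lemma has_derivative_vanishing_scaleR:
  fixes f :: "'e::real_normed_vector \<Rightarrow> real" and g :: "'e \<Rightarrow> 'f::real_normed_vector"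
  assumes f: "(f has_derivative f') (at x)" and "f x = 0" and g: "isCont g x"
  shows "((\<lambda>y. f y *\<^sub>R g y) has_derivative (\<lambda>h. f' h *\<^sub>R g x)) (at x)"
proof -
  interpret f': bounded_linear f' using f has_derivative_bounded_linear by blast
  obtain K where K: "\<And>h. norm (f' h) \<le> norm h * K" "K > 0"
    using f'.pos_bounded by blast
  have f0: "((\<lambda>h. norm (f (x + h) - f' h) / norm h) \<longlongrightarrow> 0) (at 0)"
    using f \<open>f x = 0\<close> by (simp add: has_derivative_at)
  have g0: "((\<lambda>h. norm (g (x + h))) \<longlongrightarrow> norm (g x)) (at 0)"
    using g by (intro tendsto_norm) (simp add: isCont_iff)
  have g1: "((\<lambda>h. norm (g (x + h) - g x)) \<longlongrightarrow> 0) (at 0)"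
    using g by (intro tendsto_norm_zero LIM_zero) (simp add: isCont_iff)
  have lim: "((\<lambda>h. norm (f (x + h) - f' h) / norm h * norm (g (x + h)) + K * norm (g (x + h) - g x))
       \<longlongrightarrow> 0 * norm (g x) + K * 0) (at 0)"
    by (intro tendsto_intros f0 g0 g1)
  have bound: "norm (f (x + h) *\<^sub>R g (x + h) - f' h *\<^sub>R g x) / norm h
      \<le> norm (f (x + h) - f' h) / norm h * norm (g (x + h)) + K * norm (g (x + h) - g x)"
    if "h \<noteq> 0" for h
  proof -
    have "f (x + h) *\<^sub>R g (x + h) - f' h *\<^sub>R g x =
        (f (x + h) - f' h) *\<^sub>R g (x + h) + f' h *\<^sub>R (g (x + h) - g x)"
      by (simp add: algebra_simps)
    then have "norm (f (x + h) *\<^sub>R g (x + h) - f' h *\<^sub>R g x) \<le>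
        norm (f (x + h) - f' h) * norm (g (x + h)) + norm (f' h) * norm (g (x + h) - g x)"
      by (metis norm_scaleR norm_triangle_ineq real_norm_def)
    also have "\<dots> \<le> norm (f (x + h) - f' h) * norm (g (x + h)) + (norm h * K) * norm (g (x + h) - g x)"
      by (intro add_left_mono mult_right_mono K) auto
    finally show ?thesis using that by (simp add: field_simps)
  qed
  have "((\<lambda>h. norm (f (x + h) *\<^sub>R g (x + h) - f' h *\<^sub>R g x) / norm h) \<longlongrightarrow> 0) (at 0)"
  proof (rule tendsto_sandwich[OF _ _ tendsto_const])
    show "\<forall>\<^sub>F h in at 0. norm (f (x + h) *\<^sub>R g (x + h) - f' h *\<^sub>R g x) / norm h
      \<le> norm (f (x + h) - f' h) / norm h * norm (g (x + h)) + K * norm (g (x + h) - g x)"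
      using bound by (auto simp: eventually_at_filter)
  qed (use lim in auto)
  then show ?thesis
    using \<open>f x = 0\<close> bounded_linear_compose[OF bounded_linear_scaleR_left f'.bounded_linear_axioms]
    by (simp add: has_derivative_at o_def)
qed

text \<open>Since \<open>R x\<close> is the inverse of \<open>Q x\<close>, its derivative is \<open>-R x (Q' x) (R x)\<close>, which is as often
  differentiable as \<open>R\<close> itself.\<close>

lemma times_differentiable_on_inverse_operator:
  fixes Q R :: "'e::euclidean_space \<Rightarrow> 'v::euclidean_space \<Rightarrow> 'v"
  assumes S: "open S"
    and lin: "\<And>x. x \<in> S \<Longrightarrow> linear (Q x)" "\<And>x. x \<in> S \<Longrightarrow> linear (R x)"
    and inv: "\<And>x v. x \<in> S \<Longrightarrow> Q x (R x v) = v" "\<And>x v. x \<in> S \<Longrightarrow> R x (Q x v) = v"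
    and bound: "\<And>x v. x \<in> S \<Longrightarrow> norm (R x v) \<le> C * norm v"
    and Q: "\<And>k v. times_differentiable_on k (\<lambda>x. Q x v) S"
  shows "times_differentiable_on k (\<lambda>x. R x v) S"
proof -
  let ?Q' = "\<lambda>w x h. frechet_derivative (\<lambda>x. Q x w) (at x) h"
  have Q': "((\<lambda>x. Q x w) has_derivative ?Q' w x) (at x)" if "x \<in> S" for w x
    using Q[of "Suc 0"] that by (intro times_differentiable_on_has_derivative)
  \<comment> \<open>The resolvent identity; with the uniform bound on \<open>R\<close> it yields
    continuity, and then differentiability.\<close>
  have diff: "R y v - R x v = - R y (Q y (R x v) - Q x (R x v))" if "x \<in> S" "y \<in> S" for x y v
    using that lin inv by (simp add: linear_diff)
  have cont: "isCont (\<lambda>x. R x v) x" if x: "x \<in> S" for x v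
  proof -
    have "isCont (\<lambda>y. Q y (R x v)) x" using Q'[OF x] has_derivative_continuous by blast
    then have "((\<lambda>y. C * norm (Q y (R x v) - Q x (R x v))) \<longlongrightarrow> C * norm (Q x (R x v) - Q x (R x v))) (at x)"
      by (intro tendsto_intros) (simp add: isCont_def)
    then have lim: "((\<lambda>y. C * norm (Q y (R x v) - Q x (R x v))) \<longlongrightarrow> 0) (at x)"
      by simp
    have "\<forall>\<^sub>F y in at x. norm (R y v - R x v) \<le> C * norm (Q y (R x v) - Q x (R x v))"
      using eventually_at_in_open'[OF S x]
    proof eventually_elim
      case (elim y)
      then show ?case using diff[OF x elim, of v] bound[OF elim] by simp
    qed
    from Lim_null_comparison[OF this lim] have "((\<lambda>y. R y v - R x v) \<longlongrightarrow> 0) (at x)" .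
    then show ?thesis by (simp add: isCont_def LIM_zero_iff)
  qed
  \<comment> \<open>In the resolvent identity the coefficients of \<open>Q y ?w - Q x ?w\<close>
    vanish at \<open>y = x\<close>, so continuity of the remaining factor \<open>R y b\<close> is
    enough.\<close>
  have R': "((\<lambda>x. R x v) has_derivative
      (\<lambda>h. - (\<Sum>b\<in>Basis. (?Q' (R x v) x h \<bullet> b) *\<^sub>R R x b))) (at x)" if x: "x \<in> S" for x v
  proof -
    let ?w = "R x v"
    let ?g = "\<lambda>y. R x v - (\<Sum>b\<in>Basis. ((Q y ?w - Q x ?w) \<bullet> b) *\<^sub>R R y b)"
    have "((\<lambda>y. Q y ?w - Q x ?w) has_derivative ?Q' ?w x) (at x)"
      using has_derivative_diff[OF Q'[OF x] has_derivative_const[of "Q x ?w"]] by simp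
    then have *: "((\<lambda>y. (Q y ?w - Q x ?w) \<bullet> b) has_derivative (\<lambda>h. ?Q' ?w x h \<bullet> b)) (at x)" for b
      by (rule bounded_linear.has_derivative[OF bounded_linear_inner_left])
    have "(?g has_derivative (\<lambda>h. 0 - (\<Sum>b\<in>Basis. (?Q' ?w x h \<bullet> b) *\<^sub>R R x b))) (at x)"
      by (intro has_derivative_diff has_derivative_const has_derivative_sum
          has_derivative_vanishing_scaleR cont x *) auto
    then have g': "(?g has_derivative (\<lambda>h. - (\<Sum>b\<in>Basis. (?Q' ?w x h \<bullet> b) *\<^sub>R R x b))) (at x)"
      by simp
    have "?g y = R y v" if "y \<in> S" for y
    proof -
      have "(\<Sum>b\<in>Basis. ((Q y ?w - Q x ?w) \<bullet> b) *\<^sub>R R y b) = R y (Q y ?w - Q x ?w)"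
        by (rule linear_euclidean_sum[OF lin(2)[OF that], symmetric])
      then show ?thesis using diff[OF x that, of v] by (simp add: algebra_simps)
    qed
    then show ?thesis
      by (rule has_derivative_transform_within_open[OF g' S x])
  qed
  \<comment> \<open>The vector \<open>R x v\<close> inside the derivative moves with
    \<open>x\<close>. Written over the basis, the derivative of \<open>R\<close> contains only
    \<open>R\<close> itself and derivatives of \<open>Q\<close> at fixed vectors, so the induction
    can proceed.\<close>
  have expand: "?Q' (R x v) x h = (\<Sum>c\<in>Basis. (R x v \<bullet> c) *\<^sub>R ?Q' c x h)" if x: "x \<in> S" for x v h
  proof -
    have 1: "((\<lambda>y. \<Sum>c\<in>Basis. (R x v \<bullet> c) *\<^sub>R Q y c) has_derivative
        (\<lambda>h. \<Sum>c\<in>Basis. (R x v \<bullet> c) *\<^sub>R ?Q' c x h)) (at x)"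
      by (intro has_derivative_sum has_derivative_scaleR_right Q' x)
    have 2: "(\<Sum>c\<in>Basis. (R x v \<bullet> c) *\<^sub>R Q y c) = Q y (R x v)" if "y \<in> S" for y
      by (rule linear_euclidean_sum[OF lin(1)[OF that], symmetric])
    have "((\<lambda>y. Q y (R x v)) has_derivative
        (\<lambda>h. \<Sum>c\<in>Basis. (R x v \<bullet> c) *\<^sub>R ?Q' c x h)) (at x)"
      by (rule has_derivative_transform_within_open[OF 1 S x 2])
    from fun_cong[OF has_derivative_unique[OF Q'[OF x] this], of h] show ?thesis .
  qed
  show ?thesis
  proof (induction k arbitrary: v)
    case 0
    then show ?case using cont by (simp add: continuous_at_imp_continuous_on)
  next
    case (Suc k)
    show ?case
    proof (rule times_differentiable_onI[OF S R'])
      fix h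
      have "times_differentiable_on k (\<lambda>x. ?Q' c x h) S" for c
        using Q[of "Suc k" c] by simp
      then have 1: "times_differentiable_on k (\<lambda>x. 0 - (\<Sum>b\<in>Basis.
          ((\<Sum>c\<in>Basis. (R x v \<bullet> c) *\<^sub>R ?Q' c x h) \<bullet> b) *\<^sub>R R x b)) S"
        by (intro times_differentiable_on_minus times_differentiable_on_sum Suc.IH
            times_differentiable_on_const times_differentiable_on_scaleR
            times_differentiable_on_inner_const S)
      show "times_differentiable_on k
          (\<lambda>x. - (\<Sum>b\<in>Basis. (?Q' (R x v) x h \<bullet> b) *\<^sub>R R x b)) S"
        by (rule times_differentiable_on_cong[OF S _ 1]) (use expand in auto)
    qed auto
  qed
qed

section \<open>Estimates on compact sets and ordinary differential equations\<close>

lemma linear_norm_bound_Basis: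
  fixes l :: "'e::euclidean_space \<Rightarrow> 'f::real_normed_vector"
  assumes "linear l" "\<And>b. b \<in> Basis \<Longrightarrow> norm (l b) \<le> C b"
  shows "norm (l v) \<le> (\<Sum>b\<in>Basis. C b) * norm v"
proof -
  have "norm (l v) \<le> (\<Sum>b\<in>Basis. norm ((v \<bullet> b) *\<^sub>R l b))"
    using linear_euclidean_sum[OF assms(1), of v] norm_sum by metis
  also have "\<dots> \<le> (\<Sum>b\<in>Basis. norm v * C b)"
  proof (rule sum_mono)
    fix b :: 'e assume b: "b \<in> Basis"
    show "norm ((v \<bullet> b) *\<^sub>R l b) \<le> norm v * C b"
      unfolding norm_scaleR real_norm_def
      by (intro mult_mono Basis_le_norm assms(2) b) auto
  qed
  finally show ?thesis by (simp add: sum_distrib_left mult.commute)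
qed

lemma compact_continuous_norm_bound:
  fixes f :: "'a::topological_space \<Rightarrow> 'b::real_normed_vector"
  assumes "compact K" "continuous_on K f"
  shows "\<exists>C\<ge>0. \<forall>x\<in>K. norm (f x) \<le> C"
proof -
  obtain B where "B > 0" "\<forall>y\<in>f ` K. norm y \<le> B"
    using compact_imp_bounded[OF compact_continuous_image[OF assms(2,1)]] bounded_pos by blast
  then show ?thesis by (intro exI[of _ B]) auto
qed

lemma frechet_derivative_bounded_on_compact:
  fixes f :: "'e::euclidean_space \<Rightarrow> 'f::real_normed_vector"
  assumes f: "times_differentiable_on (Suc 0) f S" and K: "compact K" "K \<subseteq> S"
  obtains C where "C \<ge> 0" "\<And>x v. x \<in> K \<Longrightarrow> norm (frechet_derivative f (at x) v) \<le> C * norm v"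
proof -
  have "\<exists>C\<ge>0. \<forall>x\<in>K. norm (frechet_derivative f (at x) b) \<le> C" for b
  proof -
    have "continuous_on K (\<lambda>x. frechet_derivative f (at x) b)"
      using f K(2) by (auto intro: continuous_on_subset)
    from compact_continuous_norm_bound[OF K(1) this] show ?thesis .
  qed
  then obtain C where C: "\<And>b. C b \<ge> 0" "\<And>b x. x \<in> K \<Longrightarrow> norm (frechet_derivative f (at x) b) \<le> C b"
    by metis
  show ?thesis
  proof (rule that)
    show "norm (frechet_derivative f (at x) v) \<le> (\<Sum>b\<in>Basis. C b) * norm v" if "x \<in> K" for x v
    proof (rule linear_norm_bound_Basis)
      show "linear (frechet_derivative f (at x))"
        using times_differentiable_on_has_derivative[OF f] that K(2) has_derivative_linear by blast
    qed (use C(2) that in auto)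
  qed (use C(1) in \<open>simp add: sum_nonneg\<close>)
qed

lemma lipschitz_on_compact_convex:
  fixes f :: "'e::euclidean_space \<Rightarrow> 'f::real_normed_vector"
  assumes f: "times_differentiable_on (Suc 0) f S" and K: "compact K" "convex K" "K \<subseteq> S"
  obtains C where "C \<ge> 0" "\<And>x y. x \<in> K \<Longrightarrow> y \<in> K \<Longrightarrow> norm (f y - f x) \<le> C * norm (y - x)"
proof -
  obtain C where C: "C \<ge> 0" "\<And>x v. x \<in> K \<Longrightarrow> norm (frechet_derivative f (at x) v) \<le> C * norm v"
    using frechet_derivative_bounded_on_compact[OF f K(1,3)] by blast
  have "norm (f y - f x) \<le> C * norm (y - x)" if "x \<in> K" "y \<in> K" for x y
  proof (rule differentiable_bound[OF K(2)])
    show "(f has_derivative frechet_derivative f (at z)) (at z within K)" if "z \<in> K" for z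
      using times_differentiable_on_has_derivative[OF f] that K(3) has_derivative_at_withinI by blast
    show "onorm (frechet_derivative f (at z)) \<le> C" if "z \<in> K" for z
      using C that by (intro onorm_le) auto
  qed (use that in auto)
  then show ?thesis using C(1) that by blast
qed

text \<open>The mean value inequality is applied to \<open>f z - ?D x z\<close> on the segment from
  \<open>x\<close> to \<open>y\<close>. Its derivative \<open>?D z - ?D x\<close> is at most a
  constant times the length of the segment, because \<open>?D\<close> is Lipschitz on
  \<open>K\<close>.\<close>

lemma quadratic_approximation_on_compact_convex:
  fixes f :: "'e::euclidean_space \<Rightarrow> 'f::real_normed_vector"
  assumes f: "times_differentiable_on (Suc (Suc 0)) f S" and K: "compact K" "convex K" "K \<subseteq> S"
  obtains C where "C \<ge> 0" "\<And>x y. x \<in> K \<Longrightarrow> y \<in> K \<Longrightarrow>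
     norm (f y - f x - frechet_derivative f (at x) (y - x)) \<le> C * (norm (y - x))\<^sup>2"
proof -
  let ?D = "\<lambda>x. frechet_derivative f (at x)"
  have "\<exists>C. C \<ge> 0 \<and> (\<forall>x\<in>K. \<forall>y\<in>K. norm (?D y b - ?D x b) \<le> C * norm (y - x))" for b
    using lipschitz_on_compact_convex[of "\<lambda>x. ?D x b" S K] f K by (metis times_differentiable_on.simps(2))
  then obtain C where C: "\<And>b. C b \<ge> 0"
    "\<And>b x y. x \<in> K \<Longrightarrow> y \<in> K \<Longrightarrow> norm (?D y b - ?D x b) \<le> C b * norm (y - x)"
    by metis
  have D: "(f has_derivative ?D x) (at x)" if "x \<in> K" for x
    using times_differentiable_on_has_derivative[OF f] that K(3) by blast
  let ?C = "\<Sum>b\<in>Basis. C b"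
  have lip: "norm (?D y v - ?D x v) \<le> (?C * norm (y - x)) * norm v" if "x \<in> K" "y \<in> K" for x y v
  proof -
    have "linear (\<lambda>v. ?D y v - ?D x v)"
      using D that has_derivative_linear by (intro linear_compose_sub) blast+
    from linear_norm_bound_Basis[OF this, of "\<lambda>b. C b * norm (y - x)"] C(2)[OF that]
    show ?thesis by (simp add: sum_distrib_right)
  qed
  have "norm (f y - f x - ?D x (y - x)) \<le> ?C * (norm (y - x))\<^sup>2" if x: "x \<in> K" and y: "y \<in> K" for x y
  proof -
    have sub: "closed_segment x y \<subseteq> K" using K(2) x y by (simp add: closed_segment_subset)
    have "norm ((f y - ?D x y) - (f x - ?D x x)) \<le> (?C * norm (y - x)) * norm (y - x)"
    proof (rule differentiable_bound[of "closed_segment x y" "\<lambda>z. f z - ?D x z" "\<lambda>z v. ?D z v - ?D x v"])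
      fix z assume z: "z \<in> closed_segment x y"
      then have zK: "z \<in> K" using sub by blast
      show "((\<lambda>z. f z - ?D x z) has_derivative (\<lambda>v. ?D z v - ?D x v)) (at z within closed_segment x y)"
        using D[OF zK] D[OF x] has_derivative_bounded_linear
        by (intro has_derivative_diff has_derivative_at_withinI[OF D[OF zK]]
            bounded_linear_imp_has_derivative) blast
      have "norm (z - x) \<le> norm (y - x)" using z segment_bound(1) by blast
      then have *: "?C * norm (z - x) \<le> ?C * norm (y - x)"
        by (intro mult_left_mono) (simp_all add: sum_nonneg C(1))
      have "norm (?D z v - ?D x v) \<le> (?C * norm (y - x)) * norm v" for v
        using lip[OF x zK, of v] mult_right_mono[OF *, of "norm v"] by simp
      then show "onorm (\<lambda>v. ?D z v - ?D x v) \<le> ?C * norm (y - x)"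
        by (rule onorm_le)
    qed auto
    moreover have "?D x (y - x) = ?D x y - ?D x x"
      using D[OF x] has_derivative_linear linear_diff by blast
    then have "(f y - ?D x y) - (f x - ?D x x) = f y - f x - ?D x (y - x)" by simp
    ultimately show ?thesis by (simp only: power2_eq_square mult.assoc)
  qed
  moreover have "?C \<ge> 0" by (simp add: sum_nonneg C(1))
  ultimately show ?thesis using that by blast
qed

section \<open>Gronwall inequalities and Picard iteration\<close>

lemma gronwall:
  fixes \<phi> :: "real \<Rightarrow> real"
  assumes d: "\<And>t. t \<in> {0..1} \<Longrightarrow> (\<phi> has_real_derivative \<phi>' t) (at t within {0..1})"
    and le: "\<And>t. t \<in> {0..1} \<Longrightarrow> \<phi>' t \<le> K * \<phi> t + c"
    and nn: "K \<ge> 0" "c \<ge> 0" and init: "\<phi> 0 = 0" and t: "t \<in> {0..1}"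
  shows "\<phi> t \<le> c * exp K"
proof -
  \<comment> \<open>The exponential is the integrating factor of the homogeneous part; subtracting
    \<open>c * s\<close> absorbs the inhomogeneity, since
    \<open>exp (- K * s) \<le> 1\<close>.\<close>
  define \<psi> where "\<psi> s = \<phi> s * exp (- K * s) - c * s" for s
  let ?d = "\<lambda>s. \<phi>' s * exp (- K * s) + \<phi> s * (- K * exp (- K * s)) - c"
  have d\<psi>: "(\<psi> has_real_derivative ?d s) (at s within {0..1})" if "s \<in> {0..1}" for s
    unfolding \<psi>_def by (auto intro!: derivative_eq_intros d[OF that])
  have d0: "?d s \<le> 0" if "s \<in> {0..1}" for s
  proof -
    have "?d s = (\<phi>' s - K * \<phi> s) * exp (- K * s) - c" by (simp add: algebra_simps)
    also have "\<dots> \<le> c * exp (- K * s) - c"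
      using le[OF that] by (intro diff_right_mono mult_right_mono) auto
    also have "\<dots> \<le> 0"
    proof -
      have "exp (- K * s) \<le> 1" using that nn by simp
      then show ?thesis using nn mult_left_mono[of "exp (- K * s)" 1 c] by simp
    qed
    finally show ?thesis .
  qed
  have "continuous_on {0..1} \<psi>"
    unfolding continuous_on_eq_continuous_within using DERIV_continuous[OF d\<psi>] by blast
  then have c: "continuous_on {0..t} \<psi>"
    by (rule continuous_on_subset) (use t in auto)
  have "\<psi> t \<le> \<psi> 0"
  proof (rule DERIV_nonpos_imp_decreasing_open[OF _ _ c])
    show "\<exists>y. (\<psi> has_real_derivative y) (at s) \<and> y \<le> 0" if "0 < s" "s < t" for s
    proof (intro exI conjI)
      have "s \<in> {0..1}" "at s within {0..1} = at s"
        using that t at_within_Icc_at[of 0 s 1] by auto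
      then show "(\<psi> has_real_derivative ?d s) (at s)" "?d s \<le> 0"
        using d\<psi>[of s] d0[of s] by auto
    qed
  qed (use t in auto)
  then have "\<phi> t * exp (- K * t) \<le> c * t" by (simp add: \<psi>_def init)
  then have "\<phi> t \<le> c * t * exp (K * t)" by (simp add: exp_minus field_simps)
  also have "\<dots> \<le> c * 1 * exp K"
    using t nn by (intro mult_mono) (auto simp: mult_left_le)
  finally show ?thesis by simp
qed

text \<open>The norm is not differentiable at the origin, so the scalar inequality is applied to the
  inner product of \<open>w\<close> with itself. Splitting the mixed term by
  \<open>2ab \<le> a^2 + b^2\<close> produces the rate \<open>2 * K + 1\<close>; the halving of the
  exponent by the square root is given away.\<close>

lemma gronwall_norm:
  fixes w :: "real \<Rightarrow> 'e::real_inner"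
  assumes d: "\<And>t. t \<in> {0..1} \<Longrightarrow> (w has_vector_derivative w' t) (at t within {0..1})"
    and le: "\<And>t. t \<in> {0..1} \<Longrightarrow> norm (w' t) \<le> K * norm (w t) + c"
    and nn: "K \<ge> 0" "c \<ge> 0" and init: "w 0 = 0" and t: "t \<in> {0..1}"
  shows "norm (w t) \<le> c * exp (2 * K + 1)"
proof -
  let ?K = "2 * K + 1"
  have "w t \<bullet> w t \<le> c\<^sup>2 * exp ?K"
  proof (rule gronwall[OF _ _ _ _ _ t])
    fix t :: real assume t: "t \<in> {0..1}"
    have "((\<lambda>t. w t \<bullet> w t) has_derivative (\<lambda>h. w t \<bullet> (h *\<^sub>R w' t) + (h *\<^sub>R w' t) \<bullet> w t)) (at t within {0..1})"
      using d[OF t] unfolding has_vector_derivative_def by (intro has_derivative_inner)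
    then show "((\<lambda>t. w t \<bullet> w t) has_real_derivative (2 * (w t \<bullet> w' t))) (at t within {0..1})"
      unfolding has_field_derivative_def
      by (rule has_derivative_eq_rhs) (simp add: fun_eq_iff inner_commute)
    have "w t \<bullet> w' t \<le> norm (w t) * norm (w' t)" by (rule norm_cauchy_schwarz)
    also have "\<dots> \<le> norm (w t) * (K * norm (w t) + c)" using le[OF t] by (intro mult_left_mono) auto
    finally have "2 * (w t \<bullet> w' t) \<le> 2 * K * (norm (w t))\<^sup>2 + 2 * norm (w t) * c"
      by (simp add: power2_eq_square algebra_simps)
    also have "2 * norm (w t) * c \<le> (norm (w t))\<^sup>2 + c\<^sup>2" by (rule sum_squares_bound)
    finally show "2 * (w t \<bullet> w' t) \<le> ?K * (w t \<bullet> w t) + c\<^sup>2"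
      by (simp add: power2_norm_eq_inner algebra_simps)
  qed (use nn init in auto)
  also have "\<dots> \<le> c\<^sup>2 * (exp ?K)\<^sup>2"
    using nn by (intro mult_left_mono) (auto simp: power2_eq_square)
  finally have "(norm (w t))\<^sup>2 \<le> (c * exp ?K)\<^sup>2"
    by (simp add: power2_norm_eq_inner power_mult_distrib)
  then show ?thesis by (rule power2_le_imp_le) (use nn in auto)
qed

text \<open>Picard iteration for the field \<open>g\<close> precomposed with the projection onto the ball, which makes
  it globally Lipschitz; the bound \<open>B\<close> keeps the solution inside the ball.\<close>

lemma integral_curve_in_ball:
  fixes g :: "'e::euclidean_space \<Rightarrow> 'e"
  assumes lip: "\<And>x y. x \<in> cball x0 r \<Longrightarrow> y \<in> cball x0 r \<Longrightarrow> norm (g y - g x) \<le> L * norm (y - x)"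
    and L: "0 \<le> L" "L < 1" and B: "\<And>x. x \<in> cball x0 r \<Longrightarrow> norm (g x) \<le> B" "B \<le> r" and r: "0 \<le> r"
  obtains y where "y 0 = x0"
    "\<And>t. t \<in> {0..1} \<Longrightarrow> y t \<in> cball x0 r"
    "\<And>t. t \<in> {0..1} \<Longrightarrow> (y has_vector_derivative g (y t)) (at t within {0..1})"
proof -
  let ?p = "closest_point (cball x0 r)"
  have ne: "cball x0 r \<noteq> {}" using r by simp
  have p: "?p x \<in> cball x0 r" for x using ne by (intro closest_point_in_set) auto
  have plip: "norm (?p x - ?p y) \<le> norm (x - y)" for x y
    using closest_point_lipschitz[of "cball x0 r" x y] ne by (simp add: dist_norm)
  let ?h = "\<lambda>x. g (?p x)"
  have hlip: "norm (?h y - ?h x) \<le> L * norm (y - x)" for x y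
    using lip[OF p p, of y x] mult_left_mono[OF plip L(1), of y x] by linarith
  have hB: "norm (?h x) \<le> B" for x using B(1)[OF p] .
  have hcont: "continuous_on A ?h" for A
  proof (rule continuous_onI)
    fix x e assume e: "(e::real) > 0"
    show "\<exists>d>0. \<forall>x'\<in>A. dist x' x < d \<longrightarrow> dist (?h x') (?h x) \<le> e"
    proof (intro exI conjI ballI impI)
      fix x' assume "dist x' x < e"
      then show "dist (?h x') (?h x) \<le> e"
        using hlip[of x' x] mult_right_mono[of L 1 "norm (x' - x)"] L by (simp add: dist_norm)
    qed (use e in auto)
  qed
  \<comment> \<open>The fixed point is sought among bounded continuous functions on the whole line.
    Clamping the upper limit makes the Picard operator act there, and keeps every interval of
    integration of length at most one, so that \<open>L\<close> itself is the contraction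
    factor.\<close>
  let ?c = "\<lambda>t. max 0 (min 1 t) :: real"
  have c01: "?c t \<in> {0..1}" for t by auto
  let ?T = "\<lambda>y t. x0 + integral {0..?c t} (\<lambda>s. ?h (y s))"
  have hy: "continuous_on A (\<lambda>s. ?h (apply_bcontfun y s))" for A y
    by (intro continuous_on_compose2[OF hcont[of UNIV]]) auto
  have int: "norm (integral {0..?c t} f) \<le> b" if "continuous_on UNIV f" "\<And>s. norm (f s) \<le> b"
    for t b and f :: "real \<Rightarrow> 'e"
  proof -
    have "norm (integral {0..?c t} f) \<le> b * (?c t - 0)"
      by (rule integral_bound) (use that in \<open>auto intro: continuous_on_subset\<close>)
    also have "\<dots> \<le> b * 1"
      using that(2)[of 0] norm_ge_zero[of "f 0"] by (intro mult_left_mono) (auto simp del: norm_ge_zero)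
    finally show ?thesis by simp
  qed
  have T: "?T (apply_bcontfun y) \<in> bcontfun" for y
  proof (rule bcontfun_normI)
    have "continuous_on {0..1} (\<lambda>u. integral {0..u} (\<lambda>s. ?h (apply_bcontfun y s)))"
      by (intro indefinite_integral_continuous_1 integrable_continuous_real hy)
    then have "continuous_on UNIV (\<lambda>t. integral {0..?c t} (\<lambda>s. ?h (apply_bcontfun y s)))"
      by (rule continuous_on_compose2) (auto intro!: continuous_intros)
    then show "continuous_on UNIV (?T (apply_bcontfun y))" by (intro continuous_intros)
    show "norm (?T (apply_bcontfun y) t) \<le> norm x0 + B" for t
      using int[OF hy hB, of t y] norm_triangle_ineq order_trans add_left_mono by meson
  qed
  have "\<exists>!y. Bcontfun (?T (apply_bcontfun y)) = y"
  proof (rule banach_fix_type[OF L], intro allI)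
    fix y z :: "real \<Rightarrow>\<^sub>C 'e"
    show "dist (Bcontfun (?T (apply_bcontfun y))) (Bcontfun (?T (apply_bcontfun z))) \<le> L * dist y z"
    proof (rule dist_bound)
      fix t
      have "integral {0..?c t} (\<lambda>s. ?h (y s)) - integral {0..?c t} (\<lambda>s. ?h (z s))
         = integral {0..?c t} (\<lambda>s. ?h (y s) - ?h (z s))"
        by (intro Henstock_Kurzweil_Integration.integral_diff[symmetric] integrable_continuous_real hy)
      moreover have "norm (integral {0..?c t} (\<lambda>s. ?h (y s) - ?h (z s))) \<le> L * dist y z"
      proof (rule int)
        show "norm (?h (y s) - ?h (z s)) \<le> L * dist y z" for s
          using hlip[of "y s" "z s"] mult_left_mono[OF dist_bounded[of y s z] L(1)]
          by (simp add: dist_norm)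
      qed (intro continuous_intros hy)
      ultimately show "dist (Bcontfun (?T (apply_bcontfun y)) t) (Bcontfun (?T (apply_bcontfun z)) t) \<le> L * dist y z"
        by (simp add: Bcontfun_inverse[OF T] dist_norm)
    qed
  qed
  then obtain y where "Bcontfun (?T (apply_bcontfun y)) = y" by blast
  then have y: "apply_bcontfun y t = ?T (apply_bcontfun y) t" for t
    using Bcontfun_inverse[OF T, of y] by metis
  have yball: "y t \<in> cball x0 r" for t
    using int[OF hy hB, of t y] B(2) by (subst y) (simp add: dist_norm)
  show ?thesis
  proof (rule that[of "apply_bcontfun y"])
    show "y 0 = x0" by (subst y) simp
    fix t :: real assume t: "t \<in> {0..1}"
    show "y t \<in> cball x0 r" by (rule yball)
    have "((\<lambda>u. integral {0..u} (\<lambda>s. ?h (y s))) has_vector_derivative ?h (y t)) (at t within {0..1})"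
      by (rule integral_has_vector_derivative[OF hy t])
    then have "((\<lambda>u. x0 + integral {0..u} (\<lambda>s. ?h (y s))) has_vector_derivative ?h (y t)) (at t within {0..1})"
      by (auto intro!: derivative_eq_intros)
    then have "(apply_bcontfun y has_vector_derivative ?h (y t)) (at t within {0..1})"
      by (rule has_vector_derivative_transform[OF t, rotated]) (subst y, simp)
    then show "(apply_bcontfun y has_vector_derivative g (y t)) (at t within {0..1})"
      by (simp only: closest_point_self[OF yball])
  qed
qed

section \<open>Involutive families of vector fields in Euclidean space\<close>

abbreviation fderiv ::
    "('e::real_normed_vector \<Rightarrow> 'f::real_normed_vector) \<Rightarrow> 'e \<Rightarrow> 'e \<Rightarrow> 'f" where
  "fderiv f x \<equiv> frechet_derivative f (at x)"

lemma times_differentiable_on_fderiv_apply: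
  fixes f :: "'e::euclidean_space \<Rightarrow> 'f::real_normed_vector"
  assumes S: "open S" and f: "times_differentiable_on (Suc k) f S" and u: "times_differentiable_on k u S"
  shows "times_differentiable_on k (\<lambda>x. fderiv f x (u x)) S"
proof -
  have 1: "times_differentiable_on k (\<lambda>x. \<Sum>b\<in>Basis. (u x \<bullet> b) *\<^sub>R fderiv f x b) S"
    using f u by (intro times_differentiable_on_sum times_differentiable_on_scaleR
        times_differentiable_on_inner_const S) auto
  show ?thesis
  proof (rule times_differentiable_on_cong[OF S _ 1])
    fix x assume "x \<in> S"
    then have "linear (fderiv f x)"
      using times_differentiable_on_has_derivative[OF f] has_derivative_linear by blast
    from linear_euclidean_sum[OF this, of "u x"]
    show "(\<Sum>b\<in>Basis. (u x \<bullet> b) *\<^sub>R fderiv f x b) = fderiv f x (u x)" by simp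
  qed
qed

definition field_bracket :: "('e::real_normed_vector \<Rightarrow> 'e) \<Rightarrow> ('e \<Rightarrow> 'e) \<Rightarrow> 'e \<Rightarrow> 'e" where
  "field_bracket u v x = fderiv v x (u x) - fderiv u x (v x)"

lemma fderiv_combination:
  fixes X :: "'i \<Rightarrow> 'e::euclidean_space \<Rightarrow> 'e" and p :: "'i \<Rightarrow> 'e \<Rightarrow> real"
  assumes "\<And>j. j \<in> J \<Longrightarrow> (X j has_derivative fderiv (X j) x) (at x)"
    "\<And>j. j \<in> J \<Longrightarrow> (p j has_derivative fderiv (p j) x) (at x)"
  shows "fderiv (\<lambda>x. \<Sum>j\<in>J. p j x *\<^sub>R X j x) x w =
    (\<Sum>j\<in>J. p j x *\<^sub>R fderiv (X j) x w) + (\<Sum>j\<in>J. fderiv (p j) x w *\<^sub>R X j x)"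
proof -
  have "((\<lambda>x. \<Sum>j\<in>J. p j x *\<^sub>R X j x) has_derivative
    (\<lambda>w. \<Sum>j\<in>J. p j x *\<^sub>R fderiv (X j) x w + fderiv (p j) x w *\<^sub>R X j x)) (at x)"
    by (intro has_derivative_sum has_derivative_scaleR assms)
  from fun_cong[OF frechet_derivative_at[OF this], of w] show ?thesis by (simp add: sum.distrib)
qed

text \<open>By the Leibniz rule the derivatives of the coefficients only contribute further
  multiples of the \<open>X k\<close>. Thus combinations with variable coefficients are closed under
  brackets, even where the \<open>X k\<close> are linearly dependent.\<close>

lemma field_bracket_combinations:
  fixes X :: "'i \<Rightarrow> 'e::euclidean_space \<Rightarrow> 'e" and p q :: "'i \<Rightarrow> 'e \<Rightarrow> real"
  assumes X: "\<And>j. j \<in> J \<Longrightarrow> (X j has_derivative fderiv (X j) x) (at x)"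
    and p: "\<And>j. j \<in> J \<Longrightarrow> (p j has_derivative fderiv (p j) x) (at x)"
    and q: "\<And>j. j \<in> J \<Longrightarrow> (q j has_derivative fderiv (q j) x) (at x)"
    and br: "\<And>i j. i \<in> J \<Longrightarrow> j \<in> J \<Longrightarrow> field_bracket (X i) (X j) x = (\<Sum>k\<in>J. c i j k *\<^sub>R X k x)"
  defines "u \<equiv> \<lambda>x. \<Sum>j\<in>J. p j x *\<^sub>R X j x" and "v \<equiv> \<lambda>x. \<Sum>j\<in>J. q j x *\<^sub>R X j x"
  shows "field_bracket u v x =
    (\<Sum>k\<in>J. (fderiv (q k) x (u x) - fderiv (p k) x (v x) + (\<Sum>i\<in>J. \<Sum>j\<in>J. p i x * q j x * c i j k)) *\<^sub>R X k x)"
proof -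
  have lin: "linear (fderiv (X j) x)" if "j \<in> J" for j
    using X[OF that] has_derivative_linear by blast
  have 1: "(\<Sum>j\<in>J. q j x *\<^sub>R fderiv (X j) x (u x)) =
      (\<Sum>i\<in>J. \<Sum>j\<in>J. (p i x * q j x) *\<^sub>R fderiv (X j) x (X i x))"
  proof -
    have "(\<Sum>j\<in>J. q j x *\<^sub>R fderiv (X j) x (u x)) =
        (\<Sum>j\<in>J. \<Sum>i\<in>J. (p i x * q j x) *\<^sub>R fderiv (X j) x (X i x))"
      by (intro sum.cong refl)
        (simp add: u_def linear_sum[OF lin] linear_cmul[OF lin] scaleR_sum_right mult.commute)
    then show ?thesis by (subst sum.swap)
  qed
  have 2: "(\<Sum>i\<in>J. p i x *\<^sub>R fderiv (X i) x (v x)) =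
      (\<Sum>i\<in>J. \<Sum>j\<in>J. (p i x * q j x) *\<^sub>R fderiv (X i) x (X j x))"
    by (intro sum.cong refl)
      (simp add: v_def linear_sum[OF lin] linear_cmul[OF lin] scaleR_sum_right)
  have "(\<Sum>j\<in>J. q j x *\<^sub>R fderiv (X j) x (u x)) - (\<Sum>i\<in>J. p i x *\<^sub>R fderiv (X i) x (v x)) =
      (\<Sum>i\<in>J. \<Sum>j\<in>J. (p i x * q j x) *\<^sub>R field_bracket (X i) (X j) x)"
    by (simp add: 1 2 field_bracket_def scaleR_diff_right sum_subtractf)
  also have "\<dots> = (\<Sum>i\<in>J. \<Sum>j\<in>J. \<Sum>k\<in>J. (p i x * q j x * c i j k) *\<^sub>R X k x)"
    by (intro sum.cong refl) (simp add: br scaleR_sum_right)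
  also have "\<dots> = (\<Sum>i\<in>J. \<Sum>k\<in>J. \<Sum>j\<in>J. (p i x * q j x * c i j k) *\<^sub>R X k x)"
    by (intro sum.cong refl sum.swap)
  also have "\<dots> = (\<Sum>k\<in>J. \<Sum>i\<in>J. \<Sum>j\<in>J. (p i x * q j x * c i j k) *\<^sub>R X k x)"
    by (rule sum.swap)
  also have "\<dots> = (\<Sum>k\<in>J. (\<Sum>i\<in>J. \<Sum>j\<in>J. p i x * q j x * c i j k) *\<^sub>R X k x)"
    by (simp add: scaleR_sum_left)
  finally have 3: "(\<Sum>j\<in>J. q j x *\<^sub>R fderiv (X j) x (u x)) - (\<Sum>i\<in>J. p i x *\<^sub>R fderiv (X i) x (v x)) =
    (\<Sum>k\<in>J. (\<Sum>i\<in>J. \<Sum>j\<in>J. p i x * q j x * c i j k) *\<^sub>R X k x)" .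
  have "field_bracket u v x =
     (\<Sum>j\<in>J. q j x *\<^sub>R fderiv (X j) x (u x)) - (\<Sum>i\<in>J. p i x *\<^sub>R fderiv (X i) x (v x))
     + ((\<Sum>j\<in>J. fderiv (q j) x (u x) *\<^sub>R X j x) - (\<Sum>j\<in>J. fderiv (p j) x (v x) *\<^sub>R X j x))"
    using fderiv_combination[of J X x p "v x", OF X p] fderiv_combination[of J X x q "u x", OF X q]
    by (simp add: field_bracket_def u_def[symmetric] v_def[symmetric])
  also have "\<dots> = (\<Sum>k\<in>J. (fderiv (q k) x (u x) - fderiv (p k) x (v x) +
      (\<Sum>i\<in>J. \<Sum>j\<in>J. p i x * q j x * c i j k)) *\<^sub>R X k x)"
    unfolding 3 by (simp add: scaleR_add_left scaleR_diff_left sum.distrib sum_subtractf)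
  finally show ?thesis .
qed

text \<open>This is what allows the derivative of \<open>F (h + k)\<close> to be split into those of
  \<open>F h\<close> and \<open>F k\<close>.\<close>

lemma linear_fderiv_family:
  fixes Y :: "'e::euclidean_space \<Rightarrow> 'e \<Rightarrow> 'e"
  assumes U: "open U" and lin: "\<And>x. x \<in> U \<Longrightarrow> linear (\<lambda>h. Y h x)"
    and Y: "\<And>h. (Y h has_derivative fderiv (Y h) x) (at x)" and x: "x \<in> U"
  shows "linear (\<lambda>h. fderiv (Y h) x v)"
proof (rule linearI)
  fix g h r
  have "(Y (g + h) has_derivative (\<lambda>v. fderiv (Y g) x v + fderiv (Y h) x v)) (at x)"
    by (rule has_derivative_transform_within_open[OF has_derivative_add[OF Y Y] U x])
      (simp add: linear_add[OF lin])
  from fun_cong[OF has_derivative_unique[OF Y this], of v]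
  show "fderiv (Y (g + h)) x v = fderiv (Y g) x v + fderiv (Y h) x v" .
  have "(Y (r *\<^sub>R h) has_derivative (\<lambda>v. r *\<^sub>R fderiv (Y h) x v)) (at x)"
    by (rule has_derivative_transform_within_open[OF has_derivative_scaleR_right[OF Y] U x])
      (simp add: linear_cmul[OF lin])
  from fun_cong[OF has_derivative_unique[OF Y this], of v]
  show "fderiv (Y (r *\<^sub>R h)) x v = r *\<^sub>R fderiv (Y h) x v" .
qed

text \<open>Linearity in \<open>h\<close> reduces every estimate to the finitely many fields
  \<open>Y b\<close> for basis vectors \<open>b\<close>. The explicit factor \<open>norm h\<close>
  makes fields with small \<open>h\<close> both small and contractive, and gives the remainders
  their order in the increment of \<open>h\<close>.\<close>

lemma linear_family_bounds:
  fixes Y :: "'e::euclidean_space \<Rightarrow> 'e \<Rightarrow> 'e"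
  assumes U: "open U" and lin: "\<And>x. x \<in> U \<Longrightarrow> linear (\<lambda>h. Y h x)"
    and Y: "\<And>k h. times_differentiable_on k (Y h) U"
    and K: "compact K" "convex K" "K \<subseteq> U"
  obtains C where "C \<ge> 0"
    "\<And>h x. x \<in> K \<Longrightarrow> norm (Y h x) \<le> C * norm h"
    "\<And>h x y. x \<in> K \<Longrightarrow> y \<in> K \<Longrightarrow> norm (Y h y - Y h x) \<le> C * norm h * norm (y - x)"
    "\<And>h x v. x \<in> K \<Longrightarrow> norm (fderiv (Y h) x v) \<le> C * norm h * norm v"
    "\<And>h x y. x \<in> K \<Longrightarrow> y \<in> K \<Longrightarrow>
       norm (Y h y - Y h x - fderiv (Y h) x (y - x)) \<le> C * norm h * (norm (y - x))\<^sup>2"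
proof -
  have "\<exists>C\<ge>0. \<forall>x\<in>K. norm (Y b x) \<le> C" for b
  proof -
    have "continuous_on K (Y b)" using Y[of 0 b] K(3) by (auto intro: continuous_on_subset)
    from compact_continuous_norm_bound[OF K(1) this] show ?thesis .
  qed
  then obtain C1 where C1: "\<And>b. C1 b \<ge> 0" "\<And>b x. x \<in> K \<Longrightarrow> norm (Y b x) \<le> C1 b" by metis
  have "\<exists>C\<ge>0. \<forall>x\<in>K. \<forall>y\<in>K. norm (Y b y - Y b x) \<le> C * norm (y - x)" for b
    using lipschitz_on_compact_convex[OF Y K] by metis
  then obtain C2 where C2: "\<And>b. C2 b \<ge> 0"
    "\<And>b x y. x \<in> K \<Longrightarrow> y \<in> K \<Longrightarrow> norm (Y b y - Y b x) \<le> C2 b * norm (y - x)" by metis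
  have "\<exists>C\<ge>0. \<forall>x\<in>K. \<forall>v. norm (fderiv (Y b) x v) \<le> C * norm v" for b
    using frechet_derivative_bounded_on_compact[OF Y K(1,3)] by metis
  then obtain C3 where C3: "\<And>b. C3 b \<ge> 0"
    "\<And>b x v. x \<in> K \<Longrightarrow> norm (fderiv (Y b) x v) \<le> C3 b * norm v" by metis
  have "\<exists>C\<ge>0. \<forall>x\<in>K. \<forall>y\<in>K. norm (Y b y - Y b x - fderiv (Y b) x (y - x)) \<le> C * (norm (y - x))\<^sup>2" for b
    using quadratic_approximation_on_compact_convex[OF Y K] by metis
  then obtain C4 where C4: "\<And>b. C4 b \<ge> 0"
    "\<And>b x y. x \<in> K \<Longrightarrow> y \<in> K \<Longrightarrow> norm (Y b y - Y b x - fderiv (Y b) x (y - x)) \<le> C4 b * (norm (y - x))\<^sup>2"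
    by metis
  let ?c = "\<lambda>b. C1 b + C2 b + C3 b + C4 b"
  let ?C = "\<Sum>b\<in>Basis. ?c b"
  have main: "norm (l h) \<le> ?C * norm h * \<rho>"
    if "linear l" "\<And>b. norm (l b) \<le> C' b * \<rho>" "\<And>b. C' b \<le> ?c b" "\<rho> \<ge> 0"
    for l :: "'e \<Rightarrow> 'e" and C' \<rho> h
  proof -
    have "norm (l b) \<le> ?c b * \<rho>" for b
      using that(2)[of b] mult_right_mono[OF that(3,4), of b] by linarith
    from linear_norm_bound_Basis[OF that(1) this, of h]
    have "norm (l h) \<le> (\<Sum>b\<in>Basis. ?c b * \<rho>) * norm h" .
    also have "(\<Sum>b\<in>Basis. ?c b * \<rho>) = ?C * \<rho>" by (rule sum_distrib_right[symmetric])
    finally show ?thesis by (simp only: mult.assoc mult.commute mult.left_commute)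
  qed
  have D: "linear (\<lambda>h. fderiv (Y h) x v)" if "x \<in> K" for x v
    using that K(3) by (intro linear_fderiv_family[OF U lin times_differentiable_on_has_derivative[OF Y]]) auto
  have Y0: "linear (\<lambda>h. Y h x)" if "x \<in> K" for x using that K(3) lin by blast
  note nn = C1(1) C2(1) C3(1) C4(1)
  show ?thesis
  proof (rule that[of ?C])
    show "?C \<ge> 0" by (intro sum_nonneg add_nonneg_nonneg nn)
    fix h x assume x: "x \<in> K"
    show "norm (Y h x) \<le> ?C * norm h"
      using main[OF Y0[OF x], of C1 1 h] C1(2)[OF x] nn by (simp add: add_nonneg_nonneg)
    show "norm (fderiv (Y h) x v) \<le> ?C * norm h * norm v" for v
      by (rule main[OF D[OF x] C3(2)[OF x]]) (simp_all add: nn add_nonneg_nonneg)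
    fix y assume y: "y \<in> K"
    show "norm (Y h y - Y h x) \<le> ?C * norm h * norm (y - x)"
      by (rule main[OF linear_compose_sub[OF Y0[OF y] Y0[OF x]] C2(2)[OF x y]])
        (simp_all add: nn add_nonneg_nonneg)
    show "norm (Y h y - Y h x - fderiv (Y h) x (y - x)) \<le> ?C * norm h * (norm (y - x))\<^sup>2"
      by (rule main[OF linear_compose_sub[OF linear_compose_sub[OF Y0[OF y] Y0[OF x]] D[OF x]] C4(2)[OF x y]])
        (simp_all add: nn add_nonneg_nonneg)
  qed
qed

section \<open>Fields transverse to a leaf and their vanishing\<close>

text \<open>The coefficients \<open>f\<close> normalise the family: the field \<open>\<Sum>\<^sub>j f j h x X\<^sub>j(x)\<close> lies in its span and
  has the constant projection \<open>\<pi> h\<close> to the span of the \<open>X\<^sub>j(x0)\<close>.\<close>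

locale adapted_family =
  fixes J :: "'i set" and X :: "'i \<Rightarrow> 'e::euclidean_space \<Rightarrow> 'e" and c :: "'i \<Rightarrow> 'i \<Rightarrow> 'i \<Rightarrow> real"
    and U :: "'e set" and x0 :: 'e and \<pi> :: "'e \<Rightarrow> 'e" and f :: "'i \<Rightarrow> 'e \<Rightarrow> 'e \<Rightarrow> real"
  assumes finite_J: "finite J"
    and open_U: "open U" and x0: "x0 \<in> U"
    and smooth_X: "\<And>j k. j \<in> J \<Longrightarrow> times_differentiable_on k (X j) U"
    and bracket_X: "\<And>i j x. i \<in> J \<Longrightarrow> j \<in> J \<Longrightarrow> x \<in> U \<Longrightarrow>
          field_bracket (X i) (X j) x = (\<Sum>k\<in>J. c i j k *\<^sub>R X k x)"
    and linear_\<pi>: "linear \<pi>"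
    and linear_f: "\<And>j x. j \<in> J \<Longrightarrow> x \<in> U \<Longrightarrow> linear (\<lambda>h. f j h x)"
    and smooth_f: "\<And>j h k. j \<in> J \<Longrightarrow> times_differentiable_on k (f j h) U"
    and \<pi>_combination: "\<And>h x. x \<in> U \<Longrightarrow> \<pi> (\<Sum>j\<in>J. f j h x *\<^sub>R X j x) = \<pi> h"
    and f_\<pi>: "\<And>j h x. j \<in> J \<Longrightarrow> x \<in> U \<Longrightarrow> f j (\<pi> h) x = f j h x"
    and combination_x0: "\<And>j. j \<in> J \<Longrightarrow> (\<Sum>i\<in>J. f i (X j x0) x0 *\<^sub>R X i x0) = X j x0"
begin

definition F :: "'e \<Rightarrow> 'e \<Rightarrow> 'e" where "F h x = (\<Sum>j\<in>J. f j h x *\<^sub>R X j x)"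

definition Z :: "'i \<Rightarrow> 'e \<Rightarrow> 'e" where "Z j x = X j x - F (X j x) x"

lemma linear_F:
  assumes "x \<in> U"
  shows "linear (\<lambda>h. F h x)"
proof (rule linearI)
  show "F (g + h) x = F g x + F h x" for g h
    using linear_add[OF linear_f[OF _ assms]] by (simp add: F_def scaleR_add_left sum.distrib)
  show "F (r *\<^sub>R h) x = r *\<^sub>R F h x" for r h
    using linear_cmul[OF linear_f[OF _ assms]] by (simp add: F_def scaleR_sum_right)
qed

lemma smooth_F: "times_differentiable_on k (F h) U"
  unfolding F_def
  by (intro times_differentiable_on_sum times_differentiable_on_scaleR open_U smooth_f smooth_X)

lemma \<pi>_F: "x \<in> U \<Longrightarrow> \<pi> (F h x) = \<pi> h"
  unfolding F_def by (rule \<pi>_combination)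

lemma F_\<pi>: "x \<in> U \<Longrightarrow> F (\<pi> h) x = F h x"
  unfolding F_def by (simp add: f_\<pi> cong: sum.cong)

lemma Z_x0: "j \<in> J \<Longrightarrow> Z j x0 = 0"
  unfolding Z_def F_def using combination_x0 by simp

lemma \<pi>_Z: "x \<in> U \<Longrightarrow> \<pi> (Z j x) = 0"
  unfolding Z_def using \<pi>_F linear_diff[OF linear_\<pi>] by simp

definition Z_coeff :: "'i \<Rightarrow> 'i \<Rightarrow> 'e \<Rightarrow> real" where
  "Z_coeff j k x = (if j = k then 1 else 0) - f k (X j x) x"

lemma Z_combination: "j \<in> J \<Longrightarrow> Z j = (\<lambda>x. \<Sum>k\<in>J. Z_coeff j k x *\<^sub>R X k x)"
proof
  fix x assume j: "j \<in> J"
  have "(\<Sum>k\<in>J. (if j = k then 1 else 0) *\<^sub>R X k x) = (\<Sum>k\<in>J. if j = k then X k x else 0)"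
    by (intro sum.cong) auto
  then have "(\<Sum>k\<in>J. (if j = k then 1 else 0) *\<^sub>R X k x) = X j x"
    using j finite_J by simp
  then show "Z j x = (\<Sum>k\<in>J. Z_coeff j k x *\<^sub>R X k x)"
    by (simp add: Z_def F_def Z_coeff_def scaleR_diff_left sum_subtractf)
qed

text \<open>The field value \<open>X j x\<close> occupies the linear argument of \<open>f k\<close>;
  expanding it in the basis leaves functions \<open>f k b\<close> with fixed argument.\<close>

lemma smooth_Z_coeff:
  assumes "j \<in> J" "k \<in> J"
  shows "times_differentiable_on n (Z_coeff j k) U"
proof -
  have 1: "times_differentiable_on n (\<lambda>x. (if j = k then 1 else 0) - (\<Sum>b\<in>Basis. (X j x \<bullet> b) *\<^sub>R f k b x)) U"
    using assms by (intro times_differentiable_on_minus times_differentiable_on_sum open_U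
        times_differentiable_on_scaleR times_differentiable_on_inner_const smooth_f smooth_X) auto
  have "(\<Sum>b\<in>Basis. (X j x \<bullet> b) *\<^sub>R f k b x) = f k (X j x) x" if "x \<in> U" for x
    by (rule linear_euclidean_sum[OF linear_f[OF assms(2) that], symmetric])
  then show ?thesis
    by (intro times_differentiable_on_cong[OF open_U _ 1]) (simp add: Z_coeff_def)
qed

lemma smooth_Z: "j \<in> J \<Longrightarrow> times_differentiable_on k (Z j) U"
  unfolding Z_combination
  by (intro times_differentiable_on_sum times_differentiable_on_scaleR open_U smooth_Z_coeff smooth_X)

text \<open>Consequently the bracket of two fields with constant projection lies in the kernel of
  \<pi>. This is why \<open>F h\<close> is normalised to have projection \<open>\<pi> h\<close> at
  every point.\<close>

lemma \<pi>_fderiv_eq_0: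
  assumes u: "times_differentiable_on (Suc 0) u U" and const: "\<And>x. x \<in> U \<Longrightarrow> \<pi> (u x) = a" and x: "x \<in> U"
  shows "\<pi> (fderiv u x w) = 0"
proof -
  have "bounded_linear \<pi>" using linear_\<pi> linear_conv_bounded_linear by blast
  then have "((\<lambda>x. \<pi> (u x)) has_derivative (\<lambda>w. \<pi> (fderiv u x w))) (at x)"
    by (rule bounded_linear.has_derivative[OF _ times_differentiable_on_has_derivative[OF u x]])
  then have "((\<lambda>x. a) has_derivative (\<lambda>w. \<pi> (fderiv u x w))) (at x)"
    by (rule has_derivative_transform_within_open[OF _ open_U x]) (rule const)
  from fun_cong[OF has_derivative_unique[OF this has_derivative_const[of a]], of w] show ?thesis .
qed

text \<open>A combination of the \<open>X\<^sub>k\<close> in the kernel of \<open>\<pi>\<close> is the same combination of the \<open>Z\<^sub>k\<close>.\<close>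

lemma field_bracket_bound:
  assumes p: "\<And>k. k \<in> J \<Longrightarrow> times_differentiable_on (Suc 0) (p k) U"
    and q: "\<And>k. k \<in> J \<Longrightarrow> times_differentiable_on (Suc 0) (q k) U"
    and K: "compact K" "K \<subseteq> U"
    and u_def: "u = (\<lambda>x. \<Sum>j\<in>J. p j x *\<^sub>R X j x)" and v_def: "v = (\<lambda>x. \<Sum>j\<in>J. q j x *\<^sub>R X j x)"
    and \<pi>u: "\<And>x. x \<in> U \<Longrightarrow> \<pi> (u x) = a" and \<pi>v: "\<And>x. x \<in> U \<Longrightarrow> \<pi> (v x) = b"
  shows "\<exists>C\<ge>0. \<forall>x\<in>K. norm (field_bracket u v x) \<le> C * (\<Sum>k\<in>J. norm (Z k x))"
proof -
  have u: "times_differentiable_on (Suc 0) u U" and v: "times_differentiable_on (Suc 0) v U"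
    unfolding u_def v_def
    by (intro times_differentiable_on_sum times_differentiable_on_scaleR open_U p q smooth_X; assumption)+
  let ?d = "\<lambda>k x. fderiv (q k) x (u x) - fderiv (p k) x (v x) + (\<Sum>i\<in>J. \<Sum>j\<in>J. p i x * q j x * c i j k)"
  have eq: "field_bracket u v x = (\<Sum>k\<in>J. ?d k x *\<^sub>R Z k x)" if x: "x \<in> U" for x
  proof -
    have br: "field_bracket u v x = (\<Sum>k\<in>J. ?d k x *\<^sub>R X k x)"
      unfolding u_def v_def
      by (rule field_bracket_combinations[OF times_differentiable_on_has_derivative[OF smooth_X x] times_differentiable_on_has_derivative[OF p x]
            times_differentiable_on_has_derivative[OF q x] bracket_X[OF _ _ x]])
    have "\<pi> (field_bracket u v x) = 0"
      using \<pi>_fderiv_eq_0[OF u \<pi>u x] \<pi>_fderiv_eq_0[OF v \<pi>v x]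
      by (simp add: field_bracket_def linear_diff[OF linear_\<pi>])
    \<comment> \<open>\<open>F\<close> depends on its first argument only through \<pi>. Subtracting
      this vanishing expression from the expansion of the bracket replaces each \<open>X k x\<close>
      by \<open>Z k x\<close>.\<close>
    then have "F (field_bracket u v x) x = 0"
      using F_\<pi>[OF x, of "field_bracket u v x"] linear_0[OF linear_F[OF x]] by simp
    then have "(\<Sum>k\<in>J. ?d k x *\<^sub>R F (X k x) x) = 0"
      unfolding br by (simp add: linear_sum[OF linear_F[OF x]] linear_cmul[OF linear_F[OF x]])
    then show ?thesis
      unfolding br by (simp add: Z_def scaleR_diff_right sum_subtractf)
  qed
  have "\<forall>k\<in>J. \<exists>C\<ge>0. \<forall>x\<in>K. norm (?d k x) \<le> C"
  proof
    fix k assume k: "k \<in> J"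
    note S0 = times_differentiable_on_Suc_imp
    have "times_differentiable_on 0 (\<lambda>x. fderiv (q k) x (u x)) U"
      by (rule times_differentiable_on_fderiv_apply[OF open_U q[OF k] S0[OF u]])
    moreover have "times_differentiable_on 0 (\<lambda>x. fderiv (p k) x (v x)) U"
      by (rule times_differentiable_on_fderiv_apply[OF open_U p[OF k] S0[OF v]])
    moreover have "times_differentiable_on 0 (\<lambda>x. \<Sum>i\<in>J. \<Sum>j\<in>J. p i x * q j x * c i j k) U"
      by (rule times_differentiable_on_sum[OF open_U] times_differentiable_on_mult[OF open_U]
          times_differentiable_on_const S0[OF p] S0[OF q] | assumption)+
    ultimately have "times_differentiable_on 0 (?d k) U"
      by (intro times_differentiable_on_add[OF open_U] times_differentiable_on_minus[OF open_U])
    then have "continuous_on K (?d k)"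
      using K(2) by (auto intro: continuous_on_subset)
    from compact_continuous_norm_bound[OF K(1) this]
    show "\<exists>C\<ge>0. \<forall>x\<in>K. norm (?d k x) \<le> C" .
  qed
  from bchoice[OF this]
  obtain C where C: "\<And>k. k \<in> J \<Longrightarrow> C k \<ge> 0" "\<And>k x. k \<in> J \<Longrightarrow> x \<in> K \<Longrightarrow> norm (?d k x) \<le> C k"
    by blast
  show ?thesis
  proof (intro exI[of _ "\<Sum>k\<in>J. C k"] conjI ballI)
    show "0 \<le> (\<Sum>k\<in>J. C k)" using C(1) by (simp add: sum_nonneg)
    fix x assume x: "x \<in> K"
    then have xU: "x \<in> U" using K(2) by blast
    have "norm (field_bracket u v x) \<le> (\<Sum>k\<in>J. norm (?d k x *\<^sub>R Z k x))"
      unfolding eq[OF xU] by (rule norm_sum)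
    also have "\<dots> \<le> (\<Sum>k\<in>J. (\<Sum>k\<in>J. C k) * norm (Z k x))"
    proof (rule sum_mono)
      fix k assume k: "k \<in> J"
      have "C k \<le> (\<Sum>k\<in>J. C k)" using k C(1) finite_J by (intro member_le_sum) auto
      then show "norm (?d k x *\<^sub>R Z k x) \<le> (\<Sum>k\<in>J. C k) * norm (Z k x)"
        using C(2)[OF k x] by (simp add: mult_right_mono)
    qed
    finally show "norm (field_bracket u v x) \<le> (\<Sum>k\<in>J. C k) * (\<Sum>k\<in>J. norm (Z k x))"
      by (simp add: sum_distrib_left)
  qed
qed

text \<open>The \<open>Z\<^sub>j\<close> satisfy a linear homogeneous differential equation along the integral curves of
  \<open>F h\<close> and vanish initially.\<close>

lemma Z_eq_0_along_curve:
  assumes K: "compact K" "K \<subseteq> U"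
    and y: "y 0 = x0" "\<And>t. t \<in> {0..1} \<Longrightarrow> y t \<in> K"
      "\<And>t. t \<in> {0..1} \<Longrightarrow> (y has_vector_derivative F h (y t)) (at t within {0..1})"
    and t: "t \<in> {0..1}" and j: "j \<in> J"
  shows "Z j (y t) = 0"
proof -
  have "\<forall>j\<in>J. \<exists>C\<ge>0. \<forall>x\<in>K. norm (field_bracket (F h) (Z j) x) \<le> C * (\<Sum>k\<in>J. norm (Z k x))"
  proof
    fix j assume j: "j \<in> J"
    have ZF: "Z j = (\<lambda>x. \<Sum>k\<in>J. Z_coeff j k x *\<^sub>R X k x)" "F h = (\<lambda>x. \<Sum>k\<in>J. f k h x *\<^sub>R X k x)"
      using Z_combination[OF j] by (auto simp: F_def)
    have "times_differentiable_on (Suc 0) (Z_coeff j k) U" "times_differentiable_on (Suc 0) (f k h) U"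
      if "k \<in> J" for k
      using smooth_Z_coeff[OF j that] smooth_f[OF that] by blast+
    from field_bracket_bound[OF this(2) this(1) K ZF(2,1) \<pi>_F \<pi>_Z]
    show "\<exists>C\<ge>0. \<forall>x\<in>K. norm (field_bracket (F h) (Z j) x) \<le> C * (\<Sum>k\<in>J. norm (Z k x))" .
  qed
  from bchoice[OF this] obtain C where C: "\<And>j. j \<in> J \<Longrightarrow> C j \<ge> 0"
    "\<And>j x. j \<in> J \<Longrightarrow> x \<in> K \<Longrightarrow> norm (field_bracket (F h) (Z j) x) \<le> C j * (\<Sum>k\<in>J. norm (Z k x))"
    by blast
  obtain B where B: "B \<ge> 0" "\<And>x v. x \<in> K \<Longrightarrow> norm (fderiv (F h) x v) \<le> B * norm v"
    using frechet_derivative_bounded_on_compact[OF smooth_F K] by blast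
  let ?N = "\<lambda>t. \<Sum>k\<in>J. norm (Z k (y t))"
  let ?A = "(\<Sum>k\<in>J. C k) + B"
  let ?z = "\<lambda>j t. fderiv (Z j) (y t) (F h (y t))"
  have A0: "?A \<ge> 0" using B(1) C(1) by (simp add: sum_nonneg)
  have z: "((\<lambda>t. Z j (y t)) has_derivative (\<lambda>s. s *\<^sub>R ?z j t)) (at t within {0..1})"
    if j: "j \<in> J" and t: "t \<in> {0..1}" for j t
  proof -
    have yU: "y t \<in> U" using y(2)[OF t] K(2) by blast
    have Zd: "(Z j has_derivative fderiv (Z j) (y t)) (at (y t))"
      by (rule times_differentiable_on_has_derivative[OF smooth_Z[OF j] yU])
    from has_derivative_compose[OF y(3)[OF t, unfolded has_vector_derivative_def] Zd]
    show ?thesis using linear_cmul[OF has_derivative_linear[OF Zd]] by simp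
  qed
  have znorm: "norm (?z j t) \<le> ?A * ?N t" if j: "j \<in> J" and t: "t \<in> {0..1}" for j t
  proof -
    \<comment> \<open>The derivative of \<open>Z j\<close> along \<open>F h\<close> is the bracket
      plus a term linear in \<open>Z j\<close>; both are controlled by the \<open>Z k\<close> at the
      same point.\<close>
    have "?z j t = field_bracket (F h) (Z j) (y t) + fderiv (F h) (y t) (Z j (y t))"
      by (simp add: field_bracket_def)
    then have "norm (?z j t) \<le> norm (field_bracket (F h) (Z j) (y t)) + norm (fderiv (F h) (y t) (Z j (y t)))"
      using norm_triangle_ineq by simp
    also have "\<dots> \<le> C j * ?N t + B * norm (Z j (y t))"
      by (intro add_mono C(2)[OF j y(2)[OF t]] B(2)[OF y(2)[OF t]])
    also have "\<dots> \<le> (\<Sum>k\<in>J. C k) * ?N t + B * ?N t"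
    proof (intro add_mono mult_right_mono mult_left_mono)
      show "C j \<le> (\<Sum>k\<in>J. C k)" by (rule member_le_sum) (use j C(1) finite_J in auto)
      show "norm (Z j (y t)) \<le> ?N t"
        using member_le_sum[of j J "\<lambda>k. norm (Z k (y t))"] j finite_J by simp
    qed (use B(1) in \<open>auto intro: sum_nonneg\<close>)
    finally show ?thesis by (simp add: distrib_right)
  qed
  \<comment> \<open>Gronwall with zero inhomogeneity and zero initial value. All \<open>Z j\<close>
    are treated together because their equations are coupled; \<open>card J\<close> arises when the
    square of the sum of norms is bounded by the sum of squares.\<close>
  have "(\<Sum>j\<in>J. Z j (y t) \<bullet> Z j (y t)) \<le> 0 * exp (2 * ?A * card J)"
  proof (rule gronwall[OF _ _ _ _ _ t])
    fix t :: real assume t: "t \<in> {0..1}"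
    have "((\<lambda>t. \<Sum>j\<in>J. Z j (y t) \<bullet> Z j (y t)) has_derivative
       (\<lambda>s. \<Sum>j\<in>J. Z j (y t) \<bullet> (s *\<^sub>R ?z j t) + (s *\<^sub>R ?z j t) \<bullet> Z j (y t))) (at t within {0..1})"
      by (intro has_derivative_sum has_derivative_inner z t)
    then show "((\<lambda>t. \<Sum>j\<in>J. Z j (y t) \<bullet> Z j (y t)) has_real_derivative
        (\<Sum>j\<in>J. 2 * (Z j (y t) \<bullet> ?z j t))) (at t within {0..1})"
      unfolding has_field_derivative_def
      by (rule has_derivative_eq_rhs) (simp add: fun_eq_iff inner_commute sum_distrib_left sum_distrib_right mult_ac)
    have "(\<Sum>j\<in>J. 2 * (Z j (y t) \<bullet> ?z j t)) \<le> (\<Sum>j\<in>J. 2 * (norm (Z j (y t)) * (?A * ?N t)))"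
    proof (rule sum_mono)
      fix j assume "j \<in> J"
      then show "2 * (Z j (y t) \<bullet> ?z j t) \<le> 2 * (norm (Z j (y t)) * (?A * ?N t))"
        using norm_cauchy_schwarz[of "Z j (y t)" "?z j t"]
          mult_left_mono[OF znorm[OF _ t, of j], of "norm (Z j (y t))"] by simp
    qed
    also have "\<dots> = 2 * ?A * (?N t)\<^sup>2"
      by (simp add: power2_eq_square sum_distrib_left sum_distrib_right algebra_simps)
    also have "\<dots> \<le> 2 * ?A * (card J * (\<Sum>j\<in>J. (norm (Z j (y t)))\<^sup>2))"
      using A0 sum_squared_le_sum_of_squares[of "\<lambda>j. norm (Z j (y t))" J]
      by (intro mult_left_mono) (simp_all add: mult.commute)
    finally show "(\<Sum>j\<in>J. 2 * (Z j (y t) \<bullet> ?z j t)) \<le>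
        2 * ?A * card J * (\<Sum>j\<in>J. Z j (y t) \<bullet> Z j (y t)) + 0"
      by (simp add: power2_norm_eq_inner)
  qed (use A0 y(1) Z_x0 in auto)
  then have "(\<Sum>j\<in>J. Z j (y t) \<bullet> Z j (y t)) = 0"
    by (simp add: antisym sum_nonneg)
  then show ?thesis
    using j finite_J by (simp add: sum_nonneg_eq_0_iff)
qed

end

section \<open>Differentiability of the time-one map\<close>

lemma has_derivative_quadratic:
  fixes G :: "'a::real_normed_vector \<Rightarrow> 'b::real_normed_vector"
  assumes D: "bounded_linear D" and \<delta>: "\<delta> > 0"
    and le: "\<And>k. norm k < \<delta> \<Longrightarrow> norm (G (h + k) - G h - D k) \<le> C * (norm k)\<^sup>2"
  shows "(G has_derivative D) (at h)"
  unfolding has_derivative_at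
proof (intro conjI D)
  have "((\<lambda>k::'a. C * norm k) \<longlongrightarrow> C * norm (0::'a)) (at 0)"
    by (rule tendsto_mult[OF tendsto_const tendsto_norm[OF tendsto_ident_at]])
  then have lim: "((\<lambda>k::'a. C * norm k) \<longlongrightarrow> 0) (at 0)" by simp
  have "\<forall>\<^sub>F k in at 0. norm (norm (G (h + k) - G h - D k) / norm k) \<le> C * norm k"
    unfolding eventually_at
  proof (intro exI conjI ballI impI)
    fix k :: 'a assume "k \<noteq> 0 \<and> dist k 0 < \<delta>"
    then show "norm (norm (G (h + k) - G h - D k) / norm k) \<le> C * norm k"
      using le[of k] by (simp add: divide_simps power2_eq_square mult.assoc)
  qed (rule \<delta>)
  from Lim_null_comparison[OF this lim]
  show "((\<lambda>k. norm (G (h + k) - G h - D k) / norm k) \<longlongrightarrow> 0) (at 0)" .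
qed

context adapted_family
begin

text \<open>The bracket is bounded by the \<open>Z k\<close>, here on the compact set consisting of
  \<open>x\<close> alone. Commutation is thus obtained exactly at points where the
  \<open>Z k\<close> vanish, in particular along the integral curves from \<open>x0\<close>.\<close>

lemma field_bracket_F_eq_0:
  assumes "x \<in> U" "\<And>j. j \<in> J \<Longrightarrow> Z j x = 0"
  shows "field_bracket (F g) (F h) x = 0"
proof -
  have F: "F h = (\<lambda>x. \<Sum>k\<in>J. f k h x *\<^sub>R X k x)" for h by (auto simp: F_def)
  have K: "compact {x}" "{x} \<subseteq> U" using assms by auto
  obtain C where "norm (field_bracket (F g) (F h) x) \<le> C * (\<Sum>k\<in>J. norm (Z k x))"
    using field_bracket_bound[OF smooth_f smooth_f K F F \<pi>_F \<pi>_F] by auto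
  then show ?thesis using assms(2) by simp
qed

text \<open>\<open>G h\<close> is the value at time \<open>1\<close> of the integral curve \<open>y h\<close> of \<open>F h\<close> through \<open>x0\<close>. Since
  \<open>F h\<close> and \<open>F k\<close> commute along \<open>y h\<close>, the curve \<open>t F k (y h t)\<close> solves the variational equation.\<close>

lemma leaf_parametrization:
  obtains \<epsilon> G where "\<epsilon> > 0" "G 0 = x0" "\<And>h. norm h < \<epsilon> \<Longrightarrow> G h \<in> U"
    "\<And>h. norm h < \<epsilon> \<Longrightarrow> (G has_derivative (\<lambda>k. F k (G h))) (at h)"
    "\<And>h j. norm h < \<epsilon> \<Longrightarrow> j \<in> J \<Longrightarrow> F (X j (G h)) (G h) = X j (G h)"
proof -
  obtain r where r: "r > 0" "cball x0 r \<subseteq> U"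
    using open_U x0 open_contains_cball by blast
  let ?K = "cball x0 r"
  obtain C where C: "C \<ge> 0"
    "\<And>h x. x \<in> ?K \<Longrightarrow> norm (F h x) \<le> C * norm h"
    "\<And>h x y. x \<in> ?K \<Longrightarrow> y \<in> ?K \<Longrightarrow> norm (F h y - F h x) \<le> C * norm h * norm (y - x)"
    "\<And>h x v. x \<in> ?K \<Longrightarrow> norm (fderiv (F h) x v) \<le> C * norm h * norm v"
    "\<And>h x y. x \<in> ?K \<Longrightarrow> y \<in> ?K \<Longrightarrow>
       norm (F h y - F h x - fderiv (F h) x (y - x)) \<le> C * norm h * (norm (y - x))\<^sup>2"
    using linear_family_bounds[OF open_U linear_F smooth_F _ _ r(2)] by auto
  \<comment> \<open>The bound \<open>1 / 2\<close> makes \<open>F h\<close> contractive for the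
    Picard iteration, and the bound \<open>r\<close> keeps its curve in the ball for unit time. The
    summand \<open>1\<close> in the witness guards against \<open>C = 0\<close>.\<close>
  obtain \<epsilon> where \<epsilon>: "\<epsilon> > 0" "C * \<epsilon> \<le> 1 / 2" "C * \<epsilon> \<le> r"
  proof (rule that[of "min (1 / 2) r / (C + 1)"])
    show "0 < min (1 / 2) r / (C + 1)" using r C(1) by simp
    have "C * (min (1 / 2) r / (C + 1)) \<le> min (1 / 2) r"
      using C(1) r mult_right_mono[of "C / (C + 1)" 1 "min (1 / 2) r"] by simp
    then show "C * (min (1 / 2) r / (C + 1)) \<le> 1 / 2" "C * (min (1 / 2) r / (C + 1)) \<le> r"
      by linarith+
  qed
  have C\<epsilon>: "C * norm h \<le> C * \<epsilon>" if "norm h < \<epsilon>" for h :: 'e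
    using that C(1) by (intro mult_left_mono) auto
  have "\<exists>y. y 0 = x0 \<and> (\<forall>t\<in>{0..1}. y t \<in> ?K) \<and>
      (\<forall>t\<in>{0..1}. (y has_vector_derivative F h (y t)) (at t within {0..1}))" if h: "norm h < \<epsilon>" for h
  proof (rule integral_curve_in_ball[of x0 r "F h" "C * norm h" "C * norm h"])
    show "C * norm h < 1" "C * norm h \<le> r" using C\<epsilon>[OF h] \<epsilon> by auto
  qed (use C(1,2,3) r in auto)
  then obtain y where y: "\<And>h. norm h < \<epsilon> \<Longrightarrow> y h 0 = x0"
    "\<And>h t. norm h < \<epsilon> \<Longrightarrow> t \<in> {0..1} \<Longrightarrow> y h t \<in> ?K"
    "\<And>h t. norm h < \<epsilon> \<Longrightarrow> t \<in> {0..1} \<Longrightarrow>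
       (y h has_vector_derivative F h (y h t)) (at t within {0..1})"
    by metis
  have yU: "y h t \<in> U" if "norm h < \<epsilon>" "t \<in> {0..1}" for h t
    using y(2)[OF that] r by blast
  have Z0: "Z j (y h t) = 0" if "norm h < \<epsilon>" "t \<in> {0..1}" "j \<in> J" for h t j
    by (rule Z_eq_0_along_curve[of ?K "y h" h]) (use r y that in auto)
  \<comment> \<open>The Gronwall factor for the Lipschitz constant \<open>C * \<epsilon>\<close>
    shared by all \<open>F h\<close> with \<open>norm h < \<epsilon>\<close>.\<close>
  define M where "M = exp (2 * (C * \<epsilon>) + 1)"
  have M: "M \<ge> 0" by (simp add: M_def)
  have C\<epsilon>0: "C * \<epsilon> \<ge> 0" using C(1) \<epsilon> by simp
  have der: "((\<lambda>h. y h 1) has_derivative (\<lambda>k. F k (y h 1))) (at h)" if h: "norm h < \<epsilon>" for h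
  proof (rule has_derivative_quadratic[of _ "\<epsilon> - norm h" _ _ "(C * \<epsilon> * (C * M)\<^sup>2 + C * C) * M"])
    show "bounded_linear (\<lambda>k. F k (y h 1))"
      using linear_F[OF yU[OF h, of 1]] linear_conv_bounded_linear by auto
    show "0 < \<epsilon> - norm h" using h by simp
    fix k :: 'e assume "norm k < \<epsilon> - norm h"
    then have hk: "norm (h + k) < \<epsilon>" using norm_triangle_ineq[of h k] by linarith
    let ?\<delta> = "\<lambda>t. y (h + k) t - y h t"
    have d\<delta>: "(?\<delta> has_vector_derivative (F (h + k) (y (h + k) t) - F h (y h t))) (at t within {0..1})"
      if t: "t \<in> {0..1}" for t
      by (intro has_vector_derivative_diff y(3) h hk t)
    have F_add: "F (h + k) x = F h x + F k x" if "x \<in> U" for x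
      by (rule linear_add[OF linear_F[OF that]])
    \<comment> \<open>A first estimate, linear in \<open>norm k\<close>; inserted into the Taylor
      remainder below it becomes quadratic.\<close>
    have \<delta>: "norm (?\<delta> t) \<le> C * norm k * M" if t: "t \<in> {0..1}" for t
      unfolding M_def
    proof (rule gronwall_norm[OF d\<delta> _ _ _ _ t])
      fix t :: real assume t: "t \<in> {0..1}"
      have "F (h + k) (y (h + k) t) - F h (y h t) =
          (F (h + k) (y (h + k) t) - F (h + k) (y h t)) + F k (y h t)"
        using F_add[OF yU[OF h t]] by simp
      then have "norm (F (h + k) (y (h + k) t) - F h (y h t)) \<le>
          norm (F (h + k) (y (h + k) t) - F (h + k) (y h t)) + norm (F k (y h t))"
        by (simp only: norm_triangle_ineq)
      also have "\<dots> \<le> C * norm (h + k) * norm (?\<delta> t) + C * norm k"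
        by (intro add_mono C(2,3) y(2) h hk t)
      also have "\<dots> \<le> C * \<epsilon> * norm (?\<delta> t) + C * norm k"
        using C\<epsilon>[OF hk] by (intro add_mono mult_right_mono) auto
      finally show "norm (F (h + k) (y (h + k) t) - F h (y h t)) \<le> C * \<epsilon> * norm (?\<delta> t) + C * norm k" .
    qed (use C(1) C\<epsilon>0 y(1) h hk in auto)
    \<comment> \<open>The difference between the true variation of the curve and the predicted
      first-order variation.\<close>
    let ?w = "\<lambda>t. ?\<delta> t - t *\<^sub>R F k (y h t)"
    let ?D = "\<lambda>g t v. fderiv (F g) (y h t) v"
    let ?w' = "\<lambda>t. F (h + k) (y (h + k) t) - F h (y h t) - (t *\<^sub>R ?D k t (F h (y h t)) + 1 *\<^sub>R F k (y h t))"
    have dw: "(?w has_vector_derivative ?w' t) (at t within {0..1})" if t: "t \<in> {0..1}" for t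
    proof -
      have Fd: "(F k has_derivative ?D k t) (at (y h t))"
        by (rule times_differentiable_on_has_derivative[OF smooth_F yU[OF h t]])
      have "((\<lambda>t. F k (y h t)) has_vector_derivative ?D k t (F h (y h t))) (at t within {0..1})"
        using has_derivative_compose[OF y(3)[OF h t, unfolded has_vector_derivative_def] Fd]
          linear_cmul[OF has_derivative_linear[OF Fd]]
        by (simp add: has_vector_derivative_def)
      then show ?thesis
        by (intro has_vector_derivative_diff d\<delta>[OF t] has_vector_derivative_scaleR) (auto intro!: derivative_eq_intros)
    qed
    have "norm (?w 1) \<le> ((C * \<epsilon> * (C * M)\<^sup>2 + C * C) * (norm k)\<^sup>2) * M"
      unfolding M_def[symmetric]
    proof (subst (2) M_def, rule gronwall_norm[OF dw])
      fix t :: real assume t: "t \<in> {0..1}"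
      let ?x = "y h t"
      have xU: "?x \<in> U" and xK: "?x \<in> ?K" and yK: "y (h + k) t \<in> ?K"
        using yU y(2) h hk t by auto
      have Dlin: "linear (\<lambda>g. ?D g t v)" for v
        by (rule linear_fderiv_family[OF open_U linear_F times_differentiable_on_has_derivative[OF smooth_F xU] xU])
      have Dlin2: "linear (?D g t)" for g
        using times_differentiable_on_has_derivative[OF smooth_F xU] has_derivative_linear by blast
      \<comment> \<open>Here commutation enters: differentiating the candidate along the curve gives
        the left side, while the variational equation asks for the right side.\<close>
      have comm: "?D k t (F h ?x) = ?D h t (F k ?x)"
        using field_bracket_F_eq_0[OF xU Z0[OF h t], of h k] by (simp add: field_bracket_def)
      let ?T = "F (h + k) (y (h + k) t) - F (h + k) ?x - ?D (h + k) t (?\<delta> t)"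
      have e1: "?D (h + k) t (?w t) = ?D (h + k) t (?\<delta> t) - t *\<^sub>R ?D (h + k) t (F k ?x)"
        by (simp only: linear_diff[OF Dlin2] linear_cmul[OF Dlin2])
      have e2: "?D (h + k) t (F k ?x) = ?D h t (F k ?x) + ?D k t (F k ?x)"
        by (rule linear_add[OF Dlin])
      \<comment> \<open>All terms of first order in \<open>k\<close> cancel: \<open>?T\<close> is
        the Taylor remainder, the last term contains \<open>k\<close> twice, and the middle one is
        linear in \<open>?w\<close> and is absorbed by Gronwall.\<close>
      have "?w' t = ?T + ?D (h + k) t (?w t) + t *\<^sub>R ?D k t (F k ?x)"
        unfolding e1 e2 comm F_add[OF xU] by (simp add: algebra_simps)
      then have "norm (?w' t) \<le> norm ?T + norm (?D (h + k) t (?w t)) + norm (t *\<^sub>R ?D k t (F k ?x))"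
        by (simp only:) (intro norm_triangle_mono order_refl)
      also have "\<dots> \<le> C * \<epsilon> * (C * norm k * M)\<^sup>2 + C * \<epsilon> * norm (?w t) + C * norm k * (C * norm k)"
      proof (intro add_mono)
        have "norm ?T \<le> C * norm (h + k) * (norm (?\<delta> t))\<^sup>2" by (rule C(5)[OF xK yK])
        also have "\<dots> \<le> C * \<epsilon> * (C * norm k * M)\<^sup>2"
          by (intro mult_mono power_mono C\<epsilon>[OF hk] \<delta>[OF t] C\<epsilon>0) auto
        finally show "norm ?T \<le> C * \<epsilon> * (C * norm k * M)\<^sup>2" .
        have "norm (?D (h + k) t (?w t)) \<le> C * norm (h + k) * norm (?w t)" by (rule C(4)[OF xK])
        also have "\<dots> \<le> C * \<epsilon> * norm (?w t)" by (intro mult_right_mono C\<epsilon>[OF hk]) auto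
        finally show "norm (?D (h + k) t (?w t)) \<le> C * \<epsilon> * norm (?w t)" .
        have "norm (t *\<^sub>R ?D k t (F k ?x)) \<le> 1 * norm (?D k t (F k ?x))"
          unfolding norm_scaleR using t by (intro mult_right_mono) auto
        also have "\<dots> \<le> C * norm k * norm (F k ?x)" using C(4)[OF xK] by simp
        also have "\<dots> \<le> C * norm k * (C * norm k)"
          using C(1) by (intro mult_left_mono C(2)[OF xK]) auto
        finally show "norm (t *\<^sub>R ?D k t (F k ?x)) \<le> C * norm k * (C * norm k)" .
      qed
      also have "\<dots> = C * \<epsilon> * norm (?w t) + (C * \<epsilon> * (C * M)\<^sup>2 + C * C) * (norm k)\<^sup>2"
        by (simp add: power2_eq_square algebra_simps)
      finally show "norm (?w' t) \<le> C * \<epsilon> * norm (?w t) + (C * \<epsilon> * (C * M)\<^sup>2 + C * C) * (norm k)\<^sup>2" .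
    qed (use C(1) C\<epsilon>0 y(1) h hk in auto)
    then show "norm (y (h + k) 1 - y h 1 - F k (y h 1)) \<le> (C * \<epsilon> * (C * M)\<^sup>2 + C * C) * M * (norm k)\<^sup>2"
      by (simp add: mult.commute mult.left_commute)
  qed
  \<comment> \<open>For \<open>h = 0\<close> the field vanishes, so Gronwall with both constants
    zero shows that the curve stands still.\<close>
  have "norm (y 0 1 - x0) \<le> 0 * exp (2 * 0 + 1)"
  proof (rule gronwall_norm)
    fix t :: real assume t: "t \<in> {0..1}"
    show "((\<lambda>t. y 0 t - x0) has_vector_derivative F 0 (y 0 t)) (at t within {0..1})"
      using y(3)[OF _ t, of 0] \<epsilon> by (auto intro!: derivative_eq_intros)
    show "norm (F 0 (y 0 t)) \<le> 0 * norm (y 0 t - x0) + 0"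
      using C(2)[OF y(2)[OF _ t], of 0 0] \<epsilon> by simp
  qed (use y(1)[of 0] \<epsilon> in auto)
  then have "y 0 1 = x0" by simp
  with \<epsilon>(1) yU der Z0 show ?thesis
    by (intro that[of \<epsilon> "\<lambda>h. y h 1"]) (auto simp: Z_def)
qed

text \<open>The derivative in direction \<open>k\<close> is the smooth field \<open>F k\<close>
  composed with \<open>G\<close>, hence as regular as \<open>G\<close>; each round gains one
  order.\<close>

lemma smooth_leaf_parametrization:
  assumes S: "open S" and G: "\<And>h. h \<in> S \<Longrightarrow> G h \<in> U"
    and D: "\<And>h. h \<in> S \<Longrightarrow> (G has_derivative (\<lambda>k. F k (G h))) (at h)"
  shows "times_differentiable_on n G S"
proof (induction n)
  case 0
  show ?case using has_derivative_continuous[OF D] by (auto intro!: continuous_at_imp_continuous_on)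
next
  case (Suc n)
  show ?case
    by (rule times_differentiable_onI[OF S D])
      (use G in \<open>auto intro!: times_differentiable_on_compose[OF S open_U _ smooth_F Suc]\<close>)
qed

end

section \<open>Construction of the normalising coefficients\<close>

text \<open>Coefficients are indexed by \<open>J\<close> rather than by the image, since different
  fields may take the same value at a point.\<close>

lemma span_image_combination:
  assumes "finite J" "v \<in> span (g ` J)"
  shows "\<exists>\<alpha>. v = (\<Sum>j\<in>J. \<alpha> j *\<^sub>R g j)"
proof -
  have "subspace {v. \<exists>\<alpha>. v = (\<Sum>j\<in>J. \<alpha> j *\<^sub>R g j)}"
  proof (intro subspaceI; clarify)
    show "\<exists>\<alpha>. 0 = (\<Sum>j\<in>J. \<alpha> j *\<^sub>R g j)" by (intro exI[of _ "\<lambda>j. 0"]) simp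
    show "\<exists>\<gamma>. (\<Sum>j\<in>J. \<alpha> j *\<^sub>R g j) + (\<Sum>j\<in>J. \<beta> j *\<^sub>R g j) = (\<Sum>j\<in>J. \<gamma> j *\<^sub>R g j)" for \<alpha> \<beta>
      by (intro exI[of _ "\<lambda>j. \<alpha> j + \<beta> j"]) (simp add: scaleR_add_left sum.distrib)
    show "\<exists>\<gamma>. r *\<^sub>R (\<Sum>j\<in>J. \<alpha> j *\<^sub>R g j) = (\<Sum>j\<in>J. \<gamma> j *\<^sub>R g j)" for r \<alpha>
      by (intro exI[of _ "\<lambda>j. r * \<alpha> j"]) (simp add: scaleR_sum_right)
  qed
  moreover have "g ` J \<subseteq> {v. \<exists>\<alpha>. v = (\<Sum>j\<in>J. \<alpha> j *\<^sub>R g j)}"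
  proof clarify
    fix i assume i: "i \<in> J"
    have "(\<Sum>j\<in>J. (if i = j then 1 else 0) *\<^sub>R g j) = (\<Sum>j\<in>J. if i = j then g j else 0)"
      by (intro sum.cong) auto
    also have "\<dots> = g i" using i assms(1) by simp
    finally show "\<exists>\<alpha>. g i = (\<Sum>j\<in>J. \<alpha> j *\<^sub>R g j)" by metis
  qed
  ultimately show ?thesis using span_minimal assms(2) by blast
qed

text \<open>Near \<open>x0\<close> the operator \<open>Q x = 1 - \<pi> + \<pi> (\<Sum>\<^sub>j a\<^sub>j X\<^sub>j(x))\<close> is a small perturbation of \<open>Q x0 = 1\<close>, where
  \<open>\<Sum>\<^sub>j a\<^sub>j(v) X\<^sub>j(x0) = \<pi> v\<close>; the normalising coefficients are \<open>f\<^sub>j = a\<^sub>j (Q x)\<^sup>-\<^sup>1 \<pi>\<close>.\<close>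

lemma adapted_family_exists:
  fixes X :: "'i \<Rightarrow> 'e::euclidean_space \<Rightarrow> 'e"
  assumes J: "finite J" and V: "open V" and x0: "x0 \<in> V"
    and X: "\<And>j k. j \<in> J \<Longrightarrow> times_differentiable_on k (X j) V"
    and br: "\<And>i j x. i \<in> J \<Longrightarrow> j \<in> J \<Longrightarrow> x \<in> V \<Longrightarrow>
          field_bracket (X i) (X j) x = (\<Sum>k\<in>J. c i j k *\<^sub>R X k x)"
    and \<pi>: "linear \<pi>" "\<And>v. \<pi> v \<in> span ((\<lambda>j. X j x0) ` J)"
      "\<And>v. v \<in> span ((\<lambda>j. X j x0) ` J) \<Longrightarrow> \<pi> v = v"
  obtains U f where "U \<subseteq> V" "adapted_family J X c U x0 \<pi> f"
proof -
  have \<pi>\<pi>: "\<pi> (\<pi> v) = \<pi> v" for v using \<pi>(2,3) by blast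
  have "\<exists>\<alpha>. \<pi> b = (\<Sum>j\<in>J. \<alpha> j *\<^sub>R X j x0)" for b
    by (rule span_image_combination[OF J \<pi>(2)])
  then obtain \<alpha> where \<alpha>: "\<And>b. \<pi> b = (\<Sum>j\<in>J. \<alpha> b j *\<^sub>R X j x0)" by metis
  \<comment> \<open>Choosing coefficients separately for every vector would not give linear
    functions, so they are chosen on the basis and extended linearly.\<close>
  define a where "a j v = (\<Sum>b\<in>Basis. (v \<bullet> b) * \<alpha> b j)" for j v
  have lin_a: "linear (a j)" for j
    unfolding a_def by (intro linearI)
      (simp_all add: inner_add_left distrib_right sum.distrib sum_distrib_left mult.assoc)
  have a_x0: "(\<Sum>j\<in>J. a j v *\<^sub>R X j x0) = \<pi> v" for v
  proof -
    have "(\<Sum>j\<in>J. a j v *\<^sub>R X j x0) = (\<Sum>j\<in>J. \<Sum>b\<in>Basis. (v \<bullet> b) *\<^sub>R \<alpha> b j *\<^sub>R X j x0)"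
      by (simp add: a_def scaleR_sum_left)
    also have "\<dots> = (\<Sum>b\<in>Basis. \<Sum>j\<in>J. (v \<bullet> b) *\<^sub>R \<alpha> b j *\<^sub>R X j x0)" by (rule sum.swap)
    also have "\<dots> = (\<Sum>b\<in>Basis. (v \<bullet> b) *\<^sub>R \<pi> b)"
      by (intro sum.cong refl) (simp add: \<alpha> scaleR_sum_right)
    also have "\<dots> = \<pi> v" by (rule linear_euclidean_sum[OF \<pi>(1), symmetric])
    finally show ?thesis .
  qed
  define P where "P v x = (\<Sum>j\<in>J. a j v *\<^sub>R X j x)" for v x
  define Q where "Q v x = v - \<pi> v + \<pi> (P v x)" for v x
  have lin_P: "linear (\<lambda>v. P v x)" for x
    unfolding P_def by (intro linearI)
      (simp_all add: linear_add[OF lin_a] linear_cmul[OF lin_a] scaleR_add_left sum.distrib scaleR_sum_right)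
  have lin_Q: "linear (\<lambda>v. Q v x)" for x
    unfolding Q_def by (intro linearI)
      (simp_all add: linear_add[OF lin_P] linear_cmul[OF lin_P] linear_add[OF \<pi>(1)] linear_cmul[OF \<pi>(1)]
        algebra_simps)
  have bl_a: "bounded_linear (a j)" for j using lin_a linear_conv_bounded_linear by blast
  have bl_\<pi>: "bounded_linear \<pi>" using \<pi>(1) linear_conv_bounded_linear by blast
  have smooth_Q: "times_differentiable_on k (Q v) V" for k v
  proof -
    have "times_differentiable_on k (P v) V"
      unfolding P_def
      by (intro times_differentiable_on_sum[OF V] times_differentiable_on_scaleR[OF V]
          times_differentiable_on_const X)
    from times_differentiable_on_linear_comp[OF bl_\<pi> V this]
    have "times_differentiable_on k (\<lambda>x. (v - \<pi> v) + \<pi> (P v x)) V"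
      by (intro times_differentiable_on_add[OF V] times_differentiable_on_const)
    then show ?thesis by (simp add: Q_def[abs_def])
  qed
  have Q_x0: "Q v x0 = v" for v by (simp add: Q_def P_def a_x0 \<pi>\<pi>)
  obtain r where r: "r > 0" "cball x0 r \<subseteq> V"
    using V x0 open_contains_cball by blast
  obtain C where C: "C \<ge> 0"
    "\<And>v x y. x \<in> cball x0 r \<Longrightarrow> y \<in> cball x0 r \<Longrightarrow> norm (Q v y - Q v x) \<le> C * norm v * norm (y - x)"
  proof (rule linear_family_bounds[OF V lin_Q smooth_Q compact_cball convex_cball r(2)])
    fix C
    assume "0 \<le> C" "\<And>v x y. x \<in> cball x0 r \<Longrightarrow> y \<in> cball x0 r \<Longrightarrow>
      norm (Q v y - Q v x) \<le> C * norm v * norm (y - x)"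
    then show thesis by (rule that)
  qed
  \<comment> \<open>On the ball of radius \<open>s\<close> the operator differs from the identity by
    at most \<open>1 / 2\<close> in norm. This gives injectivity and the bound \<open>2\<close> for
    the inverse.\<close>
  define s where "s = min r (1 / (2 * (C + 1)))"
  have s: "s > 0" "s \<le> r" "C * s \<le> 1 / 2"
  proof -
    show "s > 0" "s \<le> r" using r C(1) by (auto simp: s_def)
    have "C * s \<le> C * (1 / (2 * (C + 1)))"
      unfolding s_def using C(1) by (intro mult_left_mono) auto
    also have "\<dots> \<le> 1 / 2" using C(1) by (simp add: field_simps)
    finally show "C * s \<le> 1 / 2" .
  qed
  let ?U = "ball x0 s"
  have UV: "?U \<subseteq> V" using s(2) r(2) by auto
  have low: "norm v \<le> 2 * norm (Q v x)" if x: "x \<in> ?U" for x v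
  proof -
    have "norm (Q v x - Q v x0) \<le> C * norm v * norm (x - x0)"
      using x s(2) r(1) by (intro C(2)) auto
    also have "\<dots> \<le> C * norm v * s"
      using x C(1) by (intro mult_left_mono) (auto simp: dist_norm norm_minus_commute)
    also have "\<dots> = (C * s) * norm v" by simp
    also have "\<dots> \<le> 1 / 2 * norm v" using s(3) by (intro mult_right_mono) auto
    finally have "norm (Q v x - v) \<le> 1 / 2 * norm v" by (simp only: Q_x0)
    moreover have "norm v \<le> norm (Q v x) + norm (Q v x - v)"
      using norm_triangle_ineq4[of "Q v x" "Q v x - v"] by simp
    ultimately show ?thesis by linarith
  qed
  have inj: "inj (\<lambda>v. Q v x)" if x: "x \<in> ?U" for x
    unfolding linear_injective_0[OF lin_Q]
  proof (intro allI impI)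
    fix v assume "Q v x = 0"
    then show "v = 0" using low[OF x, of v] by simp
  qed
  define R where "R x = inv (\<lambda>v. Q v x)" for x
  have RQ: "R x (Q v x) = v" if x: "x \<in> ?U" for x v
    unfolding R_def using inv_f_f[OF inj[OF x]] .
  have QR: "Q (R x v) x = v" if x: "x \<in> ?U" for x v
    unfolding R_def
    using surj_f_inv_f[OF linear_inj_imp_surj[OF lin_Q inj[OF x]]] .
  have lin_R: "linear (R x)" if x: "x \<in> ?U" for x
    by (rule linearI) (metis RQ[OF x] QR[OF x] linear_add[OF lin_Q[of x]],
        metis RQ[OF x] QR[OF x] linear_cmul[OF lin_Q[of x]])
  have smooth_R: "times_differentiable_on k (\<lambda>x. R x v) ?U" for k v
  proof (rule times_differentiable_on_inverse_operator[where Q = "\<lambda>x v. Q v x" and R = R and C = 2])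
    show "norm (R x v) \<le> 2 * norm v" if "x \<in> ?U" for x v
      using low[OF that, of "R x v"] by (simp add: QR[OF that])
    show "times_differentiable_on k (Q v) ?U" for k v
      by (rule times_differentiable_on_subset[OF smooth_Q UV])
  qed (use lin_Q lin_R QR RQ in auto)
  have "adapted_family J X c ?U x0 \<pi> (\<lambda>j h x. a j (R x (\<pi> h)))"
  proof (rule adapted_family.intro)
    show "x0 \<in> ?U" using s by simp
    show "times_differentiable_on k (X j) ?U" if "j \<in> J" for j k
      by (rule times_differentiable_on_subset[OF X[OF that] UV])
    show "field_bracket (X i) (X j) x = (\<Sum>k\<in>J. c i j k *\<^sub>R X k x)" if "i \<in> J" "j \<in> J" "x \<in> ?U" for i j x
      using br that UV by blast
    show "linear (\<lambda>h. a j (R x (\<pi> h)))" if "x \<in> ?U" for j x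
      using linear_compose[OF linear_compose[OF \<pi>(1) lin_R[OF that]] lin_a] by (simp add: o_def)
    show "times_differentiable_on k (\<lambda>x. a j (R x (\<pi> h))) ?U" for j h k
      by (rule times_differentiable_on_linear_comp[OF bl_a open_ball smooth_R])
    show "\<pi> (\<Sum>j\<in>J. a j (R x (\<pi> h)) *\<^sub>R X j x) = \<pi> h" if x: "x \<in> ?U" for h x
    proof -
      \<comment> \<open>\<pi> annihilates the part \<open>v - \<pi> v\<close> of \<open>Q\<close>,
        so the solution \<open>v\<close> of \<open>Q v x = \<pi> h\<close> provides a combination
        \<open>P v x\<close> with projection \<open>\<pi> h\<close>.\<close>
      have "\<pi> (Q v x) = \<pi> (P v x)" for v
        by (simp add: Q_def linear_add[OF \<pi>(1)] linear_diff[OF \<pi>(1)] \<pi>\<pi>)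
      from this[of "R x (\<pi> h)"] show ?thesis by (simp add: QR[OF x] P_def \<pi>\<pi>)
    qed
    show "(\<Sum>i\<in>J. a i (R x0 (\<pi> (X j x0))) *\<^sub>R X i x0) = X j x0" if j: "j \<in> J" for j
    proof -
      have "X j x0 \<in> span ((\<lambda>j. X j x0) ` J)" using j by (intro span_base) auto
      then have "\<pi> (X j x0) = X j x0" by (rule \<pi>(3))
      moreover have "R x0 v = v" for v using RQ[of x0 v] s Q_x0 by simp
      ultimately show ?thesis by (simp add: a_x0)
    qed
  qed (use J \<pi> \<pi>\<pi> in auto)
  with UV show ?thesis using that by blast
qed

section \<open>Leaves of involutive families\<close>

text \<open>The difference of the two sides has zero derivative on a ball. With a projection for
  both maps this identifies the parameter of a leaf point; with a complementary projection and
  \<open>l' = 0\<close> it confines the leaf to an affine subspace.\<close>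

lemma linear_image_of_curve:
  fixes G :: "'e::euclidean_space \<Rightarrow> 'f::euclidean_space"
    and l :: "'f \<Rightarrow> 'g::real_normed_vector"
  assumes D: "\<And>h. norm h < \<epsilon> \<Longrightarrow> (G has_derivative G' h) (at h)"
    and l: "linear l" and l': "linear l'" and eq: "\<And>h k. norm h < \<epsilon> \<Longrightarrow> l (G' h k) = l' k"
    and h: "norm h < \<epsilon>"
  shows "l (G h - G 0) = l' h"
proof -
  have bl: "bounded_linear l" "bounded_linear l'" using l l' linear_conv_bounded_linear by blast+
  have "((\<lambda>h. l (G h) - l' h) has_derivative (\<lambda>k. 0)) (at h within ball 0 \<epsilon>)" if "h \<in> ball 0 \<epsilon>" for h
  proof -
    have "norm h < \<epsilon>" using that by simp
    have "((\<lambda>h. l (G h) - l' h) has_derivative (\<lambda>k. l (G' h k) - l' k)) (at h)"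
      by (intro has_derivative_diff bounded_linear.has_derivative[OF bl(1) D]
          bounded_linear_imp_has_derivative bl \<open>norm h < \<epsilon>\<close>)
    then show ?thesis using eq[OF \<open>norm h < \<epsilon>\<close>] has_derivative_at_withinI by fastforce
  qed
  from has_derivative_zero_constant[OF convex_ball this]
  obtain d where "\<And>h. h \<in> ball 0 \<epsilon> \<Longrightarrow> l (G h) - l' h = d" by blast
  from this[of h] this[of 0] h have "l (G h) - l' h = l (G 0) - l' 0" by (simp add: order_le_less_trans[OF norm_ge_zero])
  then show ?thesis by (simp add: linear_diff[OF l] linear_0[OF l'] algebra_simps)
qed

lemma subspace_projection_exists:
  fixes E :: "'e::real_vector set"
  assumes "subspace E"
  obtains p :: "'e \<Rightarrow> 'e" where "linear p" "\<And>v. p v \<in> E" "\<And>v. v \<in> E \<Longrightarrow> p v = v"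
  using linear_exists_left_inverse_on[OF linear_id assms] by auto

text \<open>The locale is discharged here, leaving only what the geometry uses. \<open>W\<close>
  stands for the model space of a chart: fields with values in \<open>W\<close> have leaves that do
  not leave \<open>x0 + W\<close>.\<close>

lemma involutive_leaf:
  fixes X :: "'i \<Rightarrow> 'e::euclidean_space \<Rightarrow> 'e"
  assumes J: "finite J" and V: "open V" and x0: "x0 \<in> V"
    and X: "\<And>j k. j \<in> J \<Longrightarrow> times_differentiable_on k (X j) V"
    and br: "\<And>i j x. i \<in> J \<Longrightarrow> j \<in> J \<Longrightarrow> x \<in> V \<Longrightarrow>
          field_bracket (X i) (X j) x = (\<Sum>k\<in>J. c i j k *\<^sub>R X k x)"
    and \<pi>: "linear \<pi>" "\<And>v. \<pi> v \<in> span ((\<lambda>j. X j x0) ` J)"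
      "\<And>v. v \<in> span ((\<lambda>j. X j x0) ` J) \<Longrightarrow> \<pi> v = v"
    and W: "subspace W" "\<And>j x. j \<in> J \<Longrightarrow> x \<in> V \<Longrightarrow> X j x \<in> W"
  obtains \<epsilon> G where "\<epsilon> > 0" "G 0 = x0" "\<And>h. norm h < \<epsilon> \<Longrightarrow> G h \<in> V"
    "\<And>h. norm h < \<epsilon> \<Longrightarrow> G h - x0 \<in> W"
    "\<And>h. norm h < \<epsilon> \<Longrightarrow> \<pi> (G h - x0) = \<pi> h"
    "\<And>n. times_differentiable_on n G (ball 0 \<epsilon>)"
    "\<And>h k. norm h < \<epsilon> \<Longrightarrow> fderiv G h k \<in> span ((\<lambda>j. X j (G h)) ` J)"
    "\<And>h k. norm h < \<epsilon> \<Longrightarrow> \<pi> (fderiv G h k) = \<pi> k"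
    "\<And>h k. norm h < \<epsilon> \<Longrightarrow> fderiv G h (\<pi> k) = fderiv G h k"
    "\<And>h j. norm h < \<epsilon> \<Longrightarrow> j \<in> J \<Longrightarrow> fderiv G h (X j (G h)) = X j (G h)"
proof -
  obtain U f where UV: "U \<subseteq> V" and af: "adapted_family J X c U x0 \<pi> f"
    using adapted_family_exists[OF J V x0 X br \<pi>] by blast
  interpret adapted_family J X c U x0 \<pi> f by (rule af)
  obtain \<epsilon> G where \<epsilon>: "\<epsilon> > 0" and G0: "G 0 = x0" and GU: "\<And>h. norm h < \<epsilon> \<Longrightarrow> G h \<in> U"
    and D: "\<And>h. norm h < \<epsilon> \<Longrightarrow> (G has_derivative (\<lambda>k. F k (G h))) (at h)"
    and FX: "\<And>h j. norm h < \<epsilon> \<Longrightarrow> j \<in> J \<Longrightarrow> F (X j (G h)) (G h) = X j (G h)"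
    using leaf_parametrization by blast
  have fd: "fderiv G h k = F k (G h)" if "norm h < \<epsilon>" for h k
    using fun_cong[OF frechet_derivative_at[OF D[OF that]], of k] by simp
  obtain p where p: "linear p" "\<And>v. p v \<in> W" "\<And>v. v \<in> W \<Longrightarrow> p v = v"
    using subspace_projection_exists[OF W(1)] by blast
  have FW: "F k x \<in> W" if "x \<in> U" for k x
    unfolding F_def using W(2) that UV by (intro subspace_sum[OF W(1)] subspace_scale[OF W(1)]) auto
  show ?thesis
  proof (rule that[of \<epsilon> G, OF \<epsilon> G0])
    fix h :: 'e assume h: "norm h < \<epsilon>"
    show "G h \<in> V" using GU[OF h] UV by blast
    have "(\<lambda>v. v - p v) (G h - G 0) = (\<lambda>v. 0) h"
      by (rule linear_image_of_curve[OF D])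
        (use h p FW GU in \<open>auto intro: linear_compose_sub linear_ident linear_zero\<close>)
    then have "G h - x0 = p (G h - x0)" using G0 by simp
    then show "G h - x0 \<in> W" using p(2) by metis
    have "\<pi> (G h - G 0) = \<pi> h"
      by (rule linear_image_of_curve[OF D \<pi>(1) \<pi>(1)]) (use h \<pi>_F GU in auto)
    then show "\<pi> (G h - x0) = \<pi> h" using G0 by simp
    fix k
    show "fderiv G h k \<in> span ((\<lambda>j. X j (G h)) ` J)"
      unfolding fd[OF h] F_def by (intro span_sum span_scale span_base) auto
    show "\<pi> (fderiv G h k) = \<pi> k" unfolding fd[OF h] by (rule \<pi>_F[OF GU[OF h]])
    show "fderiv G h (\<pi> k) = fderiv G h k" unfolding fd[OF h] by (rule F_\<pi>[OF GU[OF h]])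
  next
    show "times_differentiable_on n G (ball 0 \<epsilon>)" for n
      by (rule smooth_leaf_parametrization) (use GU D in auto)
    show "fderiv G h (X j (G h)) = X j (G h)" if "norm h < \<epsilon>" "j \<in> J" for h j
      unfolding fd[OF that(1)] by (rule FX[OF that])
  qed
qed

section \<open>Charts and tangent spaces\<close>

lemma
  assumes "topological_chart M c"
  shows topological_chart_inj: "inj_on (chart_map c) (chart_dom c)"
    and topological_chart_dom: "chart_dom c \<subseteq> carrier M"
    and topological_chart_open_image:
      "openin (mtop M) W \<Longrightarrow> openin (top_of_set (model M)) (chart_map c ` (chart_dom c \<inter> W))"
    and topological_chart_continuous:
      "continuous_map (subtopology (mtop M) (chart_dom c)) euclidean (chart_map c)"
    and topological_chart_inv_continuous:
      "continuous_map (top_of_set (chart_map c ` chart_dom c)) (mtop M) (chart_inv c)"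
proof -
  have op: "openin (mtop M) (chart_dom c)" and oi: "openin (top_of_set (model M)) (chart_map c ` chart_dom c)"
    and hom: "homeomorphic_map (subtopology (mtop M) (chart_dom c))
       (top_of_set (chart_map c ` chart_dom c)) (chart_map c)"
    using assms by (auto simp: topological_chart_def)
  show dom: "chart_dom c \<subseteq> carrier M" using op openin_subset by blast
  then have ts: "topspace (subtopology (mtop M) (chart_dom c)) = chart_dom c"
    by (auto simp: topspace_subtopology)
  show inj: "inj_on (chart_map c) (chart_dom c)"
    using homeomorphic_imp_injective_map[OF hom] ts by simp
  show "openin (top_of_set (model M)) (chart_map c ` (chart_dom c \<inter> W))" if "openin (mtop M) W"
  proof -
    have "openin (subtopology (mtop M) (chart_dom c)) (chart_dom c \<inter> W)"
      using that by (metis Int_commute openin_subtopology_Int)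
    then have "openin (top_of_set (chart_map c ` chart_dom c)) (chart_map c ` (chart_dom c \<inter> W))"
      using homeomorphic_imp_open_map[OF hom] by (simp add: open_map_def)
    then show ?thesis using oi openin_trans by blast
  qed
  have "continuous_map (subtopology (mtop M) (chart_dom c)) (top_of_set (chart_map c ` chart_dom c)) (chart_map c)"
    by (rule homeomorphic_imp_continuous_map[OF hom])
  then show "continuous_map (subtopology (mtop M) (chart_dom c)) euclidean (chart_map c)"
    by (rule continuous_map_into_fulltopology)
  obtain g where g: "homeomorphic_maps (subtopology (mtop M) (chart_dom c))
       (top_of_set (chart_map c ` chart_dom c)) (chart_map c) g"
    using hom homeomorphic_map_maps by blast
  have eq: "g x = chart_inv c x" if "x \<in> chart_map c ` chart_dom c" for x
    using g that inj ts unfolding homeomorphic_maps_def chart_inv_def by (auto simp: inv_into_f_f)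
  have "continuous_map (top_of_set (chart_map c ` chart_dom c)) (subtopology (mtop M) (chart_dom c)) g"
    using g by (simp add: homeomorphic_maps_def)
  then have "continuous_map (top_of_set (chart_map c ` chart_dom c)) (subtopology (mtop M) (chart_dom c)) (chart_inv c)"
    by (rule continuous_map_eq) (simp add: eq)
  then show "continuous_map (top_of_set (chart_map c ` chart_dom c)) (mtop M) (chart_inv c)"
    by (rule continuous_map_into_fulltopology)
qed

lemma chart_inv_chart_map:
  "inj_on (chart_map c) (chart_dom c) \<Longrightarrow> m \<in> chart_dom c \<Longrightarrow> chart_inv c (chart_map c m) = m"
  by (simp add: chart_inv_def)

lemma smooth_onE:
  assumes "smooth_on A f" "x \<in> A"
  obtains W g where "open W" "x \<in> W" "\<And>k. times_differentiable_on k g W" "\<And>y. y \<in> A \<Longrightarrow> y \<in> W \<Longrightarrow> g y = f y"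
proof -
  from bspec[OF assms(1)[unfolded smooth_on_def] assms(2)]
  obtain W g where W: "open W" "x \<in> W" "\<forall>k. times_differentiable_on k g W" "\<forall>y\<in>A \<inter> W. g y = f y"
    by (elim exE conjE)
  show ?thesis by (rule that[of W g]) (use W in simp_all)
qed

text \<open>The line through \<open>x\<close> in direction \<open>h\<close> stays in
  \<open>V\<close>, so every differentiable extension of \<open>f\<close> from \<open>V\<close>
  computes the same derivative along it.\<close>

lemma deriv_along_eq:
  assumes V: "subspace V" "x \<in> V" "h \<in> V" and W: "open W" "x \<in> W"
    and g: "(g has_derivative g') (at x)" and eq: "\<And>y. y \<in> V \<Longrightarrow> y \<in> W \<Longrightarrow> g y = f y"
  shows "deriv_along f x h = g' h"
proof -
  have "((\<lambda>t::real. x + t *\<^sub>R h) has_derivative (\<lambda>t. t *\<^sub>R h)) (at 0)"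
    by (auto intro!: derivative_eq_intros)
  from has_derivative_compose[OF this, of g g'] g
  have D: "((\<lambda>t. g (x + t *\<^sub>R h)) has_vector_derivative g' h) (at 0)"
    using linear_cmul[OF has_derivative_linear[OF g]] by (simp add: has_vector_derivative_def)
  have W': "open ((\<lambda>t::real. x + t *\<^sub>R h) -` W)"
    by (intro open_vimage W continuous_intros)
  have "g (x + t *\<^sub>R h) = f (x + t *\<^sub>R h)" if "t \<in> (\<lambda>t. x + t *\<^sub>R h) -` W" for t
    using that V by (intro eq) (simp_all add: subspace_add subspace_scale)
  then have "((\<lambda>t. f (x + t *\<^sub>R h)) has_vector_derivative g' h) (at 0)"
    using W(2) by (intro has_vector_derivative_transform_within_open[OF D W']) auto
  then show ?thesis unfolding deriv_along_def by (rule vector_derivative_at)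
qed

text \<open>\<open>W\<close> is cut down by an open set whose trace on \<open>V\<close> is
  \<open>A\<close>, so that the extension is valid on all of \<open>V\<close> inside
  \<open>W\<close>.\<close>

lemma smooth_onE_open:
  assumes "smooth_on A f" "x \<in> A" "openin (top_of_set V) A"
  obtains W g where "open W" "x \<in> W" "\<And>k. times_differentiable_on k g W"
    "\<And>y. y \<in> V \<Longrightarrow> y \<in> W \<Longrightarrow> y \<in> A \<and> g y = f y"
proof -
  obtain W g where W: "open W" "x \<in> W" "\<And>k. times_differentiable_on k g W"
    "\<And>y. y \<in> A \<Longrightarrow> y \<in> W \<Longrightarrow> g y = f y"
    by (rule smooth_onE[OF assms(1,2)]) (rule that)
  obtain T where T: "open T" "A = V \<inter> T"
    using assms(3) by (auto simp: openin_open)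
  show ?thesis
  proof (rule that[of "W \<inter> T" g])
    show "times_differentiable_on k g (W \<inter> T)" for k
      using W(3) by (rule times_differentiable_on_subset) simp
  qed (use W T assms(2) in auto)
qed

lemma smooth_manifoldD:
  assumes "smooth_manifold M"
  shows "subspace (model M)" "Hausdorff_space (mtop M)" "c \<in> atlas M \<Longrightarrow> topological_chart M c"
    "m \<in> carrier M \<Longrightarrow> charts_at M m \<noteq> {}"
    "c \<in> atlas M \<Longrightarrow> d \<in> atlas M \<Longrightarrow>
      smooth_on (chart_map c ` (chart_dom c \<inter> chart_dom d)) (chart_map d \<circ> chart_inv c)"
proof -
  show "charts_at M m \<noteq> {}" if "m \<in> carrier M"
  proof -
    have "m \<in> (\<Union>c\<in>atlas M. chart_dom c)" using assms that by (simp add: smooth_manifold_def)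
    then show ?thesis by (auto simp: charts_at_def)
  qed
qed (use assms in \<open>simp_all add: smooth_manifold_def\<close>)

lemma transition_extension:
  assumes M: "smooth_manifold M" and c: "c \<in> charts_at M m" and d: "d \<in> charts_at M m"
  obtains W g where "open W" "chart_map c m \<in> W" "\<And>k. times_differentiable_on k g W"
    "\<And>y. y \<in> model M \<Longrightarrow> y \<in> W \<Longrightarrow> y \<in> chart_map c ` (chart_dom c \<inter> chart_dom d) \<and>
       g y = (chart_map d \<circ> chart_inv c) y"
proof (rule smooth_onE_open)
  show "smooth_on (chart_map c ` (chart_dom c \<inter> chart_dom d)) (chart_map d \<circ> chart_inv c)"
    using smooth_manifoldD(5)[OF M] c d by (simp add: charts_at_def)
  show "chart_map c m \<in> chart_map c ` (chart_dom c \<inter> chart_dom d)"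
    using c d by (auto simp: charts_at_def)
  show "openin (top_of_set (model M)) (chart_map c ` (chart_dom c \<inter> chart_dom d))"
    using smooth_manifoldD(3)[OF M] c d
    by (intro topological_chart_open_image) (auto simp: charts_at_def topological_chart_def)
qed (rule that)

lemma chart_map_in_model:
  assumes "smooth_manifold M" "c \<in> charts_at M m"
  shows "chart_map c m \<in> model M"
  using assms openin_subset[of "top_of_set (model M)" "chart_map c ` chart_dom c"]
  by (auto simp: charts_at_def smooth_manifold_def topological_chart_def)

lemma deriv_along_transition_linear:
  assumes M: "smooth_manifold M" and c: "c \<in> charts_at M m" and d: "d \<in> charts_at M m"
  shows "\<exists>l. linear l \<and> (\<forall>v\<in>model M. deriv_along (chart_map d \<circ> chart_inv c) (chart_map c m) v = l v)"
proof -
  obtain W g where W: "open W" "chart_map c m \<in> W" "\<And>k. times_differentiable_on k g W"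
    "\<And>y. y \<in> model M \<Longrightarrow> y \<in> W \<Longrightarrow> y \<in> chart_map c ` (chart_dom c \<inter> chart_dom d) \<and>
       g y = (chart_map d \<circ> chart_inv c) y"
    by (rule transition_extension[OF M c d]) (rule that)
  have D: "(g has_derivative fderiv g (chart_map c m)) (at (chart_map c m))"
    by (rule times_differentiable_on_has_derivative[OF W(3,2)])
  show ?thesis
  proof (intro exI conjI ballI)
    show "linear (fderiv g (chart_map c m))" by (rule has_derivative_linear[OF D])
    show "deriv_along (chart_map d \<circ> chart_inv c) (chart_map c m) v = fderiv g (chart_map c m) v"
      if "v \<in> model M" for v
      using W(4) by (intro deriv_along_eq[OF smooth_manifoldD(1)[OF M] chart_map_in_model[OF M c] that W(1,2) D]) auto
  qed
qed

lemma subspace_tangent_space: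
  fixes M :: "('a, 'e::euclidean_space) manifold"
  assumes M: "smooth_manifold M"
  shows "subspace (tangent_space M m)"
proof -
  let ?T = "\<lambda>(c :: ('a, 'e) chart) (d :: ('a, 'e) chart) v. deriv_along (chart_map d \<circ> chart_inv c) (chart_map c m) v"
  note V = smooth_manifoldD(1)[OF M]
  \<comment> \<open>\<open>deriv_along\<close> is a derivative along one line at a time and not
    visibly additive in the direction; on the model space it is replaced by a linear map.\<close>
  define l where "l c d = (SOME l. linear l \<and> (\<forall>v\<in>model M. ?T c d v = l v))" for c d
  have "linear (l c d) \<and> (\<forall>v\<in>model M. ?T c d v = l c d v)"
    if "c \<in> charts_at M m" "d \<in> charts_at M m" for c d
    unfolding l_def by (rule someI_ex[OF deriv_along_transition_linear[OF M that]])
  then have lin: "\<And>c d. c \<in> charts_at M m \<Longrightarrow> d \<in> charts_at M m \<Longrightarrow> linear (l c d)"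
    and l: "\<And>c d v. c \<in> charts_at M m \<Longrightarrow> d \<in> charts_at M m \<Longrightarrow> v \<in> model M \<Longrightarrow> ?T c d v = l c d v"
    by blast+
  let ?S = "{\<xi>. (\<forall>c. c \<notin> charts_at M m \<longrightarrow> \<xi> c = 0) \<and> (\<forall>c\<in>charts_at M m. \<xi> c \<in> model M) \<and>
      (\<forall>c\<in>charts_at M m. \<forall>d\<in>charts_at M m. \<xi> d = l c d (\<xi> c))}"
  have "tangent_space M m = ?S"
    unfolding tangent_space_def by (intro Collect_cong conj_cong ball_cong refl) (simp add: l)
  moreover have "subspace \<dots>"
  proof (rule subspaceI)
    show "0 \<in> ?S"
      by (simp add: linear_0[OF lin] subspace_0[OF V])
  next
    fix \<xi> \<zeta> and r :: real
    assume \<xi>: "\<xi> \<in> ?S"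
    then have \<xi>': "\<And>c. c \<notin> charts_at M m \<Longrightarrow> \<xi> c = 0" "\<And>c. c \<in> charts_at M m \<Longrightarrow> \<xi> c \<in> model M"
      by blast+
    have scale: "(r *\<^sub>R \<xi>) d = l c d ((r *\<^sub>R \<xi>) c)" if "c \<in> charts_at M m" "d \<in> charts_at M m" for c d
    proof -
      have "\<xi> d = l c d (\<xi> c)" using \<xi> that by blast
      then show ?thesis by (simp only: scaleR_fun_def linear_cmul[OF lin[OF that]])
    qed
    show "r *\<^sub>R \<xi> \<in> ?S"
      by (intro CollectI conjI allI impI ballI scale)
        (simp_all add: scaleR_fun_def \<xi>' subspace_scale[OF V])
    assume \<zeta>: "\<zeta> \<in> ?S"
    then have \<zeta>': "\<And>c. c \<notin> charts_at M m \<Longrightarrow> \<zeta> c = 0" "\<And>c. c \<in> charts_at M m \<Longrightarrow> \<zeta> c \<in> model M"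
      by blast+
    have add: "(\<xi> + \<zeta>) d = l c d ((\<xi> + \<zeta>) c)" if "c \<in> charts_at M m" "d \<in> charts_at M m" for c d
    proof -
      have "\<xi> d = l c d (\<xi> c)" "\<zeta> d = l c d (\<zeta> c)" using \<xi> \<zeta> that by blast+
      then show ?thesis by (simp only: plus_fun_apply linear_add[OF lin[OF that]])
    qed
    show "\<xi> + \<zeta> \<in> ?S"
      by (intro CollectI conjI allI impI ballI add) (simp_all add: \<xi>' \<zeta>' subspace_add[OF V])
  qed
  ultimately show ?thesis by simp
qed

section \<open>Paracompactness and vector fields in a chart\<close>

text \<open>A subspace of a paracompact space may fail to be paracompact, so a leaf does not inherit
  the property from \<open>M\<close>. It obtains it from its global chart, because subsets of
  Euclidean space are paracompact.\<close>

lemma paracompact_space_homeomorphic_euclidean: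
  fixes f :: "'a \<Rightarrow> 'e::euclidean_space"
  assumes "homeomorphic_map X (top_of_set N) f"
  shows "paracompact_space X"
  unfolding paracompact_space_def
proof (intro allI impI)
  fix \<U> assume \<U>: "(\<forall>U\<in>\<U>. openin X U) \<and> \<Union>\<U> = topspace X"
  have inj: "inj_on f (topspace X)" by (rule homeomorphic_imp_injective_map[OF assms])
  have cont: "continuous_map X euclidean f"
    using homeomorphic_imp_continuous_map[OF assms] by (rule continuous_map_into_fulltopology)
  have img: "f ` topspace X = N"
    using homeomorphic_imp_surjective_map[OF assms] by simp
  have op: "openin X {x \<in> topspace X. f x \<in> T}" if "open T" for T
    using openin_continuous_map_preimage[OF cont, of T] that by simp
  let ?C = "{T. open T \<and> (\<exists>U\<in>\<U>. f ` U = N \<inter> T)}"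
  have "N \<subseteq> \<Union>?C"
  proof
    fix y assume "y \<in> N"
    then obtain x where x: "x \<in> topspace X" "y = f x" using img by blast
    then obtain U where U: "U \<in> \<U>" "x \<in> U" using \<U> by blast
    then have "openin (top_of_set N) (f ` U)"
      using homeomorphic_imp_open_map[OF assms] \<U> by (simp add: open_map_def)
    then obtain T where "open T" "f ` U = N \<inter> T" by (auto simp: openin_open)
    then show "y \<in> \<Union>?C" using U x by blast
  qed
  then obtain \<C> where \<C>: "N \<subseteq> \<Union>\<C>" "\<And>T. T \<in> \<C> \<Longrightarrow> open T \<and> (\<exists>T'. T' \<in> ?C \<and> T \<subseteq> T')"
    "\<And>y. y \<in> N \<Longrightarrow> \<exists>V. open V \<and> y \<in> V \<and> finite {T. T \<in> \<C> \<and> T \<inter> V \<noteq> {}}"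
  proof (rule paracompact)
    fix \<C>
    assume "N \<subseteq> \<Union>\<C>" "\<And>T. T \<in> \<C> \<Longrightarrow> open T \<and> (\<exists>T'. T' \<in> ?C \<and> T \<subseteq> T')"
      "\<And>y. y \<in> N \<Longrightarrow> \<exists>V. open V \<and> y \<in> V \<and> finite {T. T \<in> \<C> \<and> T \<inter> V \<noteq> {}}"
    then show thesis by (rule that)
  qed auto
  let ?p = "\<lambda>T. {x \<in> topspace X. f x \<in> T}"
  show "\<exists>\<V>. (\<forall>V\<in>\<V>. openin X V) \<and> \<Union>\<V> = topspace X \<and> (\<forall>V\<in>\<V>. \<exists>U\<in>\<U>. V \<subseteq> U) \<and> locally_finite_in X \<V>"
  proof (intro exI[of _ "?p ` \<C>"] conjI)
    show "\<forall>V\<in>?p ` \<C>. openin X V" using \<C>(2) op by blast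
    show un: "\<Union>(?p ` \<C>) = topspace X" using \<C>(1) img by auto
    show "\<forall>V\<in>?p ` \<C>. \<exists>U\<in>\<U>. V \<subseteq> U"
    proof clarify
      fix T assume "T \<in> \<C>"
      then obtain T' U where T': "T \<subseteq> T'" "U \<in> \<U>" "f ` U = N \<inter> T'" using \<C>(2) by blast
      have "x \<in> U" if "x \<in> topspace X" "f x \<in> T" for x
      proof -
        have "f x \<in> f ` U" using that T' img by blast
        moreover have "U \<subseteq> topspace X" using \<U> T'(2) by blast
        ultimately show ?thesis using inj that(1) by (auto simp: inj_on_def)
      qed
      then show "\<exists>U\<in>\<U>. ?p T \<subseteq> U" using T'(2) by blast
    qed
    show "locally_finite_in X (?p ` \<C>)"
      unfolding locally_finite_in_def
    proof (intro conjI ballI)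
      show "\<Union>(?p ` \<C>) \<subseteq> topspace X" using un by simp
      fix x assume x: "x \<in> topspace X"
      then obtain V where V: "open V" "f x \<in> V" "finite {T. T \<in> \<C> \<and> T \<inter> V \<noteq> {}}"
        using \<C>(3)[of "f x"] img by blast
      have "{W \<in> ?p ` \<C>. W \<inter> ?p V \<noteq> {}} \<subseteq> ?p ` {T. T \<in> \<C> \<and> T \<inter> V \<noteq> {}}" by blast
      then have "finite {W \<in> ?p ` \<C>. W \<inter> ?p V \<noteq> {}}" using V(3) finite_subset by blast
      then show "\<exists>V. openin X V \<and> x \<in> V \<and> finite {U \<in> ?p ` \<C>. U \<inter> V \<noteq> {}}"
        using op[OF V(1)] V(2) x by (intro exI[of _ "?p V"]) auto
    qed
  qed
qed

lemma sum_fun_apply: "(\<Sum>i\<in>I. f i) x = (\<Sum>i\<in>I. f i x)"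
  by (induction I rule: infinite_finite_induct) auto

lemma combination_apply:
  fixes X :: "'i \<Rightarrow> ('a, 'e::euclidean_space) vfield"
  shows "(\<Sum>i\<in>I. \<alpha> i *\<^sub>R X i) m = (\<Sum>i\<in>I. \<alpha> i *\<^sub>R X i m)"
    and "(\<Sum>i\<in>I. \<alpha> i *\<^sub>R X i) m c = (\<Sum>i\<in>I. \<alpha> i *\<^sub>R X i m c)"
  by (simp_all add: sum_fun_apply scaleR_fun_def)

lemma chart_inv_in:
  assumes "inj_on (chart_map c) (chart_dom c)" "x \<in> chart_map c ` (chart_dom c \<inter> U)"
  shows "chart_inv c x \<in> chart_dom c" "chart_inv c x \<in> U" "chart_map c (chart_inv c x) = x"
  using assms by (auto simp: chart_inv_def inv_into_f_f)

lemma tangent_spaceD: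
  assumes "\<xi> \<in> tangent_space M m"
  shows "c \<notin> charts_at M m \<Longrightarrow> \<xi> c = 0"
    and "c \<in> charts_at M m \<Longrightarrow> \<xi> c \<in> model M"
    and "c \<in> charts_at M m \<Longrightarrow> d \<in> charts_at M m \<Longrightarrow>
      \<xi> d = deriv_along (chart_map d \<circ> chart_inv c) (chart_map c m) (\<xi> c)"
  using assms unfolding tangent_space_def by blast+

lemma tangent_space_eqI:
  assumes "\<xi> \<in> tangent_space M m" "\<zeta> \<in> tangent_space M m" "c \<in> charts_at M m" "\<xi> c = \<zeta> c"
  shows "\<xi> = \<zeta>"
proof
  fix d
  show "\<xi> d = \<zeta> d"
  proof (cases "d \<in> charts_at M m")
    case True
    show ?thesis
      by (subst tangent_spaceD(3)[OF assms(1,3) True], subst tangent_spaceD(3)[OF assms(2,3) True])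
        (simp only: assms(4))
  next
    case False
    from tangent_spaceD(1)[OF assms(1) this] tangent_spaceD(1)[OF assms(2) this] show ?thesis
      by (rule trans[OF _ sym])
  qed
qed

text \<open>The chart representations are extended from the model space to an open subset of the ambient
  space by precomposition with a projection \<open>p\<close> onto the model space.\<close>

lemma leaf_in_chart:
  fixes M :: "('a, 'e::euclidean_space) manifold"
  assumes M: "smooth_manifold M" and U: "openin (mtop M) U" and mU: "m \<in> U"
    and L: "finite_dim_lie_algebra_on M U L" and c: "c \<in> charts_at M m"
  obtains E \<pi> \<epsilon> G where "subspace E" "E \<subseteq> model M"
    "linear \<pi>" "\<And>v. \<pi> v \<in> E" "\<And>v. v \<in> E \<Longrightarrow> \<pi> v = v"
    "\<epsilon> > 0" "G 0 = chart_map c m"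
    "\<And>h. norm h < \<epsilon> \<Longrightarrow> G h \<in> chart_map c ` (chart_dom c \<inter> U)"
    "\<And>h. norm h < \<epsilon> \<Longrightarrow> \<pi> (G h - chart_map c m) = \<pi> h"
    "\<And>n. times_differentiable_on n G (ball 0 \<epsilon>)"
    "\<And>h k. norm h < \<epsilon> \<Longrightarrow> \<pi> (fderiv G h k) = \<pi> k"
    "\<And>h. norm h < \<epsilon> \<Longrightarrow> fderiv G h ` E = (\<lambda>X. X (chart_inv c (G h)) c) ` L"
proof -
  let ?V = "model M" and ?x0 = "chart_map c m"
  let ?A = "chart_map c ` (chart_dom c \<inter> U)"
  have c': "c \<in> atlas M" "m \<in> chart_dom c" using c by (auto simp: charts_at_def)
  have tc: "topological_chart M c" by (rule smooth_manifoldD(3)[OF M c'(1)])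
  note inj = topological_chart_inj[OF tc]
  have V: "subspace ?V" by (rule smooth_manifoldD(1)[OF M])
  have L_fields: "L \<subseteq> vector_fields_on M U"
    and L_lie: "\<And>X Y. X \<in> L \<Longrightarrow> Y \<in> L \<Longrightarrow> lie_bracket M U X Y \<in> L"
    using L by (auto simp: finite_dim_lie_algebra_on_def)
  obtain B where B: "finite B" "L = span B"
    using L by (auto simp: finite_dim_lie_algebra_on_def)
  have BL: "X \<in> L" if "X \<in> B" for X using that B(2) span_base by blast
  have combo: "\<exists>\<alpha>. X = (\<Sum>Y\<in>B. \<alpha> Y *\<^sub>R Y)" if "X \<in> L" for X
    using span_image_combination[OF B(1), of X "\<lambda>Y. Y"] that B(2) by simp
  have Aopen: "openin (top_of_set ?V) ?A" by (rule topological_chart_open_image[OF tc U])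
  then have AV: "?A \<subseteq> ?V" using openin_subset by fastforce
  obtain T where T: "open T" "?A = ?V \<inter> T" using Aopen by (auto simp: openin_open)
  obtain p where p: "linear p" "\<And>v. p v \<in> ?V" "\<And>v. v \<in> ?V \<Longrightarrow> p v = v"
    using subspace_projection_exists[OF V] by blast
  have blp: "bounded_linear p" using p(1) linear_conv_bounded_linear by blast
  then have contp: "continuous_on S p" for S using linear_continuous_on by blast
  let ?O = "p -` T"
  have O: "open ?O" using open_vimage[OF T(1) contp] .
  have OA: "p x \<in> ?A" if "x \<in> ?O" for x using that p(2) T(2) by blast
  have x0A: "?x0 \<in> ?A" using c' mU by blast
  then have px0: "p ?x0 = ?x0" and x0O: "?x0 \<in> ?O" using AV p(3) T(2) by auto
  let ?q = "\<lambda>x. chart_inv c (p x)"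
  have q: "?q x \<in> chart_dom c" "?q x \<in> U" "chart_map c (?q x) = p x" if "x \<in> ?O" for x
    using chart_inv_in[OF inj OA[OF that]] by auto
  have q_charts: "c \<in> charts_at M (?q x)" if "x \<in> ?O" for x
    using q(1)[OF that] c'(1) by (simp add: charts_at_def)
  let ?X = "\<lambda>X x. vfield_in_chart c X (p x)"
  have X_eq: "?X X x = X (?q x) c" for X x by (simp add: vfield_in_chart_def)
  have XV: "?X X x \<in> ?V" if "X \<in> L" "x \<in> ?O" for X x
  proof -
    have "X (?q x) \<in> tangent_space M (?q x)"
      using L_fields that q(2)[OF that(2)] by (auto simp: vector_fields_on_def)
    from tangent_spaceD(2)[OF this q_charts[OF that(2)]] show ?thesis by (simp only: X_eq)
  qed
  have ext: "\<exists>W g. open W \<and> p x \<in> W \<and> (\<forall>k. times_differentiable_on k g W) \<and>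
      (\<forall>y\<in>?V. y \<in> W \<longrightarrow> g y = vfield_in_chart c X y)" if XL: "X \<in> L" and x: "x \<in> ?O" for X x
  proof (rule smooth_onE_open[OF _ OA[OF x] Aopen])
    show "smooth_on ?A (vfield_in_chart c X)"
      using L_fields XL c'(1) by (auto simp: vector_fields_on_def)
  qed blast
  have smooth: "times_differentiable_on k (?X X) ?O" if XL: "X \<in> L" for X k
  proof (rule times_differentiable_on_local)
    fix x assume x: "x \<in> ?O"
    obtain W g where W: "open W" "p x \<in> W" "\<And>k. times_differentiable_on k g W"
      "\<And>y. y \<in> ?V \<Longrightarrow> y \<in> W \<Longrightarrow> g y = vfield_in_chart c X y"
      using ext[OF XL x] by (elim exE conjE) blast
    have oW: "open (p -` W)" using open_vimage[OF W(1) contp] .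
    have "times_differentiable_on k (\<lambda>x. g (p x)) (p -` W)"
      by (rule times_differentiable_on_compose[OF oW W(1) _ W(3) times_differentiable_on_linear[OF blp oW]]) auto
    then have "times_differentiable_on k (?X X) (p -` W)"
      by (rule times_differentiable_on_cong[OF oW, rotated]) (simp add: W(4) p(2))
    then show "\<exists>W. open W \<and> x \<in> W \<and> times_differentiable_on k (?X X) W"
      using oW W(2) by blast
  qed
  \<comment> \<open>For directions in the model space the projection \<open>p\<close> drops out.
    Hence the bracket of two extended fields is the extension of the bracket formed with
    \<open>deriv_along\<close> on the manifold.\<close>
  have deriv: "fderiv (?X X) x v = deriv_along (vfield_in_chart c X) (p x) v"
    if XL: "X \<in> L" and x: "x \<in> ?O" and v: "v \<in> ?V" for X x v
  proof -
    obtain W g where W: "open W" "p x \<in> W" "\<And>k. times_differentiable_on k g W"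
      "\<And>y. y \<in> ?V \<Longrightarrow> y \<in> W \<Longrightarrow> g y = vfield_in_chart c X y"
      using ext[OF XL x] by (elim exE conjE) blast
    have D: "(g has_derivative fderiv g (p x)) (at (p x))"
      by (rule times_differentiable_on_has_derivative[OF W(3,2)])
    have "((\<lambda>x. g (p x)) has_derivative (\<lambda>v. fderiv g (p x) (p v))) (at x)"
      by (rule has_derivative_compose[OF bounded_linear_imp_has_derivative[OF blp] D])
    then have "(?X X has_derivative (\<lambda>v. fderiv g (p x) (p v))) (at x)"
      by (rule has_derivative_transform_within_open[OF _ open_vimage[OF W(1) contp]])
        (use W p(2) in auto)
    from fun_cong[OF frechet_derivative_at[OF this], of v]
    have "fderiv (?X X) x v = fderiv g (p x) v" using p(3)[OF v] by simp
    moreover have "deriv_along (vfield_in_chart c X) (p x) v = fderiv g (p x) v"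
      by (rule deriv_along_eq[OF V p(2) v W(1,2) D W(4)])
    ultimately show ?thesis by simp
  qed
  have lie_combo: "\<exists>\<alpha>. lie_bracket M U X Y = (\<Sum>Z\<in>B. \<alpha> Z *\<^sub>R Z)" if "X \<in> B" "Y \<in> B" for X Y
    by (intro combo L_lie BL that)
  \<comment> \<open>Structure constants with respect to the spanning set \<open>B\<close>; as
    \<open>B\<close> may be dependent they are merely chosen. The involutive family consists of the
    chart representations of \<open>B\<close>.\<close>
  define \<gamma> where "\<gamma> X Y = (SOME \<alpha>. lie_bracket M U X Y = (\<Sum>Z\<in>B. \<alpha> Z *\<^sub>R Z))" for X Y
  have \<gamma>: "lie_bracket M U X Y = (\<Sum>Z\<in>B. \<gamma> X Y Z *\<^sub>R Z)" if "X \<in> B" "Y \<in> B" for X Y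
    unfolding \<gamma>_def by (rule someI_ex[OF lie_combo[OF that]])
  have br: "field_bracket (?X X) (?X Y) x = (\<Sum>Z\<in>B. \<gamma> X Y Z *\<^sub>R ?X Z x)"
    if X: "X \<in> B" and Y: "Y \<in> B" and x: "x \<in> ?O" for X Y x
  proof -
    have "field_bracket (?X X) (?X Y) x = lie_bracket M U X Y (?q x) c"
      unfolding field_bracket_def deriv[OF BL[OF X] x XV[OF BL[OF Y] x]] deriv[OF BL[OF Y] x XV[OF BL[OF X] x]]
      using q[OF x] q_charts[OF x] by (simp add: lie_bracket_def X_eq)
    then show ?thesis by (simp only: \<gamma>[OF X Y] combination_apply(2) X_eq)
  qed
  let ?E = "span ((\<lambda>X. ?X X ?x0) ` B)"
  have EV: "?E \<subseteq> ?V"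
    by (rule span_minimal[OF _ V]) (use XV BL x0O in auto)
  obtain \<pi> where \<pi>: "linear \<pi>" "\<And>v. \<pi> v \<in> ?E" "\<And>v. v \<in> ?E \<Longrightarrow> \<pi> v = v"
    using subspace_projection_exists[OF subspace_span] by blast
  obtain \<epsilon> G where G: "\<epsilon> > 0" "G 0 = ?x0" "\<And>h. norm h < \<epsilon> \<Longrightarrow> G h \<in> ?O"
    "\<And>h. norm h < \<epsilon> \<Longrightarrow> G h - ?x0 \<in> ?V"
    "\<And>h. norm h < \<epsilon> \<Longrightarrow> \<pi> (G h - ?x0) = \<pi> h"
    "\<And>n. times_differentiable_on n G (ball 0 \<epsilon>)"
    "\<And>h k. norm h < \<epsilon> \<Longrightarrow> fderiv G h k \<in> span ((\<lambda>X. ?X X (G h)) ` B)"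
    "\<And>h k. norm h < \<epsilon> \<Longrightarrow> \<pi> (fderiv G h k) = \<pi> k"
    "\<And>h k. norm h < \<epsilon> \<Longrightarrow> fderiv G h (\<pi> k) = fderiv G h k"
    "\<And>h X. norm h < \<epsilon> \<Longrightarrow> X \<in> B \<Longrightarrow> fderiv G h (?X X (G h)) = ?X X (G h)"
    by (rule involutive_leaf[OF B(1) O x0O smooth[OF BL] br \<pi> V XV[OF BL]]) (assumption+, rule that)
  have Gp: "p (G h) = G h" if "norm h < \<epsilon>" for h
  proof (rule p(3))
    have "(G h - ?x0) + ?x0 \<in> ?V" using G(4)[OF that] x0A AV by (intro subspace_add[OF V]) auto
    then show "G h \<in> ?V" by simp
  qed
  show ?thesis
  proof (rule that[of ?E \<pi> \<epsilon> G, OF subspace_span EV \<pi> G(1,2) _ G(5,6,8)])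
    fix h :: 'e assume h: "norm h < \<epsilon>"
    show "G h \<in> ?A" using OA[OF G(3)[OF h]] Gp[OF h] by simp
    let ?s = "chart_inv c (G h)"
    have X_eq': "?X X (G h) = X ?s c" for X
      using X_eq[of X "G h"] by (simp only: Gp[OF h])
    have lin: "linear (fderiv G h)"
      using times_differentiable_on_has_derivative[OF G(6)] h has_derivative_linear by (metis mem_ball_0)
    show "fderiv G h ` ?E = (\<lambda>X. X ?s c) ` L"
    proof (intro equalityI subsetI)
      fix v assume "v \<in> fderiv G h ` ?E"
      then have "v \<in> span ((\<lambda>X. ?X X (G h)) ` B)" using G(7)[OF h] by blast
      then obtain \<alpha> where "v = (\<Sum>X\<in>B. \<alpha> X *\<^sub>R ?X X (G h))"
        using span_image_combination[OF B(1)] by blast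
      then have "v = (\<Sum>X\<in>B. \<alpha> X *\<^sub>R X) ?s c" by (simp only: combination_apply(2) X_eq')
      moreover have "(\<Sum>X\<in>B. \<alpha> X *\<^sub>R X) \<in> L"
        unfolding B(2) by (intro span_sum span_scale span_base)
      ultimately show "v \<in> (\<lambda>X. X ?s c) ` L" by blast
    next
      fix v assume "v \<in> (\<lambda>X. X ?s c) ` L"
      then obtain X where X: "X \<in> L" "v = X ?s c" by blast
      obtain \<alpha> where "X = (\<Sum>Y\<in>B. \<alpha> Y *\<^sub>R Y)" using combo[OF X(1)] by blast
      then have v: "v = (\<Sum>Y\<in>B. \<alpha> Y *\<^sub>R ?X Y (G h))" by (simp only: X(2) combination_apply(2) X_eq')
      \<comment> \<open>Because the \<open>Z\<close> vanish on the leaf, the derivative of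
        \<open>G\<close> fixes the values of \<open>L\<close> there. As it factors through \<pi>,
        such a value is the image of \<open>\<pi> v\<close>, an element of \<open>E\<close>.\<close>
      have "fderiv G h v = v"
        unfolding v linear_sum[OF lin] linear_cmul[OF lin]
        by (intro sum.cong refl arg_cong2[where f = scaleR] G(10)[OF h])
      then have "fderiv G h (\<pi> v) = v" using G(9)[OF h] by simp
      then show "v \<in> fderiv G h ` ?E" using \<pi>(2) by (metis image_eqI)
    qed
  qed
qed

section \<open>Integral manifolds\<close>

text \<open>\<open>v \<mapsto> \<pi> (v - chart_map c m)\<close> is a left inverse of
  \<open>G\<close> on \<open>E\<close>, so \<open>G\<close> restricted to \<open>E\<close> is an
  embedding and its inverse serves as the only chart. \<open>Z\<close> is a prescribed candidate for
  the tangent space; comparing it with the derivative of \<open>G\<close> in the single chart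
  \<open>c\<close> suffices, since one component determines a tangent vector.\<close>

lemma slice_submanifold:
  fixes M :: "('a, 'e::euclidean_space) manifold"
  assumes M: "smooth_manifold M" and c: "c \<in> charts_at M m" and E: "subspace E" "E \<subseteq> model M"
    and \<pi>: "linear \<pi>" "\<And>v. \<pi> v \<in> E" "\<And>v. v \<in> E \<Longrightarrow> \<pi> v = v"
    and G: "\<And>h. norm h < \<epsilon> \<Longrightarrow> G h \<in> chart_map c ` chart_dom c"
      "\<And>h. norm h < \<epsilon> \<Longrightarrow> \<pi> (G h - chart_map c m) = \<pi> h"
      "\<And>n. times_differentiable_on n G (ball 0 \<epsilon>)"
      "\<And>h k. norm h < \<epsilon> \<Longrightarrow> \<pi> (fderiv G h k) = \<pi> k"
      "\<And>h k. norm h < \<epsilon> \<Longrightarrow> k \<in> E \<Longrightarrow> fderiv G h k \<in> model M"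
  defines "\<sigma> \<equiv> \<lambda>h. chart_inv c (G h)"
  obtains S where "immersive_submanifold S M" "carrier S = \<sigma> ` (ball 0 \<epsilon> \<inter> E)"
    "\<And>h Z. h \<in> ball 0 \<epsilon> \<inter> E \<Longrightarrow> Z \<subseteq> tangent_space M (\<sigma> h) \<Longrightarrow> fderiv G h ` E = (\<lambda>\<zeta>. \<zeta> c) ` Z \<Longrightarrow>
       tangent_map S M (\<lambda>s. s) (\<sigma> h) ` tangent_space S (\<sigma> h) = Z"
proof -
  let ?V = "model M" and ?x0 = "chart_map c m"
  have c': "c \<in> atlas M" "m \<in> chart_dom c" using c by (auto simp: charts_at_def)
  have tc: "topological_chart M c" by (rule smooth_manifoldD(3)[OF M c'(1)])
  note inj = topological_chart_inj[OF tc]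
  have V: "subspace ?V" by (rule smooth_manifoldD(1)[OF M])
  define N where "N = ball 0 \<epsilon> \<inter> E"
  define S0 where "S0 = \<sigma> ` N"
  define \<kappa> where "\<kappa> = (S0, \<lambda>s. \<pi> (chart_map c s - ?x0))"
  define S where "S = \<lparr>model = E, mtop = subtopology (mtop M) S0, atlas = {\<kappa>}\<rparr>"
  have N: "norm h < \<epsilon>" "h \<in> E" if "h \<in> N" for h using that by (auto simp: N_def)
  have \<sigma>: "\<sigma> h \<in> chart_dom c" "chart_map c (\<sigma> h) = G h" if "h \<in> N" for h
    using chart_inv_in[OF inj, of "G h" UNIV] G(1)[OF N(1)[OF that]] by (auto simp: \<sigma>_def)
  have \<kappa>\<sigma>: "chart_map \<kappa> (\<sigma> h) = h" if "h \<in> N" for h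
    using G(2)[OF N(1)[OF that]] \<pi>(3)[OF N(2)[OF that]] \<sigma>(2)[OF that] by (simp add: \<kappa>_def)
  have \<kappa>_dom: "chart_dom \<kappa> = S0" by (simp add: \<kappa>_def)
  have \<kappa>_inj: "inj_on (chart_map \<kappa>) S0"
    unfolding S0_def by (rule inj_onI) (auto simp: \<kappa>\<sigma>)
  have inv_\<kappa>: "chart_inv \<kappa> h = \<sigma> h" if "h \<in> N" for h
    using chart_inv_chart_map[of \<kappa> "\<sigma> h"] \<kappa>_inj that by (simp add: \<kappa>_dom \<kappa>\<sigma> S0_def)
  have \<kappa>_image: "chart_map \<kappa> ` S0 = N"
    by (auto simp: S0_def \<kappa>\<sigma> image_image cong: image_cong_simp)
  have S0_dom: "S0 \<subseteq> chart_dom c" using \<sigma>(1) by (auto simp: S0_def)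
  then have S0_M: "S0 \<subseteq> carrier M" using topological_chart_dom[OF tc] by blast
  then have carrier_S: "carrier S = S0" by (auto simp: S_def topspace_subtopology)
  have S_simps: "model S = E" "mtop S = subtopology (mtop M) S0" "atlas S = {\<kappa>}"
    by (simp_all add: S_def)
  have N_open: "openin (top_of_set E) N" unfolding N_def by (metis Int_commute open_ball openin_open_Int)
  have G_cont: "continuous_on (ball 0 \<epsilon>) G" using G(3)[of 0] by simp
  have cont_\<kappa>: "continuous_map (subtopology (mtop M) S0) (top_of_set N) (chart_map \<kappa>)"
  proof -
    have "continuous_map (subtopology (mtop M) S0) euclidean (chart_map c)"
      by (rule continuous_map_from_subtopology_mono[OF topological_chart_continuous[OF tc] S0_dom])
    moreover have "continuous_map euclidean euclidean (\<lambda>v. \<pi> (v - ?x0))"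
      unfolding continuous_map_iff_continuous2
      by (intro continuous_on_compose2[OF linear_continuous_on[of \<pi> UNIV]] continuous_intros)
        (use \<pi>(1) linear_conv_bounded_linear in auto)
    ultimately have "continuous_map (subtopology (mtop M) S0) euclidean ((\<lambda>v. \<pi> (v - ?x0)) \<circ> chart_map c)"
      by (rule continuous_map_compose)
    then have "continuous_map (subtopology (mtop M) S0) euclidean (chart_map \<kappa>)"
      by (simp add: \<kappa>_def o_def)
    then show ?thesis
      by (rule continuous_map_into_subtopology) (use \<kappa>_image in \<open>auto simp: topspace_subtopology\<close>)
  qed
  have cont_\<sigma>: "continuous_map (top_of_set N) (subtopology (mtop M) S0) \<sigma>"
  proof -
    have "continuous_map (top_of_set N) (top_of_set (chart_map c ` chart_dom c)) G"
      using G(1) N(1) continuous_on_subset[OF G_cont, of N] by (auto simp: N_def)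
    from continuous_map_compose[OF this topological_chart_inv_continuous[OF tc]]
    have "continuous_map (top_of_set N) (mtop M) \<sigma>" by (simp add: o_def \<sigma>_def)
    then show ?thesis by (rule continuous_map_into_subtopology) (auto simp: S0_def)
  qed
  have hom: "homeomorphic_map (subtopology (mtop M) S0) (top_of_set N) (chart_map \<kappa>)"
    by (rule homeomorphic_maps_imp_map[where g = \<sigma>])
      (use cont_\<kappa> cont_\<sigma> \<kappa>\<sigma> in \<open>auto simp: homeomorphic_maps_def topspace_subtopology S0_def\<close>)
  have smooth_\<kappa>: "smooth_on N (chart_map \<kappa> \<circ> chart_inv \<kappa>)"
    unfolding smooth_on_def
  proof
    fix h assume "h \<in> N"
    show "\<exists>W g. open W \<and> h \<in> W \<and> (\<forall>k. times_differentiable_on k g W) \<and>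
        (\<forall>y\<in>N \<inter> W. g y = (chart_map \<kappa> \<circ> chart_inv \<kappa>) y)"
      by (intro exI[of _ UNIV] exI[of _ "\<lambda>x. x"])
        (simp add: times_differentiable_on_ident inv_\<kappa> \<kappa>\<sigma>)
  qed
  have S: "smooth_manifold S"
    unfolding smooth_manifold_def S_simps
  proof (intro conjI E(1))
    show "Hausdorff_space (subtopology (mtop M) S0)"
      by (rule Hausdorff_space_subtopology[OF smooth_manifoldD(2)[OF M]])
    show "paracompact_space (subtopology (mtop M) S0)"
      by (rule paracompact_space_homeomorphic_euclidean[OF hom])
    show "\<forall>c\<in>{\<kappa>}. topological_chart S c"
      using hom N_open openin_topspace[of "mtop S", unfolded carrier_S, unfolded S_simps]
      by (simp add: topological_chart_def \<kappa>_dom \<kappa>_image carrier_S S_simps subtopology_subtopology)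
    show "(\<Union>c\<in>{\<kappa>}. chart_dom c) = topspace (subtopology (mtop M) S0)"
      using carrier_S by (simp add: \<kappa>_dom S_simps)
    show "\<forall>c\<in>{\<kappa>}. \<forall>d\<in>{\<kappa>}. smooth_on (chart_map c ` (chart_dom c \<inter> chart_dom d)) (chart_map d \<circ> chart_inv c)"
      using smooth_\<kappa> by (simp add: \<kappa>_dom \<kappa>_image)
  qed
  have c_charts: "c \<in> charts_at M (\<sigma> h)" if "h \<in> N" for h
    using c'(1) \<sigma>(1)[OF that] by (simp add: charts_at_def)
  have GV: "G h \<in> ?V" if "norm h < \<epsilon>" for h
    using G(1)[OF that] openin_subset[OF topological_chart_open_image[OF tc openin_topspace]]
      topological_chart_dom[OF tc] by (auto simp: Int_absorb2)
  text \<open>In the charts \<open>\<kappa>\<close> and \<open>d\<close> the inclusion is the transition from \<open>c\<close> to \<open>d\<close> after \<open>G\<close>.\<close>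
  have inclusion: "\<exists>W g. open W \<and> h \<in> W \<and> (\<forall>k. times_differentiable_on k g W) \<and>
      (\<forall>y\<in>E. y \<in> W \<longrightarrow> g y = (chart_map d \<circ> (\<lambda>s. s) \<circ> chart_inv \<kappa>) y) \<and>
      (\<forall>k\<in>E. fderiv g h k = deriv_along (chart_map d \<circ> chart_inv c) (G h) (fderiv G h k))"
    if h: "h \<in> N" and d: "d \<in> charts_at M (\<sigma> h)" for h d
  proof -
    obtain W' g' where W': "open W'" "G h \<in> W'" "\<And>k. times_differentiable_on k g' W'"
      "\<And>y. y \<in> ?V \<Longrightarrow> y \<in> W' \<Longrightarrow> g' y = (chart_map d \<circ> chart_inv c) y"
    proof (rule transition_extension[OF M c_charts[OF h] d])
      fix W g
      assume W: "open W" "chart_map c (\<sigma> h) \<in> W" "\<And>k. times_differentiable_on k g W"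
        "\<And>y. y \<in> ?V \<Longrightarrow> y \<in> W \<Longrightarrow> y \<in> chart_map c ` (chart_dom c \<inter> chart_dom d) \<and>
          g y = (chart_map d \<circ> chart_inv c) y"
      show thesis
        by (rule that[OF W(1) _ W(3)]) (use W(2,4) \<sigma>(2)[OF h] in auto)
    qed
    let ?W = "ball 0 \<epsilon> \<inter> G -` W'"
    have oW: "open ?W" by (rule continuous_open_preimage[OF G_cont open_ball W'(1)])
    have D: "(G has_derivative fderiv G h) (at h)"
      by (rule times_differentiable_on_has_derivative[OF G(3)]) (use N(1)[OF h] in simp)
    have D': "(g' has_derivative fderiv g' (G h)) (at (G h))"
      by (rule times_differentiable_on_has_derivative[OF W'(3,2)])
    show ?thesis
    proof (intro exI conjI ballI allI impI)
      show "open ?W" by (rule oW)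
      show "h \<in> ?W" using N(1)[OF h] W'(2) by simp
      show "times_differentiable_on k (\<lambda>y. g' (G y)) ?W" for k
        by (rule times_differentiable_on_compose[OF oW W'(1) _ W'(3) times_differentiable_on_subset[OF G(3)]]) auto
      show "g' (G y) = (chart_map d \<circ> (\<lambda>s. s) \<circ> chart_inv \<kappa>) y" if "y \<in> E" "y \<in> ?W" for y
      proof -
        have "y \<in> N" using that by (simp add: N_def)
        moreover have "g' (G y) = (chart_map d \<circ> chart_inv c) (G y)"
          using that GV[of y] by (intro W'(4)) auto
        ultimately show ?thesis by (simp add: inv_\<kappa> \<sigma>_def)
      qed
      fix k assume k: "k \<in> E"
      have "fderiv (\<lambda>y. g' (G y)) h k = fderiv g' (G h) (fderiv G h k)"
        using fun_cong[OF frechet_derivative_at[OF has_derivative_compose[OF D D']], of k] by simp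
      also have "\<dots> = deriv_along (chart_map d \<circ> chart_inv c) (G h) (fderiv G h k)"
        by (rule deriv_along_eq[OF V GV[OF N(1)[OF h]] G(5)[OF N(1)[OF h] k] W'(1,2) D' W'(4), symmetric])
      finally show "fderiv (\<lambda>y. g' (G y)) h k = deriv_along (chart_map d \<circ> chart_inv c) (G h) (fderiv G h k)" .
    qed
  qed
  have deriv_inclusion: "deriv_along (chart_map d \<circ> (\<lambda>s. s) \<circ> chart_inv \<kappa>) h k =
      deriv_along (chart_map d \<circ> chart_inv c) (G h) (fderiv G h k)"
    if h: "h \<in> N" and d: "d \<in> charts_at M (\<sigma> h)" and k: "k \<in> E" for h d k
  proof -
    obtain W g where W: "open W" "h \<in> W" "\<forall>k. times_differentiable_on k g W"
      "\<forall>y\<in>E. y \<in> W \<longrightarrow> g y = (chart_map d \<circ> (\<lambda>s. s) \<circ> chart_inv \<kappa>) y"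
      and g: "\<forall>k\<in>E. fderiv g h k = deriv_along (chart_map d \<circ> chart_inv c) (G h) (fderiv G h k)"
      using inclusion[OF h d] by (elim exE conjE)
    have "deriv_along (chart_map d \<circ> (\<lambda>s. s) \<circ> chart_inv \<kappa>) h k = fderiv g h k"
      by (rule deriv_along_eq[OF E(1) N(2)[OF h] k W(1,2) times_differentiable_on_has_derivative[OF spec[OF W(3)] W(2)]])
        (use W(4) in blast)
    then show ?thesis using g k by simp
  qed
  \<comment> \<open>With a single chart the arbitrary choice made in \<open>tangent_map\<close> is
    determined.\<close>
  have charts_S: "charts_at S (\<sigma> h) = {\<kappa>}" if "h \<in> N" for h
  proof -
    have "\<sigma> h \<in> chart_dom \<kappa>" using that by (simp add: \<kappa>_dom S0_def)
    then show ?thesis unfolding charts_at_def S_simps by blast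
  qed
  \<comment> \<open>Both sides transport the same vector from \<open>c\<close> to \<open>d\<close>
    by the derivative of the transition map.\<close>
  have tangent_map_S: "tangent_map S M (\<lambda>s. s) (\<sigma> h) \<xi> = \<zeta>"
    if h: "h \<in> N" and \<xi>: "\<xi> \<in> tangent_space S (\<sigma> h)" and \<zeta>: "\<zeta> \<in> tangent_space M (\<sigma> h)"
      and eq: "\<zeta> c = fderiv G h (\<xi> \<kappa>)" for h \<xi> \<zeta>
  proof
    fix d
    have \<xi>E: "\<xi> \<kappa> \<in> E" using tangent_spaceD(2)[OF \<xi>, of \<kappa>] charts_S[OF h] by (simp add: S_simps)
    show "tangent_map S M (\<lambda>s. s) (\<sigma> h) \<xi> d = \<zeta> d"
    proof (cases "d \<in> charts_at M (\<sigma> h)")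
      case True
      have "\<zeta> d = deriv_along (chart_map d \<circ> chart_inv c) (chart_map c (\<sigma> h)) (\<zeta> c)"
        by (rule tangent_spaceD(3)[OF \<zeta> c_charts[OF h] True])
      then show ?thesis
        using True by (simp add: tangent_map_def charts_S[OF h] \<kappa>\<sigma>[OF h] \<sigma>(2)[OF h] eq
            deriv_inclusion[OF h True \<xi>E])
    next
      case False
      then show ?thesis using tangent_spaceD(1)[OF \<zeta> False] by (simp add: tangent_map_def)
    qed
  qed
  have tangent_S: "(\<lambda>d. if d = \<kappa> then k else 0) \<in> tangent_space S (\<sigma> h)" if h: "h \<in> N" and k: "k \<in> E" for h k
  proof -
    have "deriv_along (chart_map \<kappa> \<circ> chart_inv \<kappa>) h k = k"
    proof (rule deriv_along_eq[OF E(1) N(2)[OF h] k open_ball, where g = "\<lambda>x. x" and g' = "\<lambda>x. x"])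
      show "h \<in> ball 0 \<epsilon>" using N(1)[OF h] by simp
      show "y = (chart_map \<kappa> \<circ> chart_inv \<kappa>) y" if "y \<in> E" "y \<in> ball 0 \<epsilon>" for y
        using that by (simp add: N_def inv_\<kappa> \<kappa>\<sigma>)
    qed auto
    then show ?thesis
      using k by (simp add: tangent_space_def charts_S[OF h] S_simps \<kappa>\<sigma>[OF h])
  qed
  have immersion: "immersion S M (\<lambda>s. s)"
    unfolding immersion_def smooth_map_def
  proof (intro conjI ballI)
    show "continuous_map (mtop S) (mtop M) (\<lambda>s. s)"
      unfolding S_simps using continuous_map_from_subtopology[OF continuous_map_id] by (simp add: id_def)
    fix e d assume e: "e \<in> atlas S" and d: "d \<in> atlas M"
    have [simp]: "e = \<kappa>" using e by (simp add: S_simps)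
    have "smooth_on (chart_map \<kappa> ` (S0 \<inter> (\<lambda>s. s) -` chart_dom d)) (chart_map d \<circ> (\<lambda>s. s) \<circ> chart_inv \<kappa>)"
      unfolding smooth_on_def
    proof
      fix x assume "x \<in> chart_map \<kappa> ` (S0 \<inter> (\<lambda>s. s) -` chart_dom d)"
      then obtain h where h: "h \<in> N" "x = h" "\<sigma> h \<in> chart_dom d" by (auto simp: S0_def \<kappa>\<sigma>)
      have "d \<in> charts_at M (\<sigma> h)" using d h(3) by (simp add: charts_at_def)
      from inclusion[OF h(1) this] obtain W g where W: "open W" "h \<in> W" "\<forall>k. times_differentiable_on k g W"
        "\<forall>y\<in>E. y \<in> W \<longrightarrow> g y = (chart_map d \<circ> (\<lambda>s. s) \<circ> chart_inv \<kappa>) y"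
        by (elim exE conjE)
      have "y \<in> E" if "y \<in> chart_map \<kappa> ` (S0 \<inter> (\<lambda>s. s) -` chart_dom d)" for y
        using that \<kappa>_image N(2) by blast
      then show "\<exists>W g. open W \<and> x \<in> W \<and> (\<forall>k. times_differentiable_on k g W) \<and>
          (\<forall>y\<in>chart_map \<kappa> ` (S0 \<inter> (\<lambda>s. s) -` chart_dom d) \<inter> W. g y = (chart_map d \<circ> (\<lambda>s. s) \<circ> chart_inv \<kappa>) y)"
        using W h(2) by (intro exI[of _ W] exI[of _ g]) auto
    qed
    then show "smooth_on (chart_map e ` (chart_dom e \<inter> (\<lambda>s. s) -` chart_dom d)) (chart_map d \<circ> (\<lambda>s. s) \<circ> chart_inv e)"
      by (simp add: \<kappa>_dom)
  next
    fix s assume "s \<in> carrier S"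
    then obtain h where h: "h \<in> N" "s = \<sigma> h" by (auto simp: carrier_S S0_def)
    have at_c: "tangent_map S M (\<lambda>s. s) (\<sigma> h) \<xi> c = fderiv G h (\<xi> \<kappa>)" "\<xi> \<kappa> \<in> E"
      if \<xi>: "\<xi> \<in> tangent_space S (\<sigma> h)" for \<xi>
    proof -
      show \<xi>E: "\<xi> \<kappa> \<in> E" using tangent_spaceD(2)[OF \<xi>, of \<kappa>] charts_S[OF h(1)] by (simp add: S_simps)
      \<comment> \<open>The case \<open>d = c\<close> of the inclusion formula, where the transition
        map is the identity on the model space near \<open>G h\<close>.\<close>
      have "deriv_along (chart_map c \<circ> chart_inv c) (G h) (fderiv G h (\<xi> \<kappa>)) = fderiv G h (\<xi> \<kappa>)"
      proof (rule transition_extension[OF M c_charts[OF h(1)] c_charts[OF h(1)]])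
        fix W g
        assume W: "open W" "chart_map c (\<sigma> h) \<in> W" "\<And>k. times_differentiable_on k g W"
          "\<And>y. y \<in> ?V \<Longrightarrow> y \<in> W \<Longrightarrow> y \<in> chart_map c ` (chart_dom c \<inter> chart_dom c) \<and>
            g y = (chart_map c \<circ> chart_inv c) y"
        have "y = (chart_map c \<circ> chart_inv c) y" if "y \<in> ?V" "y \<in> W" for y
          using W(4)[OF that] chart_inv_in(3)[OF inj, of y UNIV] by simp
        then show ?thesis
          using W(1,2) \<sigma>(2)[OF h(1)]
          by (intro deriv_along_eq[OF V GV[OF N(1)[OF h(1)]] G(5)[OF N(1)[OF h(1)] \<xi>E], where g = "\<lambda>x. x" and g' = "\<lambda>x. x"]) auto
      qed
      then show "tangent_map S M (\<lambda>s. s) (\<sigma> h) \<xi> c = fderiv G h (\<xi> \<kappa>)"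
        using c_charts[OF h(1)]
        by (simp add: tangent_map_def charts_S[OF h(1)] \<kappa>\<sigma>[OF h(1)] deriv_inclusion[OF h(1) c_charts[OF h(1)] \<xi>E])
    qed
    show "inj_on (tangent_map S M (\<lambda>s. s) s) (tangent_space S s)"
      unfolding h(2)
    proof (rule inj_onI)
      fix \<xi> \<zeta>
      assume \<xi>: "\<xi> \<in> tangent_space S (\<sigma> h)" and \<zeta>: "\<zeta> \<in> tangent_space S (\<sigma> h)"
        and "tangent_map S M (\<lambda>s. s) (\<sigma> h) \<xi> = tangent_map S M (\<lambda>s. s) (\<sigma> h) \<zeta>"
      then have "fderiv G h (\<xi> \<kappa>) = fderiv G h (\<zeta> \<kappa>)" using at_c(1)[OF \<xi>] at_c(1)[OF \<zeta>] by simp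
      \<comment> \<open>On \<open>E\<close> the projection is a left inverse of the derivative of
        \<open>G\<close>, which makes the inclusion immersive.\<close>
      then have "\<pi> (\<xi> \<kappa>) = \<pi> (\<zeta> \<kappa>)" using G(4)[OF N(1)[OF h(1)]] by metis
      then have "\<xi> \<kappa> = \<zeta> \<kappa>" using \<pi>(3) at_c(2)[OF \<xi>] at_c(2)[OF \<zeta>] by simp
      then show "\<xi> = \<zeta>"
        using charts_S[OF h(1)] by (intro tangent_space_eqI[OF \<xi> \<zeta>, of \<kappa>]) auto
    qed
  qed
  show ?thesis
  proof (rule that[of S])
    show "immersive_submanifold S M"
      using S immersion S0_M carrier_S by (simp add: immersive_submanifold_def)
    show "carrier S = \<sigma> ` (ball 0 \<epsilon> \<inter> E)" using carrier_S by (simp add: S0_def N_def)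
    fix h Z
    assume h': "h \<in> ball 0 \<epsilon> \<inter> E" and Z: "Z \<subseteq> tangent_space M (\<sigma> h)"
      and img: "fderiv G h ` E = (\<lambda>\<zeta>. \<zeta> c) ` Z"
    then have h: "h \<in> N" by (simp add: N_def)
    show "tangent_map S M (\<lambda>s. s) (\<sigma> h) ` tangent_space S (\<sigma> h) = Z"
    proof (intro equalityI subsetI)
      fix \<zeta> assume "\<zeta> \<in> tangent_map S M (\<lambda>s. s) (\<sigma> h) ` tangent_space S (\<sigma> h)"
      then obtain \<xi> where \<xi>: "\<xi> \<in> tangent_space S (\<sigma> h)" "\<zeta> = tangent_map S M (\<lambda>s. s) (\<sigma> h) \<xi>" by blast
      have "\<xi> \<kappa> \<in> E" using tangent_spaceD(2)[OF \<xi>(1), of \<kappa>] charts_S[OF h] by (simp add: S_simps)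
      then have "fderiv G h (\<xi> \<kappa>) \<in> (\<lambda>\<zeta>. \<zeta> c) ` Z" using img by blast
      then obtain \<zeta>' where "\<zeta>' \<in> Z" "\<zeta>' c = fderiv G h (\<xi> \<kappa>)" by force
      then show "\<zeta> \<in> Z" using tangent_map_S[OF h \<xi>(1), of \<zeta>'] Z \<xi>(2) by blast
    next
      fix \<zeta> assume \<zeta>: "\<zeta> \<in> Z"
      then have "\<zeta> c \<in> fderiv G h ` E" using img by blast
      then obtain k where k: "k \<in> E" "\<zeta> c = fderiv G h k" by blast
      let ?\<xi> = "\<lambda>d. if d = \<kappa> then k else 0"
      have "tangent_map S M (\<lambda>s. s) (\<sigma> h) ?\<xi> = \<zeta>"
        by (rule tangent_map_S[OF h tangent_S[OF h k(1)]]) (use \<zeta> Z k in auto)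
      then show "\<zeta> \<in> tangent_map S M (\<lambda>s. s) (\<sigma> h) ` tangent_space S (\<sigma> h)"
        using tangent_S[OF h k(1)] by blast
    qed
  qed
qed

text \<open>The two conditions in \<open>generates_on\<close> give the two inclusions. At a fixed
  point the coefficient functions become real numbers, so a smooth combination takes the same value
  there as some element of \<open>L\<close>.\<close>

lemma induced_distribution_eq:
  fixes D :: "('a, 'e::euclidean_space) local_vfield set"
  assumes L: "subspace L" and gen: "generates_on M U L D" and m: "m \<in> U"
  shows "induced_distribution D m = (\<lambda>X. X m) ` L"
proof
  show "(\<lambda>X. X m) ` L \<subseteq> induced_distribution D m"
    using gen m by (auto simp: generates_on_def tangent_fields_def)
  have "linear (\<lambda>X :: ('a, 'e) vfield. X m)"
    by (rule linearI) (simp_all add: scaleR_fun_def)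
  then have sub: "subspace ((\<lambda>X. X m) ` L)"
    using L by (rule linear_subspace_image)
  show "induced_distribution D m \<subseteq> (\<lambda>X. X m) ` L"
    unfolding induced_distribution_def
  proof (rule span_minimal[OF _ sub], clarify)
    fix V Y assume Y: "(V, Y) \<in> D" and mV: "m \<in> V"
    have "smooth_linear_combination M L (restrict_vfield U (V, Y))"
      using gen Y by (auto simp: generates_on_def)
    then obtain F a where F: "finite F" "F \<subseteq> L"
      "\<forall>m\<in>V \<inter> U. (if m \<in> U then Y m else 0) = (\<Sum>X\<in>F. a X m *\<^sub>R X m)"
      unfolding smooth_linear_combination_def restrict_vfield_def case_prod_conv by (elim exE conjE)
    have "Y m = (\<Sum>X\<in>F. a X m *\<^sub>R X) m"
      using F(3) m mV by (simp add: combination_apply(1))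
    moreover have "(\<Sum>X\<in>F. a X m *\<^sub>R X) \<in> L"
      using F(2) by (intro subspace_sum[OF L] subspace_scale[OF L]) auto
    ultimately show "Y m \<in> (\<lambda>X. X m) ` L" by blast
  qed
qed

theorem mainTheorem3:
  fixes M :: "('a, 'e::euclidean_space) manifold"
    and D :: "('a, 'e) local_vfield set"
  assumes "smooth_manifold M"
    and "D \<subseteq> local_vector_fields M"
    and "everywhere_defined M D"
    and "\<And>m. m \<in> carrier M \<Longrightarrow>
           \<exists>U L. openin (mtop M) U \<and> m \<in> U \<and> finite_dim_lie_algebra_on M U L \<and> generates_on M U L D"
  shows "integrable_distribution M (induced_distribution D)"
  unfolding integrable_distribution_def
\<comment> \<open>The second alternative is reached at every point: where all fields of
  \<open>L\<close> vanish, \<open>E\<close> is zero and the manifold found below is the single point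
  \<open>m\<close>.\<close>
proof (intro conjI ballI disjI2)
  note M = assms(1)
  have "induced_distribution D m \<subseteq> tangent_space M m" for m
    unfolding induced_distribution_def
    by (rule span_minimal[OF _ subspace_tangent_space[OF M]])
      (use assms(2) in \<open>auto simp: local_vector_fields_def vector_fields_on_def\<close>)
  then have "distribution M (induced_distribution D)"
    by (simp add: distribution_def induced_distribution_def)
  then show "smooth_distribution M (induced_distribution D)"
    using assms(2,3) unfolding smooth_distribution_def by blast
  fix m assume "m \<in> carrier M"
  then obtain U L where U: "openin (mtop M) U" "m \<in> U" and L: "finite_dim_lie_algebra_on M U L"
    and gen: "generates_on M U L D"
    using assms(4) by blast
  have subL: "subspace L" and L_fields: "L \<subseteq> vector_fields_on M U"
    using L by (auto simp: finite_dim_lie_algebra_on_def)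
  obtain c where c: "c \<in> charts_at M m"
    using smooth_manifoldD(4)[OF M \<open>m \<in> carrier M\<close>] by blast
  have tc: "topological_chart M c"
    using smooth_manifoldD(3)[OF M] c by (simp add: charts_at_def)
  obtain E \<pi> \<epsilon> G where E: "subspace E" "E \<subseteq> model M"
    and \<pi>: "linear \<pi>" "\<And>v. \<pi> v \<in> E" "\<And>v. v \<in> E \<Longrightarrow> \<pi> v = v"
    and \<epsilon>: "\<epsilon> > 0" "G 0 = chart_map c m"
    and G: "\<And>h. norm h < \<epsilon> \<Longrightarrow> G h \<in> chart_map c ` (chart_dom c \<inter> U)"
    "\<And>h. norm h < \<epsilon> \<Longrightarrow> \<pi> (G h - chart_map c m) = \<pi> h"
    "\<And>n. times_differentiable_on n G (ball 0 \<epsilon>)"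
    "\<And>h k. norm h < \<epsilon> \<Longrightarrow> \<pi> (fderiv G h k) = \<pi> k"
    "\<And>h. norm h < \<epsilon> \<Longrightarrow> fderiv G h ` E = (\<lambda>X. X (chart_inv c (G h)) c) ` L"
    by (rule leaf_in_chart[OF M U L c]) (rule that)
  let ?\<sigma> = "\<lambda>h. chart_inv c (G h)"
  have \<sigma>: "?\<sigma> h \<in> chart_dom c" "?\<sigma> h \<in> U" if "norm h < \<epsilon>" for h
    using chart_inv_in[OF topological_chart_inj[OF tc] G(1)[OF that]] by auto
  have tangent: "X (?\<sigma> h) \<in> tangent_space M (?\<sigma> h)" if "X \<in> L" "norm h < \<epsilon>" for X h
    using L_fields that(1) \<sigma>(2)[OF that(2)] by (auto simp: vector_fields_on_def)
  \<comment> \<open>On \<open>E\<close> the derivative takes values of fields in \<open>L\<close>,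
    and components of tangent vectors lie in the model space.\<close>
  have G_model: "fderiv G h k \<in> model M" if h: "norm h < \<epsilon>" and k: "k \<in> E" for h k
  proof -
    obtain X where X: "X \<in> L" "fderiv G h k = X (?\<sigma> h) c" using G(5)[OF h] k by blast
    have "c \<in> charts_at M (?\<sigma> h)" using c \<sigma>(1)[OF h] by (simp add: charts_at_def)
    from tangent_spaceD(2)[OF tangent[OF X(1) h] this] show ?thesis by (simp only: X(2))
  qed
  have G_dom: "G h \<in> chart_map c ` chart_dom c" if "norm h < \<epsilon>" for h
    using G(1)[OF that] by blast
  obtain S where S: "immersive_submanifold S M" "carrier S = ?\<sigma> ` (ball 0 \<epsilon> \<inter> E)"
    "\<And>h Z. h \<in> ball 0 \<epsilon> \<inter> E \<Longrightarrow> Z \<subseteq> tangent_space M (?\<sigma> h) \<Longrightarrow> fderiv G h ` E = (\<lambda>\<zeta>. \<zeta> c) ` Z \<Longrightarrow>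
       tangent_map S M (\<lambda>s. s) (?\<sigma> h) ` tangent_space S (?\<sigma> h) = Z"
    by (rule slice_submanifold[OF M c E \<pi> G_dom G(2,3,4) G_model]) (assumption+, rule that)
  show "\<exists>S. integral_manifold M (induced_distribution D) S \<and> m \<in> carrier S"
  proof (intro exI conjI)
    have "?\<sigma> 0 = m"
      using chart_inv_chart_map[OF topological_chart_inj[OF tc]] c \<epsilon>(2) by (simp add: charts_at_def)
    moreover have "0 \<in> ball 0 \<epsilon> \<inter> E" using \<epsilon>(1) subspace_0[OF E(1)] by simp
    ultimately show "m \<in> carrier S" using S(2) by blast
    show "integral_manifold M (induced_distribution D) S"
      unfolding integral_manifold_def
    proof (intro conjI S(1) ballI)
      fix s assume "s \<in> carrier S"
      then obtain h where h: "h \<in> ball 0 \<epsilon> \<inter> E" "s = ?\<sigma> h" using S(2) by blast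
      then have h\<epsilon>: "norm h < \<epsilon>" by simp
      \<comment> \<open>The prescribed tangent space is the set of values of \<open>L\<close> at the
        point; it coincides with the distribution throughout \<open>U\<close>, although its
        dimension may vary off the leaf.\<close>
      have "tangent_map S M (\<lambda>s. s) (?\<sigma> h) ` tangent_space S (?\<sigma> h) = (\<lambda>X. X (?\<sigma> h)) ` L"
      proof (rule S(3)[OF h(1)])
        show "(\<lambda>X. X (?\<sigma> h)) ` L \<subseteq> tangent_space M (?\<sigma> h)" using tangent h\<epsilon> by blast
        show "fderiv G h ` E = (\<lambda>\<zeta>. \<zeta> c) ` (\<lambda>X. X (?\<sigma> h)) ` L"
          unfolding G(5)[OF h\<epsilon>] image_image ..
      qed
      also have "\<dots> = induced_distribution D (?\<sigma> h)"
        by (rule induced_distribution_eq[OF subL gen \<sigma>(2)[OF h\<epsilon>], symmetric])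
      finally show "tangent_map S M (\<lambda>s. s) s ` tangent_space S s = induced_distribution D s"
        unfolding h(2) .
    qed
  qed
qed

end
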